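(* Fix the number of regressors $p$, i.e. assume $p=O(1)$ as $n\to\infty$. Then every function $F\in\mathsf{GEN}$ can be minimized over $\mathbb{R}^p$ in polynomial time; that is, for rational data $(X,y)$ and with the coefficient vectors $a$ supplied by an oracle, the problem $\min_{\beta\in\mathbb{R}^p}F(\beta)$ can be solved in time polynomial in the bitsize $L$ of $(X,y)$.
   Context: Let $X\in\mathbb{R}^{n\times p}$ have rows $x_1^{T},\dots,x_n^{T}$, let $y\in\mathbb{R}^n$, and for $\beta\in\mathbb{R}^p$ let $r_i^\beta=y_i-x_i^{T}\beta$ be the $i$th residual. $\mathcal{S}_n$ is the set of permutations of $\{1,\dots,n\}$. For $\pi\in\mathcal{S}_n$ let $C^\pi=\{\beta\in\mathbb{R}^p : r^\beta_{\pi(1)}\le r^\beta_{\pi(2)}\le\dots\le r^\beta_{\pi(n)}\}$; when $C^\pi$ is full-dimensional it is called a cell, and $\mathcal{C}$ denotes the set of $\pi\in\mathcal{S}_n$ for which $C^\pi$ is a cell. $\mathsf{GEN}$ is the class of functions $F(\beta)=\sum_{i=1}^n a_i^\beta (y_i-x_i^{T}\beta)$, $\beta\in\mathbb{R}^p$, with real coefficients $a_i^\beta$ depending on $\beta$, such that: (1a) the matrix $(X,y)$ contains no pair of identical rows; (1b) if $\beta,\beta'\in\mathbb{R}^p$ and $\pi\in\mathcal{S}_n$ satisfy $r^\beta_{\pi(1)}<\dots<r^\beta_{\pi(n)}$ and $r^{\beta'}_{\pi(1)}<\dots<r^{\beta'}_{\pi(n)}$, then $a_i^\beta=a_i^{\beta'}$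 for all $i$ (so for $\pi\in\mathcal{C}$ the coefficients are constant on the interior of $C^\pi$; denote the constant vector by $a^\pi$); (2) $F$ is lower semicontinuous, in the sense that at points outside the interiors of the cells $F$ takes the lowest of the values inherited from the cells containing the point: $F(\beta)=\min\{\sum_{i=1}^n a_i^{\pi}r_i^\beta : \pi\in\mathcal{C},\ \beta\in C^\pi\}$. Computational model: the data $(X,y)$ are rational with bitsize $L$ (total number of bits needed to write the numerators and denominators of the entries in binary, plus signs). Given a permutation $\pi$, the coefficient vector is returned by an external oracle (the time for its computation is disregarded), and the bitsize of each vector $(a_1^\beta,\dots,a_n^\beta)$ is bounded by a polynomial in $L$. Minimizing $F$ includes recognizing that $F$ is unbounded from below. *)

theory Defs
  imports
    "HOL-Analysis.Analysis"
    "HOL-Combinatorics.Permutations"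
    "HOL-Computational_Algebra.Polynomial"
    "HOL-Library.Log_Nat"
begin

section \<open>Residuals, cells and the class GEN\<close>

text \<open>
  Observations are numbered \<open>0, \<dots>, n - 1\<close>, and \<open>\<real>\<^sup>p\<close> is the space
  \<^const>\<open>Euclidean_space\<close> \<open>p\<close>, whose points are the functions
  \<open>\<beta> :: nat \<Rightarrow> real\<close> with \<open>\<beta> j = 0\<close> for \<open>j \<ge> p\<close>.
  Only the entries \<open>X i j\<close>, \<open>y i\<close> with \<open>i < n\<close>, \<open>j < p\<close> matter.
\<close>

abbreviation Rp :: "nat \<Rightarrow> (nat \<Rightarrow> real) set" where
  "Rp p \<equiv> topspace (Euclidean_space p)"

definition residual ::
  "nat \<Rightarrow> (nat \<Rightarrow> nat \<Rightarrow> real) \<Rightarrow> (nat \<Rightarrow> real) \<Rightarrow> (nat \<Rightarrow> real) \<Rightarrow> nat \<Rightarrow> real" where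
  "residual p X y \<beta> i = y i - (\<Sum>j<p. X i j * \<beta> j)"

definition C_of ::
  "nat \<Rightarrow> nat \<Rightarrow> (nat \<Rightarrow> nat \<Rightarrow> real) \<Rightarrow> (nat \<Rightarrow> real) \<Rightarrow> (nat \<Rightarrow> nat) \<Rightarrow> (nat \<Rightarrow> real) set" where
  "C_of n p X y \<pi> =
     {\<beta> \<in> Rp p. \<forall>k. Suc k < n \<longrightarrow> residual p X y \<beta> (\<pi> k) \<le> residual p X y \<beta> (\<pi> (Suc k))}"

definition strict_C_of ::
  "nat \<Rightarrow> nat \<Rightarrow> (nat \<Rightarrow> nat \<Rightarrow> real) \<Rightarrow> (nat \<Rightarrow> real) \<Rightarrow> (nat \<Rightarrow> nat) \<Rightarrow> (nat \<Rightarrow> real) set" where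
  "strict_C_of n p X y \<pi> =
     {\<beta> \<in> Rp p. \<forall>k. Suc k < n \<longrightarrow> residual p X y \<beta> (\<pi> k) < residual p X y \<beta> (\<pi> (Suc k))}"

text \<open>A convex subset of \<open>\<real>\<^sup>p\<close> is full-dimensional iff its interior is nonempty.\<close>

definition cell_interior ::
  "nat \<Rightarrow> nat \<Rightarrow> (nat \<Rightarrow> nat \<Rightarrow> real) \<Rightarrow> (nat \<Rightarrow> real) \<Rightarrow> (nat \<Rightarrow> nat) \<Rightarrow> (nat \<Rightarrow> real) set" where
  "cell_interior n p X y \<pi> = Euclidean_space p interior_of C_of n p X y \<pi>"

definition cells ::
  "nat \<Rightarrow> nat \<Rightarrow> (nat \<Rightarrow> nat \<Rightarrow> real) \<Rightarrow> (nat \<Rightarrow> real) \<Rightarrow> (nat \<Rightarrow> nat) set" where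
  "cells n p X y = {\<pi>. \<pi> permutes {..<n} \<and> cell_interior n p X y \<pi> \<noteq> {}}"

text \<open>
  The vector \<open>a\<^sup>\<pi>\<close> of a cell.  The choice of the interior point is immaterial for the
  functions in GEN below: since \<open>(X, y)\<close> has no identical rows, the residuals are strictly
  ordered in the interior of a cell, and there the coefficients are constant.
\<close>

definition cell_coef ::
  "nat \<Rightarrow> nat \<Rightarrow> (nat \<Rightarrow> nat \<Rightarrow> real) \<Rightarrow> (nat \<Rightarrow> real) \<Rightarrow> ((nat \<Rightarrow> real) \<Rightarrow> nat \<Rightarrow> 'c)
    \<Rightarrow> (nat \<Rightarrow> nat) \<Rightarrow> nat \<Rightarrow> 'c" where
  "cell_coef n p X y a \<pi> = a (SOME \<beta>. \<beta> \<in> cell_interior n p X y \<pi>)"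

definition no_identical_rows ::
  "nat \<Rightarrow> nat \<Rightarrow> (nat \<Rightarrow> nat \<Rightarrow> real) \<Rightarrow> (nat \<Rightarrow> real) \<Rightarrow> bool" where
  "no_identical_rows n p X y \<longleftrightarrow>
     (\<forall>i<n. \<forall>i'<n. i \<noteq> i' \<longrightarrow> \<not> ((\<forall>j<p. X i j = X i' j) \<and> y i = y i'))"

text \<open>
  \<open>F\<close> belongs to GEN for the data \<open>(X, y)\<close>, with coefficients \<open>a \<beta> i\<close>.  The last conjunct is
  lower semicontinuity: \<open>F\<close> takes the lowest value inherited from the cells containing \<open>\<beta>\<close>.
  (The minimum is over a finite nonempty set, as the cells cover \<open>\<real>\<^sup>p\<close>.)
\<close>

definition in_GEN ::
  "nat \<Rightarrow> nat \<Rightarrow> (nat \<Rightarrow> nat \<Rightarrow> real) \<Rightarrow> (nat \<Rightarrow> real) \<Rightarrow> ((nat \<Rightarrow> real) \<Rightarrow> nat \<Rightarrow> real)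
    \<Rightarrow> ((nat \<Rightarrow> real) \<Rightarrow> real) \<Rightarrow> bool" where
  "in_GEN n p X y a F \<longleftrightarrow>
     (\<forall>\<beta>\<in>Rp p. F \<beta> = (\<Sum>i<n. a \<beta> i * residual p X y \<beta> i)) \<and>
     no_identical_rows n p X y \<and>
     (\<forall>\<pi> \<beta> \<beta>'. \<pi> permutes {..<n} \<longrightarrow> \<beta> \<in> strict_C_of n p X y \<pi> \<longrightarrow> \<beta>' \<in> strict_C_of n p X y \<pi>
        \<longrightarrow> (\<forall>i<n. a \<beta> i = a \<beta>' i)) \<and>
     (\<forall>\<beta>\<in>Rp p. F \<beta> =
        Min {\<Sum>i<n. cell_coef n p X y a \<pi> i * residual p X y \<beta> i | \<pi>.
               \<pi> \<in> cells n p X y \<and> \<beta> \<in> C_of n p X y \<pi>})"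


section \<open>Bitsize\<close>

definition bin_digits :: "nat \<Rightarrow> nat" where
  "bin_digits m = max 1 (floorlog 2 m)"

text \<open>Numerator and denominator in lowest terms, plus one bit for the sign.\<close>

definition rat_bits :: "rat \<Rightarrow> nat" where
  "rat_bits q = (case quotient_of q of (a, b) \<Rightarrow> 1 + bin_digits (nat \<bar>a\<bar>) + bin_digits (nat b))"

definition vec_bits :: "nat \<Rightarrow> (nat \<Rightarrow> rat) \<Rightarrow> nat" where
  "vec_bits n v = (\<Sum>i<n. rat_bits (v i))"

definition data_bits :: "nat \<Rightarrow> nat \<Rightarrow> (nat \<Rightarrow> nat \<Rightarrow> rat) \<Rightarrow> (nat \<Rightarrow> rat) \<Rightarrow> nat" where
  "data_bits n p X y = (\<Sum>i<n. vec_bits p (X i) + rat_bits (y i))"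


section \<open>Programs and their running time\<close>

text \<open>
  The model of computation is a small language of structured programs with an external source
  \<open>Q\<close> of answers.  A program transforms one value, which is a binary tree with integers at its
  leaves.  Time is bit cost: reading, copying or writing a value costs at least its size in bits,
  and the time of an arithmetic operation is quadratic in the bit length of its operands, as in
  schoolbook multiplication.  An answer of \<open>Q\<close> is obtained for the cost of writing the question
  and reading the answer.  In particular no run produces a value larger than its
  running time (lemma \<open>run_size\<close>), so that the model and multitape Turing machines
  with an answer tape simulate each other with polynomial overhead.
\<close>

datatype val = Leaf int | Node val val

fun val_size :: "val \<Rightarrow> nat" where
  "val_size (Leaf z) = 1 + bin_digits (nat \<bar>z\<bar>)"
| "val_size (Node v w) = 1 + val_size v + val_size w"

datatype prim = Add | Sub | Mul | Leq | Left | Right | Is_Node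

text \<open>Undefined (\<^const>\<open>None\<close>) when the argument has the wrong shape; the run is then stuck.\<close>

fun prim_apply :: "prim \<Rightarrow> val \<Rightarrow> val option" where
  "prim_apply Add (Node (Leaf a) (Leaf b)) = Some (Leaf (a + b))"
| "prim_apply Sub (Node (Leaf a) (Leaf b)) = Some (Leaf (a - b))"
| "prim_apply Mul (Node (Leaf a) (Leaf b)) = Some (Leaf (a * b))"
| "prim_apply Leq (Node (Leaf a) (Leaf b)) = Some (Leaf (if a \<le> b then 1 else 0))"
| "prim_apply Left (Node v w) = Some v"
| "prim_apply Right (Node v w) = Some w"
| "prim_apply Is_Node (Node v w) = Some (Leaf 1)"
| "prim_apply Is_Node (Leaf z) = Some (Leaf 0)"
| "prim_apply _ _ = None"

datatype prog =
    Skip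
  | Const val
  | Prim prim
  | Ask
  | Seq prog prog
  | Fork prog prog
  | If prog prog prog
  | While prog prog

text \<open>
  \<open>run Q c v w t\<close>: with answers given by \<open>Q\<close>, program \<open>c\<close> started on \<open>v\<close> halts with result \<open>w\<close>
  after time \<open>t\<close>.  Tests succeed on every nonzero integer.
\<close>

inductive run :: "(val \<Rightarrow> val) \<Rightarrow> prog \<Rightarrow> val \<Rightarrow> val \<Rightarrow> nat \<Rightarrow> bool" for Q where
  Skip: "run Q Skip v v (val_size v)"
| Const: "run Q (Const w) v w (val_size v + val_size w)"
| Prim: "prim_apply f v = Some w \<Longrightarrow> run Q (Prim f) v w ((val_size v)\<^sup>2)"
| Ask: "run Q Ask v (Q v) (val_size v + val_size (Q v))"
| Seq: "run Q c v u s \<Longrightarrow> run Q d u w t \<Longrightarrow> run Q (Seq c d) v w (s + t + 1)"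
| Fork: "run Q c v u s \<Longrightarrow> run Q d v w t \<Longrightarrow>
         run Q (Fork c d) v (Node u w) (s + t + val_size v + 1)"
| IfTrue: "run Q b v (Leaf z) s \<Longrightarrow> z \<noteq> 0 \<Longrightarrow> run Q c v w t \<Longrightarrow>
         run Q (If b c d) v w (s + t + val_size v + 1)"
| IfFalse: "run Q b v (Leaf 0) s \<Longrightarrow> run Q d v w t \<Longrightarrow>
         run Q (If b c d) v w (s + t + val_size v + 1)"
| WhileTrue: "run Q b v (Leaf z) r \<Longrightarrow> z \<noteq> 0 \<Longrightarrow> run Q c v u s \<Longrightarrow> run Q (While b c) u w t \<Longrightarrow>
         run Q (While b c) v w (r + s + t + val_size v + 1)"
| WhileFalse: "run Q b v (Leaf 0) r \<Longrightarrow> run Q (While b c) v v (r + val_size v + 1)"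

inductive_cases run_SkipE: "run Q Skip v w t"
inductive_cases run_ConstE: "run Q (Const u) v w t"
inductive_cases run_PrimE: "run Q (Prim f) v w t"
inductive_cases run_AskE: "run Q Ask v w t"
inductive_cases run_SeqE: "run Q (Seq c d) v w t"
inductive_cases run_ForkE: "run Q (Fork c d) v w t"
inductive_cases run_IfE: "run Q (If b c d) v w t"
inductive_cases run_WhileE: "run Q (While b c) v w t"

lemma run_deterministic:
  assumes "run Q c v w t" and "run Q c v w' t'"
  shows "w' = w \<and> t' = t"
  using assms
proof (induction arbitrary: w' t' rule: run.induct)
  case (Skip v) then show ?case by (auto elim: run_SkipE)
next
  case (Const w v) then show ?case by (auto elim: run_ConstE)
next
  case (Prim f v w) then show ?case by (auto elim: run_PrimE)
next
  case (Ask v) then show ?case by (auto elim: run_AskE)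
next
  case (Seq c v u s d w t)
  show ?case
  proof (rule run_SeqE[OF Seq.prems])
    fix u' s1 t1
    assume c: "run Q c v u' s1" and d: "run Q d u' w' t1" and t': "t' = Suc (s1 + t1)"
    from Seq.IH(1)[OF c] d have "run Q d u w' t1" by simp
    from Seq.IH(1)[OF c] Seq.IH(2)[OF this] t' show ?thesis by simp
  qed
next
  case (Fork c v u s d w t)
  show ?case
  proof (rule run_ForkE[OF Fork.prems])
    fix u' s1 w1 t1
    assume c: "run Q c v u' s1" and d: "run Q d v w1 t1"
      and eqs: "w' = Node u' w1" "t' = Suc (s1 + t1 + val_size v)"
    from Fork.IH(1)[OF c] Fork.IH(2)[OF d] eqs show ?thesis by simp
  qed
next
  case (IfTrue b v z s c w t d)
  show ?case
  proof (rule run_IfE[OF IfTrue.prems])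
    fix z1 s1 t1
    assume b: "run Q b v (Leaf z1) s1" and c: "run Q c v w' t1"
      and t': "t' = Suc (s1 + t1 + val_size v)"
    from IfTrue.IH(1)[OF b] IfTrue.IH(2)[OF c] t' show ?thesis by simp
  next
    fix s1 t1
    assume b: "run Q b v (Leaf 0) s1"
    from IfTrue.IH(1)[OF b] \<open>z \<noteq> 0\<close> show ?thesis by simp
  qed
next
  case (IfFalse b v s d w t c)
  show ?case
  proof (rule run_IfE[OF IfFalse.prems])
    fix z1 s1 t1
    assume b: "run Q b v (Leaf z1) s1" and z: "z1 \<noteq> 0"
    from IfFalse.IH(1)[OF b] z show ?thesis by simp
  next
    fix s1 t1
    assume b: "run Q b v (Leaf 0) s1" and d: "run Q d v w' t1"
      and t': "t' = Suc (s1 + t1 + val_size v)"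
    from IfFalse.IH(1)[OF b] IfFalse.IH(2)[OF d] t' show ?thesis by simp
  qed
next
  case (WhileTrue b v z r c u s w t)
  show ?case
  proof (rule run_WhileE[OF WhileTrue.prems])
    fix z1 r1 u1 s1 t1
    assume b: "run Q b v (Leaf z1) r1" and c: "run Q c v u1 s1"
      and l: "run Q (While b c) u1 w' t1" and t': "t' = Suc (r1 + s1 + t1 + val_size v)"
    from WhileTrue.IH(2)[OF c] l have "run Q (While b c) u w' t1" by simp
    from WhileTrue.IH(1)[OF b] WhileTrue.IH(2)[OF c] WhileTrue.IH(3)[OF this] t'
    show ?thesis by simp
  next
    fix r1
    assume b: "run Q b v (Leaf 0) r1"
    from WhileTrue.IH(1)[OF b] \<open>z \<noteq> 0\<close> show ?thesis by simp
  qed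
next
  case (WhileFalse b v r c)
  show ?case
  proof (rule run_WhileE[OF WhileFalse.prems])
    fix z1 r1 u1 s1 t1
    assume b: "run Q b v (Leaf z1) r1" and z: "z1 \<noteq> 0"
    from WhileFalse.IH(1)[OF b] z show ?thesis by simp
  next
    fix r1
    assume b: "run Q b v (Leaf 0) r1" and eqs: "w' = v" "t' = Suc (r1 + val_size v)"
    from WhileFalse.IH(1)[OF b] eqs show ?thesis by simp
  qed
qed

lemma bin_digits_le_iff: "0 < k \<Longrightarrow> bin_digits m \<le> k \<longleftrightarrow> m < 2 ^ k"
  unfolding bin_digits_def by (auto simp: floorlog_le_iff Suc_le_eq)

lemma less_power_bin_digits: "m < 2 ^ bin_digits m"
  using bin_digits_le_iff[of "bin_digits m" m] by (simp add: bin_digits_def)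

lemma bin_digits_pos: "0 < bin_digits m"
  by (simp add: bin_digits_def)

lemma bin_digits_mono: "m \<le> m' \<Longrightarrow> bin_digits m \<le> bin_digits m'"
  unfolding bin_digits_def by (intro max.mono floorlog_mono order_refl)

lemma bin_digits_add: "bin_digits (m + k) \<le> bin_digits m + bin_digits k"
proof -
  have "m + 1 \<le> 2 ^ bin_digits m" "k + 1 \<le> 2 ^ bin_digits k"
    using less_power_bin_digits by (simp_all add: Suc_le_eq)
  then have "(m + 1) * (k + 1) \<le> 2 ^ bin_digits m * 2 ^ bin_digits k"
    by (rule mult_le_mono)
  then have "m + k < 2 ^ (bin_digits m + bin_digits k)"
    by (simp add: power_add)
  then show ?thesis by (simp add: bin_digits_le_iff bin_digits_pos)
qed

lemma bin_digits_mult: "bin_digits (m * k) \<le> bin_digits m + bin_digits k"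
proof -
  have "m * k < 2 ^ bin_digits m * 2 ^ bin_digits k"
    using less_power_bin_digits by (intro mult_strict_mono) auto
  then show ?thesis by (simp add: bin_digits_le_iff bin_digits_pos power_add)
qed

lemma prim_apply_size: "prim_apply f v = Some w \<Longrightarrow> val_size w \<le> val_size v"
proof (induction f v rule: prim_apply.induct)
  case (1 a b)
  have "bin_digits (nat \<bar>a + b\<bar>) \<le> bin_digits (nat \<bar>a\<bar> + nat \<bar>b\<bar>)"
    by (rule bin_digits_mono) linarith
  with 1 show ?case using bin_digits_add[of "nat \<bar>a\<bar>" "nat \<bar>b\<bar>"] by auto
next
  case (2 a b)
  have "bin_digits (nat \<bar>a - b\<bar>) \<le> bin_digits (nat \<bar>a\<bar> + nat \<bar>b\<bar>)"
    by (rule bin_digits_mono) linarith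
  with 2 show ?case using bin_digits_add[of "nat \<bar>a\<bar>" "nat \<bar>b\<bar>"] by auto
next
  case (3 a b)
  then show ?case
    using bin_digits_mult[of "nat \<bar>a\<bar>" "nat \<bar>b\<bar>"] by (auto simp: abs_mult nat_mult_distrib)
next
  case (7 v w)
  have "0 < val_size v" by (cases v) auto
  with 7 show ?case by (auto simp: bin_digits_def floorlog_def)
qed (auto simp: bin_digits_def floorlog_def)

lemma run_size: "run Q c v w t \<Longrightarrow> val_size w \<le> t"
proof (induction rule: run.induct)
  case (Prim f v w)
  then show ?case
    using prim_apply_size[OF Prim] by (metis le_square le_trans power2_eq_square)
qed auto


section \<open>Encodings\<close>

fun enc_list :: "val list \<Rightarrow> val" where
  "enc_list [] = Leaf 0"
| "enc_list (v # vs) = Node v (enc_list vs)"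

definition enc_rat :: "rat \<Rightarrow> val" where
  "enc_rat q = (case quotient_of q of (a, b) \<Rightarrow> Node (Leaf a) (Leaf b))"

definition enc_vec :: "nat \<Rightarrow> (nat \<Rightarrow> rat) \<Rightarrow> val" where
  "enc_vec n v = enc_list (map (\<lambda>i. enc_rat (v i)) [0..<n])"

definition enc_perm :: "nat \<Rightarrow> (nat \<Rightarrow> nat) \<Rightarrow> val" where
  "enc_perm n \<pi> = enc_list (map (\<lambda>k. Leaf (int (\<pi> k))) [0..<n])"

text \<open>The input is the list of the rows of the matrix \<open>(X, y)\<close>.\<close>

definition enc_data :: "nat \<Rightarrow> nat \<Rightarrow> (nat \<Rightarrow> nat \<Rightarrow> rat) \<Rightarrow> (nat \<Rightarrow> rat) \<Rightarrow> val" where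
  "enc_data n p X y =
     enc_list (map (\<lambda>i. enc_vec (Suc p) (\<lambda>j. if j < p then X i j else y i)) [0..<n])"

text \<open>Computed rationals need not be in lowest terms.\<close>

definition represents :: "val \<Rightarrow> real \<Rightarrow> bool" where
  "represents v x \<longleftrightarrow>
     (\<exists>a b. b \<noteq> 0 \<and> v = Node (Leaf a) (Leaf b) \<and> x = real_of_int a / real_of_int b)"

definition represents_point :: "nat \<Rightarrow> val \<Rightarrow> (nat \<Rightarrow> real) \<Rightarrow> bool" where
  "represents_point p v \<beta> \<longleftrightarrow>
     \<beta> \<in> Rp p \<and> (\<exists>vs. v = enc_list vs \<and> length vs = p \<and> (\<forall>j<p. represents (vs ! j) (\<beta> j)))"


section \<open>Minimization\<close>

text \<open>
  A correct result is either the report that \<open>F\<close> is unbounded from below, \<open>Leaf 0\<close>, or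
  a minimizer of \<open>F\<close> together with the minimum.
\<close>

definition minimization_result :: "nat \<Rightarrow> ((nat \<Rightarrow> real) \<Rightarrow> real) \<Rightarrow> val \<Rightarrow> bool" where
  "minimization_result p F out \<longleftrightarrow>
     (\<not> bdd_below (F ` Rp p) \<and> out = Leaf 0) \<or>
     (\<exists>\<beta> v w. out = Node v w \<and> represents_point p v \<beta> \<and> represents w (F \<beta>) \<and>
        (\<forall>\<beta>'\<in>Rp p. F \<beta> \<le> F \<beta>'))"

text \<open>
  \<open>Q\<close> returns \<open>a\<^sup>\<pi>\<close> when asked for the permutation \<open>\<pi>\<close> of a cell; its other
  answers are arbitrary, since \<open>a\<^sup>\<pi>\<close> is defined for cells only.
\<close>

definition answers_coefs ::
  "nat \<Rightarrow> nat \<Rightarrow> (nat \<Rightarrow> nat \<Rightarrow> real) \<Rightarrow> (nat \<Rightarrow> real) \<Rightarrow> ((nat \<Rightarrow> real) \<Rightarrow> nat \<Rightarrow> rat)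
    \<Rightarrow> (val \<Rightarrow> val) \<Rightarrow> bool" where
  "answers_coefs n p X y a Q \<longleftrightarrow>
     (\<forall>\<pi>\<in>cells n p X y. Q (enc_perm n \<pi>) = enc_vec n (cell_coef n p X y a \<pi>))"

end

theory Submission
  imports Defs
begin

text \<open>
In the interior of each cell \<open>F\<close> is affine, and everywhere it is the least of the affine functions of
the cells containing the point.  Minimizing \<open>F\<close> therefore means minimizing one affine function
over each closed cell.  As \<open>p\<close> is a constant, this can be done without a linear programming
algorithm, by exhausting a set of sample points that has polynomial size.

The point \<open>\<beta>\<close> becomes the vector \<open>(-\<beta>, 1)\<close> of length \<open>p + 1\<close>, on which the rows \<open>R i\<close> of the
integer matrix proportional to \<open>(X, y)\<close> evaluate to multiples of the residuals.  The differences
\<open>R i - R k\<close>, together with the last coordinate (the height), form a central arrangement \<open>H\<close> of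
hyperplanes.  The points \<open>samples\<close> come from a cylindrical decomposition of \<open>H\<close>: one
coordinate is eliminated by forming, for any two functionals, the combination in which it cancels,
the samples of these eliminants are found recursively, and over each of them the midpoints of any
two roots and the neighbours of every root are taken.  Each of the \<open>p + 1\<close> steps raises the number
of functionals and the length of the numbers at most polynomially.

Two facts make the samples sufficient.  By \<open>samples_meet_every_face\<close> they meet every face, so that
every cell is found, as the ranking of the residuals at a sample of positive height without ties;
and the oracle is only ever asked about cells.  By \<open>nonneg_on_samples_imp_nonneg\<close> a
linear function that is nonnegative at the samples in a closed face is nonnegative on the face, so
that these samples do the work of the vertices and extreme rays of the face.  Hence
\<open>F\<close> is unbounded from below iff the linear function of some cell decreases along a sample of height
\<open>0\<close> in the recession cone of the cell, and otherwise the minimum is attained at a sample of positive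
height.

That the cells cover \<open>\<real>\<^sup>p\<close>, and that the residuals are strictly ordered somewhere in each of them, is
seen by moving along the curve \<open>\<beta> + (\<delta>, \<delta>\<^sup>2, \<dots>, \<delta>\<^sup>p)\<close>: the difference of two residuals is a
polynomial in \<open>\<delta>\<close>, which is not zero because the rows of \<open>(X, y)\<close> differ.

The running time is controlled by the predicate \<open>polytime\<close> on functions between encodable types.  It
is closed under composition, maps, filters and those folds whose intermediate values remain
polynomially bounded.  The algorithm consists of a polynomial time function that finds samples in
all cells, one question for each of these samples, and a polynomial time function of the answers.
\<close>

section \<open>Encodable types\<close>

text \<open>
Values are untyped trees.  With a fixed representation of each type, functions of HOL can be
composed instead of programs.
\<close>

class encodable =
  fixes encode :: "'a \<Rightarrow> val"

instantiation int :: encodable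
begin
definition encode_int :: "int \<Rightarrow> val" where "encode_int z = Leaf z"
instance ..
end

instantiation bool :: encodable
begin
definition encode_bool :: "bool \<Rightarrow> val" where "encode_bool b = Leaf (if b then 1 else 0)"
instance ..
end

instantiation prod :: (encodable, encodable) encodable
begin
definition encode_prod :: "'a \<times> 'b \<Rightarrow> val" where
  "encode_prod z = Node (encode (fst z)) (encode (snd z))"
instance ..
end

instantiation list :: (encodable) encodable
begin
definition encode_list :: "'a list \<Rightarrow> val" where "encode_list xs = enc_list (map encode xs)"
instance ..
end

text \<open>
There is no tag for \<^const>\<open>Some\<close>, since \<^const>\<open>minimization_result\<close> distinguishes its two cases
only by their shape.
\<close>

instantiation option :: (encodable) encodable
begin
definition encode_option :: "'a option \<Rightarrow> val" where
  "encode_option x = (case x of None \<Rightarrow> Leaf 0 | Some a \<Rightarrow> encode a)"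
instance ..
end

lemma encode_simps [simp]:
  "encode z = Leaf z" "encode b = Leaf (if b then 1 else 0)"
  "encode (u, v) = Node (encode u) (encode v)"
  "encode [] = Leaf 0" "encode (x # xs) = Node (encode x) (encode xs)"
  "encode None = Leaf 0" "encode (Some x) = encode x"
  by (simp_all add: encode_int_def encode_bool_def encode_prod_def encode_list_def encode_option_def)

abbreviation sz :: "'a :: encodable \<Rightarrow> nat" where
  "sz x \<equiv> val_size (encode x)"

lemma val_size_ge_2: "2 \<le> val_size v"
proof (cases v)
  case (Leaf z)
  then show ?thesis using bin_digits_pos[of "nat \<bar>z\<bar>"] by simp
next
  case (Node a b)
  then show ?thesis by (cases a; cases b) (use bin_digits_pos in \<open>auto simp: Suc_le_eq\<close>)
qed

lemma bin_digits_0_1 [simp]: "bin_digits 0 = 1" "bin_digits (Suc 0) = 1"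
  by (simp_all add: bin_digits_def floorlog_def)

lemma sz_Nil [simp]: "sz ([] :: 'a :: encodable list) = 2"
  and sz_Cons [simp]: "sz (x # xs) = Suc (sz x + sz xs)"
  and sz_Pair [simp]: "sz (u, v) = Suc (sz u + sz v)"
  and sz_bool [simp]: "sz (b :: bool) = 2"
  by (simp_all del: val_size.simps add: val_size.simps)

lemma sz_prod: "sz z = Suc (sz (fst z) + sz (snd z))"
  by (metis prod.collapse sz_Pair)

lemma sz_append: "sz (xs @ ys) + 2 = sz xs + sz ys"
  by (induction xs) auto

lemma sz_append_le: "sz (xs @ ys) \<le> sz xs + sz ys"
  using sz_append[of xs ys] by linarith

lemma sz_member: "x \<in> set xs \<Longrightarrow> sz x \<le> sz xs"
  by (induction xs) auto

lemma length_le_sz: "length xs \<le> sz xs"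
  by (induction xs) auto

lemma sz_list_le:
  assumes "\<And>x. x \<in> set xs \<Longrightarrow> sz x \<le> B"
  shows "sz xs \<le> length xs * (B + 1) + 2"
  using assms
proof (induction xs)
  case (Cons a xs)
  then have "sz a \<le> B" "sz xs \<le> length xs * (B + 1) + 2" by auto
  then show ?case by simp
qed simp

lemma sz_filter: "sz (filter P xs) \<le> sz xs"
  by (induction xs) auto

lemma sz_rev: "sz (rev xs) = sz xs"
proof (induction xs)
  case (Cons a xs)
  then show ?case using sz_append[of "rev xs" "[a]"] by simp
qed simp

section \<open>Polynomial bounds\<close>

text \<open>
All sizes are at least 2; hence powers of the size absorb constant factors and sums.
\<close>

definition poly_bounded :: "('a :: encodable \<Rightarrow> nat) \<Rightarrow> bool" where
  "poly_bounded g \<longleftrightarrow> (\<exists>k. \<forall>x. g x \<le> sz x ^ k)"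

lemma poly_bounded_mono: "poly_bounded g \<Longrightarrow> (\<And>x. f x \<le> g x) \<Longrightarrow> poly_bounded f"
  unfolding poly_bounded_def using le_trans by blast

lemma poly_bounded_sz: "poly_bounded sz"
  unfolding poly_bounded_def by (metis order_refl power_one_right)

lemma poly_bounded_const: "poly_bounded (\<lambda>x. n)"
proof -
  have "n \<le> sz (x :: 'a) ^ n" for x
  proof -
    have "n \<le> 2 ^ n" by (rule less_imp_le[OF less_exp])
    also have "\<dots> \<le> sz x ^ n" by (rule power_mono[OF val_size_ge_2]) simp
    finally show ?thesis .
  qed
  then show ?thesis unfolding poly_bounded_def by blast
qed

lemma power_add_le_sz: "sz x ^ j + sz x ^ k \<le> sz x ^ (Suc (j + k))"
proof -
  have "sz x ^ j \<le> sz x ^ (j + k)" "sz x ^ k \<le> sz x ^ (j + k)"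
    using val_size_ge_2[of "encode x"] by (auto intro!: power_increasing)
  then have "sz x ^ j + sz x ^ k \<le> 2 * sz x ^ (j + k)" by simp
  also have "\<dots> \<le> sz x * sz x ^ (j + k)" by (rule mult_le_mono1[OF val_size_ge_2])
  finally show ?thesis by simp
qed

lemma poly_bounded_add: "poly_bounded f \<Longrightarrow> poly_bounded g \<Longrightarrow> poly_bounded (\<lambda>x. f x + g x)"
  unfolding poly_bounded_def by (meson add_mono le_trans power_add_le_sz)

lemma poly_bounded_mult: "poly_bounded f \<Longrightarrow> poly_bounded g \<Longrightarrow> poly_bounded (\<lambda>x. f x * g x)"
  unfolding poly_bounded_def by (metis mult_le_mono power_add)

lemma poly_bounded_power: "poly_bounded f \<Longrightarrow> poly_bounded (\<lambda>x. f x ^ k)"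
  by (induction k) (auto intro: poly_bounded_const poly_bounded_mult simp: poly_bounded_const)

lemma poly_bounded_Suc: "poly_bounded f \<Longrightarrow> poly_bounded (\<lambda>x. Suc (f x))"
  using poly_bounded_add[OF _ poly_bounded_const, of f 1] by simp

lemmas poly_bounded_intros =
  poly_bounded_sz poly_bounded_const poly_bounded_add poly_bounded_mult poly_bounded_power
  poly_bounded_Suc

section \<open>Functions computable in polynomial time\<close>

definition runs_within :: "(val \<Rightarrow> val) \<Rightarrow> prog \<Rightarrow> val \<Rightarrow> val \<Rightarrow> nat \<Rightarrow> bool" where
  "runs_within Q c v w b \<longleftrightarrow> (\<exists>t\<le>b. run Q c v w t)"

lemma runs_within_mono: "runs_within Q c v w b \<Longrightarrow> b \<le> b' \<Longrightarrow> runs_within Q c v w b'"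
  unfolding runs_within_def using le_trans by blast

lemma runs_within_size: "runs_within Q c v w b \<Longrightarrow> val_size w \<le> b"
  unfolding runs_within_def using run_size le_trans by blast

lemma runs_within_Seq:
  "runs_within Q c v u s \<Longrightarrow> runs_within Q d u w t \<Longrightarrow> runs_within Q (Seq c d) v w (s + t + 1)"
  unfolding runs_within_def by (meson add_mono run.Seq order_refl)

lemma runs_within_Fork:
  "runs_within Q c v u s \<Longrightarrow> runs_within Q d v w t \<Longrightarrow>
    runs_within Q (Fork c d) v (Node u w) (s + t + val_size v + 1)"
  unfolding runs_within_def by (meson add_mono run.Fork order_refl)

lemma runs_within_If:
  assumes "runs_within Q b v (encode z) r"
    and "z \<Longrightarrow> runs_within Q c v w s" and "\<not> z \<Longrightarrow> runs_within Q d v w s"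
  shows "runs_within Q (If b c d) v w (r + s + val_size v + 1)"
proof (cases z)
  case True
  with assms obtain r' s' where "run Q b v (Leaf 1) r'" "r' \<le> r" "run Q c v w s'" "s' \<le> s"
    unfolding runs_within_def by auto
  then show ?thesis using run.IfTrue[of Q b v 1 r' c w s' d] unfolding runs_within_def
    by (intro exI[of _ "r' + s' + val_size v + 1"]) auto
next
  case False
  with assms obtain r' s' where "run Q b v (Leaf 0) r'" "r' \<le> r" "run Q d v w s'" "s' \<le> s"
    unfolding runs_within_def by auto
  then show ?thesis using run.IfFalse[of Q b v r' d w s' c] unfolding runs_within_def
    by (intro exI[of _ "r' + s' + val_size v + 1"]) auto
qed

text \<open>
The bound \<open>B\<close> serves the test, the body and the size of the state at once.
\<close>

lemma runs_within_While:
  assumes "\<And>i. i < m \<Longrightarrow> runs_within Q b (v i) (encode True) B"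
    and "\<And>i. i < m \<Longrightarrow> runs_within Q c (v i) (v (Suc i)) B"
    and "runs_within Q b (v m) (encode False) B"
    and "\<And>i. i \<le> m \<Longrightarrow> val_size (v i) \<le> B"
  shows "runs_within Q (While b c) (v 0) (v m) (Suc m * (3 * B + 1))"
  using assms
proof (induction m arbitrary: v)
  case 0
  then obtain r where "run Q b (v 0) (Leaf 0) r" "r \<le> B" "val_size (v 0) \<le> B"
    unfolding runs_within_def by auto
  then show ?case using run.WhileFalse[of Q b "v 0" r c] unfolding runs_within_def
    by (intro exI[of _ "r + val_size (v 0) + 1"]) auto
next
  case (Suc m)
  have "runs_within Q (While b c) (v (Suc 0)) (v (Suc m)) (Suc m * (3 * B + 1))"
    using Suc.IH[of "\<lambda>i. v (Suc i)"] Suc.prems by auto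
  then obtain t where t: "run Q (While b c) (v (Suc 0)) (v (Suc m)) t" "t \<le> Suc m * (3 * B + 1)"
    unfolding runs_within_def by auto
  obtain r s where r: "run Q b (v 0) (Leaf 1) r" "r \<le> B" "run Q c (v 0) (v (Suc 0)) s" "s \<le> B"
    using Suc.prems(1,2)[of 0] unfolding runs_within_def by auto
  have "val_size (v 0) \<le> B" using Suc.prems(4)[of 0] by simp
  then have "r + s + t + val_size (v 0) + 1 \<le> Suc (Suc m) * (3 * B + 1)"
    using r t by simp
  then show ?case using run.WhileTrue[of Q b "v 0" 1 r c "v (Suc 0)" s "v (Suc m)" t] r t
    unfolding runs_within_def by (intro exI[of _ "r + s + t + val_size (v 0) + 1"]) auto
qed

text \<open>
The program and the exponent are uniform in \<open>Q\<close>, as the result depends on the argument alone.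
\<close>

definition polytime :: "('a :: encodable \<Rightarrow> 'b :: encodable) \<Rightarrow> bool" where
  "polytime f \<longleftrightarrow>
     (\<exists>c k. \<forall>Q x. runs_within Q c (encode x) (encode (f x)) (sz x ^ k))"

lemma polytimeI:
  assumes "\<And>Q x. runs_within Q c (encode x) (encode (f x)) (g x)" and "poly_bounded g"
  shows "polytime f"
  using assms unfolding polytime_def poly_bounded_def by (meson runs_within_mono)

lemma polytimeE:
  assumes "polytime f"
  obtains c g where "\<And>Q x. runs_within Q c (encode x) (encode (f x)) (g x)" and "poly_bounded g"
proof -
  obtain c k where "\<And>Q x. runs_within Q c (encode x) (encode (f x)) (sz x ^ k)"
    using assms unfolding polytime_def by blast
  then show thesis by (rule that) (intro poly_bounded_power poly_bounded_sz)
qed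

lemma polytime_size: "polytime f \<Longrightarrow> poly_bounded (\<lambda>x. sz (f x))"
  unfolding polytime_def poly_bounded_def using runs_within_size by fast

lemma poly_bounded_comp:
  assumes "polytime f" and "poly_bounded g"
  shows "poly_bounded (\<lambda>x. g (f x))"
proof -
  obtain k where "g y \<le> sz y ^ k" for y using assms(2) unfolding poly_bounded_def by blast
  then show ?thesis
    by (rule poly_bounded_mono[OF poly_bounded_power[OF polytime_size[OF assms(1)]]])
qed

text \<open>
Rules that decompose the body of \<open>\<lambda>x. \<dots>\<close> in a goal \<open>polytime (\<lambda>x. \<dots>)\<close>.  The argument of a
map or filter becomes a function of the pair of the context \<open>x\<close> and the list element.
\<close>

named_theorems polytime_intros

lemma polytime_id: "polytime (\<lambda>x. x)"
  by (rule polytimeI[where c = Skip and g = sz])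
    (auto simp: runs_within_def intro: run.Skip poly_bounded_sz)

lemma polytime_const: "polytime (\<lambda>x. a)"
  by (rule polytimeI[where c = "Const (encode a)" and g = "\<lambda>x. sz x + sz a"])
    (auto simp: runs_within_def intro: run.Const poly_bounded_intros)

lemma polytime_comp: "polytime g \<Longrightarrow> polytime f \<Longrightarrow> polytime (\<lambda>x. g (f x))"
proof (elim polytimeE)
  fix c s d t
  assume c: "\<And>Q x. runs_within Q c (encode x) (encode (g x)) (s x)" and s: "poly_bounded s"
    and d: "\<And>Q x. runs_within Q d (encode x) (encode (f x)) (t x)" and t: "poly_bounded t"
  have "polytime f" using d t by (rule polytimeI)
  note s' = poly_bounded_comp[OF this s]
  show "polytime (\<lambda>x. g (f x))"
    by (rule polytimeI[OF runs_within_Seq[OF d c]])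
      (intro poly_bounded_intros t s')
qed

lemma polytime_Pair [polytime_intros]:
  "polytime f \<Longrightarrow> polytime g \<Longrightarrow> polytime (\<lambda>x. (f x, g x))"
proof (elim polytimeE)
  fix c s d t
  assume c: "\<And>Q x. runs_within Q c (encode x) (encode (f x)) (s x)" and s: "poly_bounded s"
    and d: "\<And>Q x. runs_within Q d (encode x) (encode (g x)) (t x)" and t: "poly_bounded t"
  show "polytime (\<lambda>x. (f x, g x))"
    using runs_within_Fork[OF c d]
    by (intro polytimeI[where g = "\<lambda>x. s x + t x + sz x + 1"] poly_bounded_intros s t) auto
qed

lemma polytime_If [polytime_intros]:
  "polytime b \<Longrightarrow> polytime f \<Longrightarrow> polytime g \<Longrightarrow> polytime (\<lambda>x. if b x then f x else g x)"
proof (elim polytimeE)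
  fix bc r c s d t
  assume b: "\<And>Q x. runs_within Q bc (encode x) (encode (b x)) (r x)" and r: "poly_bounded r"
    and c: "\<And>Q x. runs_within Q c (encode x) (encode (f x)) (s x)" and s: "poly_bounded s"
    and d: "\<And>Q x. runs_within Q d (encode x) (encode (g x)) (t x)" and t: "poly_bounded t"
  have "runs_within Q (If bc c d) (encode x) (encode (if b x then f x else g x))
      (r x + (s x + t x) + sz x + 1)" for Q x
    by (rule runs_within_If[OF b]) (auto intro: runs_within_mono[OF c] runs_within_mono[OF d])
  then show "polytime (\<lambda>x. if b x then f x else g x)"
    by (rule polytimeI) (intro poly_bounded_intros r s t)
qed

lemma polytime_prim:
  assumes "\<And>x. prim_apply f (encode x) = Some (encode (g x))"
  shows "polytime g"
  by (rule polytimeI[where c = "Prim f" and g = "\<lambda>x. sz x ^ 2"])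
    (auto simp: runs_within_def intro!: run.Prim assms poly_bounded_intros)

lemma polytime_prims:
  "polytime (fst :: 'a :: encodable \<times> 'b :: encodable \<Rightarrow> 'a)"
  "polytime (snd :: 'a \<times> 'b \<Rightarrow> 'b)"
  "polytime (\<lambda>z :: int \<times> int. fst z + snd z)"
  "polytime (\<lambda>z :: int \<times> int. fst z - snd z)"
  "polytime (\<lambda>z :: int \<times> int. fst z * snd z)"
  "polytime (\<lambda>z :: int \<times> int. fst z \<le> snd z)"
  "polytime (\<lambda>xs :: 'a list. xs \<noteq> [])"
proof -
  have "prim_apply Is_Node (encode xs) = Some (encode (xs \<noteq> []))" for xs :: "'a list"
    by (cases xs) simp_all
  then show "polytime (\<lambda>xs :: 'a list. xs \<noteq> [])" by (rule polytime_prim)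
qed (rule polytime_prim[where f = Left], simp add: encode_prod_def,
    rule polytime_prim[where f = Right], simp add: encode_prod_def,
    rule polytime_prim[where f = Add], simp add: encode_prod_def,
    rule polytime_prim[where f = Sub], simp add: encode_prod_def,
    rule polytime_prim[where f = Mul], simp add: encode_prod_def,
    rule polytime_prim[where f = Leq], simp add: encode_prod_def)

lemma polytime_fst [polytime_intros]: "polytime f \<Longrightarrow> polytime (\<lambda>x. fst (f x))"
  and polytime_snd [polytime_intros]: "polytime f \<Longrightarrow> polytime (\<lambda>x. snd (f x))"
  by (rule polytime_comp, rule polytime_prims, assumption)+

lemma polytime_arith [polytime_intros]:
  assumes "polytime f" and "polytime g"
  shows "polytime (\<lambda>x. f x + g x :: int)" "polytime (\<lambda>x. f x - g x :: int)"
    "polytime (\<lambda>x. f x * g x :: int)" "polytime (\<lambda>x. f x \<le> (g x :: int))"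
  using polytime_prims(3-6)[THEN polytime_comp, OF polytime_Pair[OF assms]] by simp_all

lemma polytime_Not [polytime_intros]: "polytime f \<Longrightarrow> polytime (\<lambda>x. \<not> f x)"
proof -
  assume "polytime f"
  then have "polytime (\<lambda>x. if f x then False else True)" by (intro polytime_If polytime_const)
  moreover have "(\<lambda>x. if f x then False else True) = (\<lambda>x. \<not> f x)" by auto
  ultimately show ?thesis by simp
qed

lemma polytime_conj [polytime_intros]: "polytime f \<Longrightarrow> polytime g \<Longrightarrow> polytime (\<lambda>x. f x \<and> g x)"
proof -
  assume "polytime f" "polytime g"
  then have "polytime (\<lambda>x. if f x then g x else False)" by (intro polytime_If polytime_const)
  moreover have "(\<lambda>x. if f x then g x else False) = (\<lambda>x. f x \<and> g x)" by auto
  ultimately show ?thesis by simp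
qed

lemma polytime_less [polytime_intros]:
  assumes "polytime f" and "polytime g"
  shows "polytime (\<lambda>x. f x < (g x :: int))"
  unfolding not_le[symmetric] by (intro polytime_intros assms)

lemma polytime_eq [polytime_intros]:
  assumes "polytime f" and "polytime g"
  shows "polytime (\<lambda>x. f x = (g x :: int))"
  unfolding order_eq_iff by (intro polytime_intros assms)

lemma polytime_uminus [polytime_intros]: "polytime f \<Longrightarrow> polytime (\<lambda>x. - f x :: int)"
  using polytime_arith(2)[OF polytime_const, of f 0] by simp

lemma polytime_Some [polytime_intros]: "polytime f \<Longrightarrow> polytime (\<lambda>x. Some (f x))"
  unfolding polytime_def by simp

lemma polytime_Cons [polytime_intros]:
  "polytime f \<Longrightarrow> polytime g \<Longrightarrow> polytime (\<lambda>x. f x # g x)"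
  using polytime_Pair[of f g] unfolding polytime_def by simp

lemma polytime_is_Nil [polytime_intros]: "polytime f \<Longrightarrow> polytime (\<lambda>x. f x = [])"
  using polytime_Not[OF polytime_comp[OF polytime_prims(7)], of f] by simp

text \<open>
The program tests for the empty list, on which the primitive would be stuck, and then writes the
value \<open>f []\<close> as a constant, which is possible even if that value is unspecified.
\<close>

lemma polytime_list_component:
  assumes f: "\<And>x xs. prim_apply c (encode (x # xs)) = Some (encode (f (x # xs)))"
  shows "polytime (f :: 'a :: encodable list \<Rightarrow> 'b :: encodable)"
proof (rule polytimeE[OF polytime_prims(7)[where 'a = 'a]])
  fix b g
  assume b: "\<And>Q xs. runs_within Q b (encode xs) (encode (xs \<noteq> ([] :: 'a list))) (g xs)"
    and g: "poly_bounded g"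
  have "runs_within Q (If b (Prim c) (Const (encode (f [])))) (encode xs) (encode (f xs))
      (g xs + (sz xs ^ 2 + sz xs + sz (f [])) + sz xs + 1)" for Q xs
  proof (rule runs_within_If[OF b])
    assume "xs \<noteq> []"
    then obtain y ys where "xs = y # ys" by (cases xs) auto
    then show "runs_within Q (Prim c) (encode xs) (encode (f xs)) (sz xs ^ 2 + sz xs + sz (f []))"
      unfolding runs_within_def using run.Prim[OF f] by (intro exI[of _ "sz xs ^ 2"]) auto
  next
    assume "\<not> xs \<noteq> []"
    then show "runs_within Q (Const (encode (f []))) (encode xs) (encode (f xs))
        (sz xs ^ 2 + sz xs + sz (f []))"
      unfolding runs_within_def using run.Const[of Q "encode (f [])" "encode xs"]
      by (intro exI[of _ "sz xs + sz (f [])"]) auto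
  qed
  then show ?thesis by (rule polytimeI) (intro poly_bounded_intros g)
qed

lemma polytime_hd [polytime_intros]: "polytime f \<Longrightarrow> polytime (\<lambda>x. hd (f x))"
  by (rule polytime_comp[OF polytime_list_component[where c = Left]]) simp_all

lemma polytime_tl [polytime_intros]: "polytime f \<Longrightarrow> polytime (\<lambda>x. tl (f x))"
  by (rule polytime_comp[OF polytime_list_component[where c = Right]]) simp_all

section \<open>List functions in polynomial time\<close>

lemma sz_drop: "sz (drop i xs) \<le> sz xs"
proof (induction xs arbitrary: i)
  case (Cons a xs)
  then show ?case by (cases i) (auto intro: le_SucI trans_le_add2)
qed simp

text \<open>
Iterating a polynomial time step may square the size of the accumulator in every round; a bound on
all intermediate values is what makes the loop polynomial.  The state of the loop consists of the
context \<open>x\<close>, the remaining list and the accumulator.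
\<close>

lemma polytime_fold_bounded:
  assumes F: "polytime (\<lambda>z. F (fst z) (fst (snd z)) (snd (snd z)))"
    and L: "polytime L" and I: "polytime I"
    and bound: "\<And>x ys zs. L x = ys @ zs \<Longrightarrow> sz (fold (F x) ys (I x)) \<le> h x" and h: "poly_bounded h"
  shows "polytime (\<lambda>x. fold (F x) (L x) (I x))"
proof -
  define test where "test = (\<lambda>z :: 'a \<times> 'b list \<times> 'c. fst (snd z) \<noteq> [])"
  define step where "step = (\<lambda>z :: 'a \<times> 'b list \<times> 'c.
      (fst z, tl (fst (snd z)), F (fst z) (hd (fst (snd z))) (snd (snd z))))"
  have "polytime test" unfolding test_def by (intro polytime_intros polytime_id)
  then obtain b r where b: "\<And>Q x. runs_within Q b (encode x) (encode (test x)) (sz x ^ r)"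
    unfolding polytime_def by blast
  have "polytime (\<lambda>z :: 'a \<times> 'b list \<times> 'c. F (fst z) (hd (fst (snd z))) (snd (snd z)))"
    using polytime_comp[OF F, of "\<lambda>z. (fst z, hd (fst (snd z)), snd (snd z))",
        OF polytime_Pair, OF _ polytime_Pair, OF _ polytime_hd]
    by (simp add: polytime_intros polytime_id)
  then have "polytime step" unfolding step_def by (intro polytime_intros polytime_id)
  then obtain c s where c: "\<And>Q x. runs_within Q c (encode x) (encode (step x)) (sz x ^ s)"
    unfolding polytime_def by blast
  have "polytime (\<lambda>x. (x, L x, I x))" by (intro polytime_intros polytime_id L I)
  then obtain d t where d: "\<And>Q x. runs_within Q d (encode x) (encode (x, L x, I x)) (sz x ^ t)"
    unfolding polytime_def by blast
  obtain e u where e: "\<And>Q z. runs_within Q e (encode z) (encode (snd (snd z :: 'b list \<times> 'c))) (sz (z :: 'a \<times> _) ^ u)"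
    using polytime_snd[OF polytime_snd[OF polytime_id]] unfolding polytime_def by blast
  define state where "state x i = (x, drop i (L x), fold (F x) (take i (L x)) (I x))" for x i
  define M where "M x = sz x + sz (L x) + h x + 2" for x
  define B where "B x = M x ^ r + M x ^ s + M x ^ u + M x" for x
  have M: "sz (state x i) \<le> M x" for x i
    using sz_drop[of i "L x"] bound[of x "take i (L x)" "drop i (L x)"]
    by (simp add: state_def M_def)
  have step: "step (state x i) = state x (Suc i)" "test (state x i)" if "i < length (L x)" for x i
    using that by (simp_all add: state_def step_def test_def take_Suc_conv_app_nth hd_drop_conv_nth drop_Suc tl_drop)
  have le: "sz (state x i) ^ k \<le> M x ^ k" for x i k by (rule power_mono[OF M]) simp
  have loop: "runs_within Q (While b c) (encode (state x 0)) (encode (state x (length (L x))))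
      (Suc (length (L x)) * (3 * B x + 1))" for Q x
  proof (rule runs_within_While)
    fix i assume i: "i < length (L x)"
    show "runs_within Q b (encode (state x i)) (encode True) (B x)"
      using b[of Q "state x i"] le[of x i r] step(2)[OF i] unfolding B_def
      by (auto elim!: runs_within_mono)
    show "runs_within Q c (encode (state x i)) (encode (state x (Suc i))) (B x)"
      using c[of Q "state x i"] le[of x i s] step(1)[OF i] unfolding B_def
      by (auto elim!: runs_within_mono)
  next
    show "runs_within Q b (encode (state x (length (L x)))) (encode False) (B x)"
      using b[of Q "state x (length (L x))"] le[of x "length (L x)" r] unfolding B_def
      by (auto elim!: runs_within_mono simp: test_def state_def)
  next
    show "sz (state x i) \<le> B x" for i using M[of x i] by (simp add: B_def)
  qed
  have fin: "runs_within Q e (encode (state x (length (L x)))) (encode (fold (F x) (L x) (I x))) (B x)" for Q x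
    using e[of Q "state x (length (L x))"] le[of x "length (L x)" u] unfolding B_def
    by (auto elim!: runs_within_mono simp: state_def)
  have init: "state x 0 = (x, L x, I x)" for x by (simp add: state_def)
  have B: "poly_bounded B"
    unfolding B_def M_def by (intro poly_bounded_intros polytime_size L h)
  have len: "poly_bounded (\<lambda>x. length (L x))"
    by (rule poly_bounded_mono[OF polytime_size[OF L] length_le_sz])
  show ?thesis
    by (rule polytimeI[OF runs_within_Seq[OF d[folded init] runs_within_Seq[OF loop fin]]])
      (intro poly_bounded_intros B len)
qed

lemma polytime_rev [polytime_intros]:
  assumes "polytime L" shows "polytime (\<lambda>x. rev (L x))"
proof -
  have "polytime (\<lambda>x. fold (\<lambda>r a. r # a) (L x) [])"
  proof (rule polytime_fold_bounded)
    fix x ys zs assume "L x = ys @ zs"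
    then show "sz (fold (#) ys []) \<le> sz (L x)"
      using sz_append[of ys zs] val_size_ge_2[of "encode zs"]
      by (simp add: fold_Cons_rev sz_rev)
  qed (intro polytime_intros polytime_id polytime_const assms polytime_size)+
  then show ?thesis by (simp add: fold_Cons_rev)
qed

lemma polytime_foldr_bounded:
  assumes "polytime (\<lambda>z. F (fst z) (fst (snd z)) (snd (snd z)))"
    and L: "polytime L" and "polytime I"
    and bound: "\<And>x ys zs. L x = ys @ zs \<Longrightarrow> sz (foldr (F x) zs (I x)) \<le> h x" and "poly_bounded h"
  shows "polytime (\<lambda>x. foldr (F x) (L x) (I x))"
  unfolding foldr_conv_fold
proof (rule polytime_fold_bounded)
  fix x ys zs assume "rev (L x) = ys @ zs"
  then have "L x = rev zs @ rev ys" by (metis rev_append rev_rev_ident)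
  then show "sz (fold (F x) ys (I x)) \<le> h x" using bound[of x "rev zs" "rev ys"] by (simp add: foldr_conv_fold)
qed (intro assms polytime_rev)+

lemma sz_suffix: "L = ys @ zs \<Longrightarrow> sz zs \<le> sz L"
  using sz_append[of ys zs] val_size_ge_2[of "encode ys"] by simp

lemma append_eq_foldr: "xs @ ys = foldr (#) xs ys"
  by (induction xs) simp_all

lemma polytime_append [polytime_intros]:
  assumes "polytime f" "polytime g" shows "polytime (\<lambda>x. f x @ g x)"
proof -
  have "polytime (\<lambda>x. foldr (\<lambda>r a. r # a) (f x) (g x))"
  proof (rule polytime_foldr_bounded)
    fix x ys zs assume "f x = ys @ zs"
    then show "sz (foldr (#) zs (g x)) \<le> sz (f x) + sz (g x)"
      using sz_append_le[of zs "g x"] sz_suffix[of "f x" ys zs]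
      by (simp add: append_eq_foldr)
  qed (intro polytime_intros polytime_id assms polytime_size poly_bounded_intros)+
  then show ?thesis by (simp add: append_eq_foldr)
qed

lemma polytime_concat [polytime_intros]:
  assumes "polytime f" shows "polytime (\<lambda>x. concat (f x))"
proof -
  have "polytime (\<lambda>x. foldr (\<lambda>r a. r @ a) (f x) [])"
  proof (rule polytime_foldr_bounded)
    fix x ys zs assume *: "f x = ys @ zs"
    have "sz (foldr (@) zs []) \<le> sz zs"
      by (induction zs) (auto intro: order.trans[OF sz_append_le])
    with sz_suffix[OF *] show "sz (foldr (@) zs []) \<le> sz (f x)" by simp
  qed (intro polytime_intros polytime_id polytime_const assms polytime_size)+
  then show ?thesis by (simp add: concat_conv_foldr)
qed

lemma polytime_binary: "polytime (\<lambda>z. F (fst z) (snd z)) \<Longrightarrow> polytime f \<Longrightarrow> polytime g \<Longrightarrow> polytime (\<lambda>x. F (f x) (g x))"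
  using polytime_comp[OF _ polytime_Pair] by fastforce

lemma map_eq_foldr: "map f xs = foldr (\<lambda>r a. f r # a) xs []"
  by (induction xs) simp_all

lemma polytime_map [polytime_intros]:
  assumes F: "polytime (\<lambda>z. F (fst z) (snd z))" and L: "polytime L"
  shows "polytime (\<lambda>x. map (F x) (L x))"
proof -
  obtain k where k: "sz (F x r) \<le> sz (x, r) ^ k" for x r
    using polytime_size[OF F] unfolding poly_bounded_def by force
  define h where "h x = sz (L x) * ((sz x + sz (L x) + 1) ^ k + 1) + 2" for x
  have "polytime (\<lambda>x. foldr (\<lambda>r a. F x r # a) (L x) [])"
  proof (rule polytime_foldr_bounded)
    fix x ys zs assume *: "L x = ys @ zs"
    have "sz y \<le> (sz x + sz (L x) + 1) ^ k" if "y \<in> set (map (F x) zs)" for y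
    proof -
      from that obtain r where r: "r \<in> set (L x)" "y = F x r" using * by auto
      have "sz y \<le> sz (x, r) ^ k" using k r by simp
      also have "\<dots> \<le> (sz x + sz (L x) + 1) ^ k"
        by (rule power_mono) (use sz_member[OF r(1)] in auto)
      finally show ?thesis .
    qed
    then have "sz (map (F x) zs) \<le> length zs * ((sz x + sz (L x) + 1) ^ k + 1) + 2"
      using sz_list_le[of "map (F x) zs"] by simp
    also have "\<dots> \<le> h x"
      unfolding h_def using length_le_sz[of "L x"] * by (intro add_mono mult_le_mono1) auto
    finally show "sz (foldr (\<lambda>r a. F x r # a) zs []) \<le> h x" by (simp add: map_eq_foldr[symmetric])
  next
    show "poly_bounded h" unfolding h_def by (intro poly_bounded_intros polytime_size L)
  next
    show "polytime (\<lambda>z. F (fst z) (fst (snd z)) # snd (snd z))"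
      by (intro polytime_intros polytime_binary[OF F] polytime_id)
  qed (intro polytime_const L)+
  then show ?thesis by (simp add: map_eq_foldr[symmetric])
qed

lemma filter_eq_foldr: "filter P xs = foldr (\<lambda>r a. if P r then r # a else a) xs []"
  by (induction xs) simp_all

lemma polytime_filter [polytime_intros]:
  assumes P: "polytime (\<lambda>z. P (fst z) (snd z))" and L: "polytime L"
  shows "polytime (\<lambda>x. filter (P x) (L x))"
  unfolding filter_eq_foldr
proof (rule polytime_foldr_bounded)
  fix x ys zs assume *: "L x = ys @ zs"
  show "sz (foldr (\<lambda>r a. if P x r then r # a else a) zs []) \<le> sz (L x)"
    using sz_filter[of "P x" zs] sz_suffix[OF *] by (simp add: filter_eq_foldr[symmetric])
qed (intro polytime_intros polytime_binary[OF P] polytime_const polytime_id polytime_size L)+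

lemma polytime_list_all [polytime_intros]:
  assumes P: "polytime (\<lambda>z. P (fst z) (snd z))" and L: "polytime L"
  shows "polytime (\<lambda>x. \<forall>r\<in>set (L x). P x r)"
proof -
  have "polytime (\<lambda>x. filter (\<lambda>r. \<not> P x r) (L x) = [])"
    by (intro polytime_intros P L)
  then show ?thesis by (simp add: filter_empty_conv)
qed

lemma polytime_in_set [polytime_intros]:
  assumes f: "polytime f" and L: "polytime L"
  shows "polytime (\<lambda>x. f x \<in> set (L x :: int list))"
proof -
  have "polytime (\<lambda>x. \<not> (\<forall>r\<in>set (L x). \<not> r = f x))"
    by (intro polytime_intros L polytime_comp[OF f] polytime_id)
  moreover have "(\<lambda>x. \<not> (\<forall>r\<in>set (L x). \<not> r = f x)) = (\<lambda>x. f x \<in> set (L x))" by auto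
  ultimately show ?thesis by simp
qed

lemma polytime_insert_all:
  assumes "polytime L" shows "polytime (\<lambda>x. foldr List.insert (L x) ([] :: int list))"
proof (rule polytime_foldr_bounded)
  fix x ys zs assume *: "L x = ys @ zs"
  have "sz (foldr List.insert zs []) \<le> sz zs"
    by (induction zs) (auto simp: List.insert_def)
  with sz_suffix[OF *] show "sz (foldr List.insert zs []) \<le> sz (L x)" by simp
qed (unfold List.insert_def, (intro polytime_intros polytime_const polytime_id polytime_size assms)+)

lemma sz_add_int: "sz (z + w :: int) \<le> sz z + sz w"
proof -
  have "nat \<bar>z + w\<bar> \<le> nat \<bar>z\<bar> + nat \<bar>w\<bar>" by linarith
  from bin_digits_mono[OF this] bin_digits_add[of "nat \<bar>z\<bar>" "nat \<bar>w\<bar>"]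
  show ?thesis by simp
qed

lemma sz_mult_int: "sz (z * w :: int) \<le> sz z + sz w"
  using bin_digits_mult[of "nat \<bar>z\<bar>" "nat \<bar>w\<bar>"] by (simp add: abs_mult nat_mult_distrib)

lemma polytime_sum_list [polytime_intros]:
  assumes "polytime L" shows "polytime (\<lambda>x. sum_list (L x :: int list))"
  unfolding sum_list.eq_foldr
proof (rule polytime_foldr_bounded)
  fix x ys zs assume *: "L x = ys @ zs"
  have "sz (foldr (+) zs 0) \<le> sz zs"
  proof (induction zs)
    case (Cons z zs)
    then show ?case using sz_add_int[of z "foldr (+) zs 0"] by simp
  qed simp
  with sz_suffix[OF *] show "sz (foldr (+) zs 0) \<le> sz (L x)" by simp
qed (intro polytime_intros polytime_const polytime_id polytime_size assms)+

lemma polytime_prod_list [polytime_intros]: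
  assumes "polytime L" shows "polytime (\<lambda>x. prod_list (L x :: int list))"
  unfolding prod_list.eq_foldr
proof (rule polytime_foldr_bounded)
  fix x ys zs assume *: "L x = ys @ zs"
  have "sz (foldr (*) zs 1) \<le> sz zs"
  proof (induction zs)
    case (Cons z zs)
    then show ?case using sz_mult_int[of z "foldr (*) zs 1"] by simp
  qed simp
  with sz_suffix[OF *] show "sz (foldr (*) zs 1) \<le> sz (L x)" by simp
qed (intro polytime_intros polytime_const polytime_id polytime_size assms)+

lemma sz_of_nat_le: "sz (int n) \<le> n + 2"
  using bin_digits_le_iff[of "Suc n" n] less_exp[of "Suc n"] by (simp add: Suc_lessD)

lemma polytime_length [polytime_intros]:
  assumes "polytime L" shows "polytime (\<lambda>x. int (length (L x)))"
proof -
  have eq: "foldr (\<lambda>r a. a + 1) zs 0 = int (length zs)" for zs :: "'b list"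
    by (induction zs) simp_all
  have "polytime (\<lambda>x. foldr (\<lambda>r a. a + 1) (L x) (0 :: int))"
  proof (rule polytime_foldr_bounded)
    fix x ys zs assume *: "L x = ys @ zs"
    show "sz (foldr (\<lambda>r a. a + 1) zs (0::int)) \<le> sz (L x) + 2"
      unfolding eq using sz_of_nat_le[of "length zs"] length_le_sz[of "L x"] * by simp
  qed (intro polytime_intros polytime_const polytime_id polytime_size assms poly_bounded_intros)+
  then show ?thesis by (simp add: eq)
qed

lemma polytime_upt [polytime_intros]:
  assumes "polytime L" shows "polytime (\<lambda>x. map int [0..<length (L x)])"
proof -
  have eq: "fold (\<lambda>r a. a @ [int (length a)]) zs [] = map int [0..<length zs]" for zs :: "'b list"
    by (induction zs rule: rev_induct) simp_all
  have "polytime (\<lambda>x. fold (\<lambda>r a. a @ [int (length a)]) (L x) [])"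
  proof (rule polytime_fold_bounded)
    fix x ys zs assume *: "L x = ys @ zs"
    then have len: "length ys \<le> sz (L x)" using length_le_sz[of "L x"] by simp
    have "sz y \<le> sz (L x) + 2" if "y \<in> set (map int [0..<length ys])" for y
    proof -
      from that obtain i where "i < length ys" "y = int i" by auto
      then show ?thesis using sz_of_nat_le[of i] len by simp
    qed
    then have "sz (map int [0..<length ys]) \<le> length ys * (sz (L x) + 2 + 1) + 2"
      using sz_list_le[of "map int [0..<length ys]" "sz (L x) + 2"] by simp
    also have "\<dots> \<le> sz (L x) * (sz (L x) + 2 + 1) + 2"
      using len by (intro add_mono mult_le_mono1) auto
    finally show "sz (fold (\<lambda>r a. a @ [int (length a)]) ys []) \<le> \<dots>" unfolding eq .
  qed (intro polytime_intros polytime_const polytime_id polytime_size assms poly_bounded_intros)+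
  then show ?thesis by (simp add: eq)
qed

text \<open>
A fold consumes only one list, so the other one is kept in the accumulator.
\<close>

lemma fold_zip_state:
  "fold (\<lambda>r a. if fst a = [] then a else (tl (fst a), (r, hd (fst a)) # snd a)) xs (ys, zs)
    = (drop (length xs) ys, rev (zip xs ys) @ zs)"
proof (induction xs arbitrary: ys zs)
  case (Cons x xs)
  then show ?case by (cases ys) simp_all
qed simp

lemma sz_zip: "sz (zip xs ys) \<le> sz xs + sz ys"
proof (induction xs arbitrary: ys)
  case (Cons x xs)
  show ?case
  proof (cases ys)
    case (Cons y ys')
    then show ?thesis using Cons.IH[of ys'] by simp
  qed simp
qed simp

lemma polytime_zip [polytime_intros]:
  assumes f: "polytime f" and g: "polytime g" shows "polytime (\<lambda>x. zip (f x) (g x))"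
proof -
  have "polytime (\<lambda>x. fold (\<lambda>r a. if fst a = [] then a else (tl (fst a), (r, hd (fst a)) # snd a))
      (f x) (g x, []))"
  proof (rule polytime_fold_bounded)
    fix x ys zs assume *: "f x = ys @ zs"
    have "sz ys \<le> sz (f x)" using sz_append[of ys zs] * val_size_ge_2[of "encode zs"] by simp
    then have "sz (rev (zip ys (g x))) \<le> sz (f x) + sz (g x)"
      using sz_zip[of ys "g x"] by (simp add: sz_rev)
    then show "sz (fold (\<lambda>r a. if fst a = [] then a else (tl (fst a), (r, hd (fst a)) # snd a)) ys (g x, []))
        \<le> Suc (sz (g x) + (sz (f x) + sz (g x)))"
      using sz_drop[of "length ys" "g x"] unfolding fold_zip_state by simp
  qed (intro polytime_intros polytime_const polytime_id polytime_size f g poly_bounded_intros)+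
  then have "polytime (\<lambda>x. rev (snd (fold (\<lambda>r a. if fst a = [] then a else (tl (fst a), (r, hd (fst a)) # snd a))
      (f x) (g x, []))))" by (intro polytime_intros)
  then show ?thesis unfolding fold_zip_state by simp
qed

section \<open>Sample points of a central hyperplane arrangement\<close>

definition dot :: "'a :: comm_ring_1 list \<Rightarrow> 'a list \<Rightarrow> 'a" where
  "dot u v = sum_list (map (\<lambda>z. fst z * snd z) (zip u v))"

definition scale :: "'a :: comm_ring_1 \<Rightarrow> 'a list \<Rightarrow> 'a list" where
  "scale k v = map (\<lambda>x. k * x) v"

abbreviation real_vec :: "int list \<Rightarrow> real list" where
  "real_vec \<equiv> map real_of_int"

text \<open>
The combination of \<open>g\<close> and \<open>h\<close> in which the first coordinate cancels.  If both leading coefficients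
are nonzero, their signs and the sign of the eliminant tell which of the two functionals has the
smaller root on the line over a point.
\<close>

definition eliminant :: "int list \<Rightarrow> int list \<Rightarrow> int list" where
  "eliminant g h = map (\<lambda>z. hd h * fst z - hd g * snd z) (zip (tl g) (tl h))"

text \<open>
Up to a positive factor, these are the points over \<open>s\<close> whose first coordinate is the midpoint of
the roots of \<open>g\<close> and \<open>h\<close>, and one more or one less than the root of \<open>h\<close> (\<open>lifts_cases\<close>).  The
factors are squares, which clears the denominators without a case distinction on signs.  If a leading
coefficient vanishes and there is no root, the corresponding vectors are zero and lie in every closed
face.
\<close>

definition lifts :: "int list \<Rightarrow> int list \<Rightarrow> int list \<Rightarrow> int list list" where
  "lifts g h s =
     [- (hd g * hd h) * (hd h * dot (tl g) s + hd g * dot (tl h) s)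
        # scale (2 * (hd g * hd h) * (hd g * hd h)) s,
      hd h * (hd h - dot (tl h) s) # scale (hd h * hd h) s,
      - hd h * (hd h + dot (tl h) s) # scale (hd h * hd h) s]"

text \<open>
The axis functional provides a root on every line, so that none of the intervals into which the
roots cut the line is the whole line.
\<close>

definition with_axis :: "nat \<Rightarrow> int list list \<Rightarrow> int list list" where
  "with_axis d H = (1 # replicate d 0) # H"

definition eliminants :: "int list list \<Rightarrow> int list list" where
  "eliminants H = concat (map (\<lambda>g. map (\<lambda>h. eliminant g h) H) H)"

definition lift_all :: "int list list \<Rightarrow> int list list \<Rightarrow> int list list" where
  "lift_all H S = concat (map (\<lambda>s. concat (map (\<lambda>g. concat (map (\<lambda>h. lifts g h s) H)) H)) S)"

fun samples :: "nat \<Rightarrow> int list list \<Rightarrow> int list list" where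
  "samples 0 H = [[]]"
| "samples (Suc d) H = lift_all (with_axis d H) (samples d (eliminants (with_axis d H)))"

text \<open>
The closure of the face of the arrangement that contains \<open>z\<close> in its relative interior.
\<close>

definition face_closure :: "int list list \<Rightarrow> real list \<Rightarrow> real list set" where
  "face_closure H z = {w. \<forall>h\<in>set H. (0 \<le> dot (real_vec h) z \<longrightarrow> 0 \<le> dot (real_vec h) w) \<and>
     (dot (real_vec h) z \<le> 0 \<longrightarrow> dot (real_vec h) w \<le> 0)}"

lemma dot_simps [simp]:
  "dot (a # u) (b # v) = a * b + dot u v" "dot [] v = 0" "dot u [] = 0"
  by (simp_all add: dot_def)

lemma scale_simps [simp]: "scale k [] = []" "scale k (x # v) = k * x # scale k v"
  "length (scale k v) = length v"
  by (simp_all add: scale_def)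

lemma dot_scale [simp]: "dot u (scale k v) = k * dot u v"
proof (induction u arbitrary: v)
  case (Cons a u)
  then show ?case by (cases v) (simp_all add: algebra_simps)
qed simp

lemma dot_real_vec: "dot (real_vec u) (real_vec v) = real_of_int (dot u v)"
proof (induction u arbitrary: v)
  case (Cons a u)
  then show ?case by (cases v) simp_all
qed simp

lemma real_vec_scale: "real_vec (scale k v) = scale (real_of_int k) (real_vec v)"
  by (simp add: scale_def)

lemma dot_replicate_0 [simp]: "dot (replicate d 0) v = 0" "dot v (replicate d 0) = 0"
proof -
  show *: "dot (replicate d 0) v = 0" for v :: "'a list"
  proof (induction d arbitrary: v)
    case (Suc d)
    then show ?case by (cases v) simp_all
  qed simp
  show "dot v (replicate d 0) = 0"
  proof (induction d arbitrary: v)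
    case (Suc d)
    then show ?case by (cases v) simp_all
  qed simp
qed

lemma dot_combination:
  assumes "length u = length v" "length v = length z"
  shows "dot (map (\<lambda>x. a * fst x - b * snd x) (zip u v)) z = a * dot u z - b * dot v z"
  using assms by (induction u v z rule: list_induct3) (simp_all add: algebra_simps)

lemma length_eliminant: "length g = Suc d \<Longrightarrow> length h = Suc d \<Longrightarrow> length (eliminant g h) = d"
  by (simp add: eliminant_def)

lemma dot_eliminant:
  assumes "length g = Suc d" "length h = Suc d" "length z = d"
  shows "dot (real_vec (eliminant g h)) z
    = real_of_int (hd h) * dot (real_vec (tl g)) z - real_of_int (hd g) * dot (real_vec (tl h)) z"
proof -
  have "real_vec (eliminant g h) = map (\<lambda>x. real_of_int (hd h) * fst x - real_of_int (hd g) * snd x)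
      (zip (real_vec (tl g)) (real_vec (tl h)))"
    by (simp add: eliminant_def zip_map1 zip_map2 split_beta)
  then show ?thesis using assms by (simp add: dot_combination)
qed

definition root_over :: "int list \<Rightarrow> real list \<Rightarrow> real" where
  "root_over h z = - dot (real_vec (tl h)) z / real_of_int (hd h)"

lemma dot_fibre:
  assumes "length h = Suc d"
  shows "dot (real_vec h) (x # z) = real_of_int (hd h) * x + dot (real_vec (tl h)) z"
  using assms by (cases h) simp_all

lemma dot_fibre_root:
  assumes "length h = Suc d" "hd h \<noteq> 0"
  shows "dot (real_vec h) (x # z) = real_of_int (hd h) * (x - root_over h z)"
  using assms by (simp add: dot_fibre[OF assms(1)] root_over_def algebra_simps)

text \<open>
Thus the sign conditions of the face of the point over \<open>z\<close> at which \<open>h\<close> vanishes are conditions on the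
eliminants at \<open>z\<close>.
\<close>

lemma dot_at_root:
  assumes "length g = Suc d" "length h = Suc d" "length z = d" "hd h \<noteq> 0"
  shows "dot (real_vec g) (root_over h z # z) = dot (real_vec (eliminant g h)) z / real_of_int (hd h)"
  using assms by (simp add: dot_fibre[OF assms(1)] dot_eliminant root_over_def field_simps)

lemma lifts_cases:
  assumes "hd g \<noteq> 0" "hd h \<noteq> 0"
    and x: "x = (root_over g (real_vec s) + root_over h (real_vec s)) / 2 \<or>
      x = root_over h (real_vec s) + 1 \<or> x = root_over h (real_vec s) - 1"
  shows "\<exists>w\<in>set (lifts g h s). \<exists>k>0. real_vec w = scale k (x # real_vec s)"
proof -
  define a b G K where "a = real_of_int (hd g)" and "b = real_of_int (hd h)"
    and "G = real_of_int (dot (tl g) s)" and "K = real_of_int (dot (tl h) s)"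
  have nz: "a \<noteq> 0" "b \<noteq> 0" using assms by (simp_all add: a_def b_def)
  have r: "root_over g (real_vec s) = - G / a" "root_over h (real_vec s) = - K / b"
    by (simp_all add: root_over_def dot_real_vec a_def b_def G_def K_def)
  from x consider "x = (- G / a - K / b) / 2" | "x = - K / b + 1" | "x = - K / b - 1"
    unfolding r by auto
  then show ?thesis
  proof cases
    case 1
    have calc: "- (a * b) * (b * G + a * K) = 2 * (a * b) * (a * b) * x"
      unfolding 1 using nz by (simp add: field_simps)
    have "a * b \<noteq> 0" using nz by simp
    then have "(a * b) * (a * b) > 0" using not_real_square_gt_zero[of "a * b"] by argo
    then have "2 * (a * b) * (a * b) > 0" by linarith
    moreover note calc
    ultimately show ?thesis
      by (intro bexI[of _ "lifts g h s ! 0"] exI[of _ "2 * (a * b) * (a * b)"])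
        (simp_all add: lifts_def real_vec_scale a_def b_def G_def K_def)
  next
    case 2
    have "b * (b - K) = b * b * x" unfolding 2 using nz by (simp add: field_simps)
    moreover have "b * b > 0" using not_real_square_gt_zero[of b] nz by argo
    ultimately show ?thesis
      by (intro bexI[of _ "lifts g h s ! 1"] exI[of _ "b * b"])
        (simp_all add: lifts_def real_vec_scale b_def K_def)
  next
    case 3
    have "- b * (b + K) = b * b * x" unfolding 3 using nz by (simp add: field_simps)
    moreover have "b * b > 0" using not_real_square_gt_zero[of b] nz by argo
    ultimately show ?thesis
      by (intro bexI[of _ "lifts g h s ! 2"] exI[of _ "b * b"])
        (simp_all add: lifts_def real_vec_scale b_def K_def)
  qed
qed

lemma set_eliminants: "set (eliminants H) = {eliminant g h | g h. g \<in> set H \<and> h \<in> set H}"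
  by (auto simp: eliminants_def)

lemma set_lift_all: "set (lift_all H S) = (\<Union>s\<in>set S. \<Union>g\<in>set H. \<Union>h\<in>set H. set (lifts g h s))"
  by (auto simp: lift_all_def)

lemma length_samples: "s \<in> set (samples d H) \<Longrightarrow> length s = d"
proof (induction d arbitrary: s H)
  case (Suc d)
  then show ?case by (fastforce simp: set_lift_all lifts_def)
qed simp

lemma finite_has_max:
  fixes f :: "'a \<Rightarrow> real"
  assumes "finite A" "A \<noteq> {}"
  obtains a where "a \<in> A" "\<And>b. b \<in> A \<Longrightarrow> f b \<le> f a"
proof -
  have "Max (f ` A) \<in> f ` A" using assms by (intro Max_in) auto
  then obtain a where "a \<in> A" "Max (f ` A) = f a" by auto
  then show thesis using that[of a] assms(1) Max_ge[of "f ` A"] by auto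
qed

lemma finite_has_min:
  fixes f :: "'a \<Rightarrow> real"
  assumes "finite A" "A \<noteq> {}"
  obtains a where "a \<in> A" "\<And>b. b \<in> A \<Longrightarrow> f a \<le> f b"
  using finite_has_max[OF assms, of "\<lambda>x. - f x"] by auto

lemma sgn_eq_iff_real:
  fixes a b :: real
  shows "sgn a = sgn b \<longleftrightarrow> (0 < a \<longleftrightarrow> 0 < b) \<and> (a < 0 \<longleftrightarrow> b < 0)"
  by (cases a "0::real" rule: linorder_cases; cases b "0::real" rule: linorder_cases) auto

text \<open>
The points \<open>r i\<close> cut the line into points and open intervals, and equally ordered points \<open>r' i\<close> cut
it in the same pattern.  So the piece of \<open>s\<close> has a counterpart, which contains an \<open>r' i\<close>, the
midpoint of two consecutive ones, or a point next to an extreme one.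
\<close>

lemma sample_on_line:
  fixes r r' :: "'i \<Rightarrow> real"
  assumes "finite I" "I \<noteq> {}"
    and order: "\<And>i j. i \<in> I \<Longrightarrow> j \<in> I \<Longrightarrow> sgn (r i - r j) = sgn (r' i - r' j)"
  shows "\<exists>x. (\<forall>i\<in>I. sgn (x - r' i) = sgn (s - r i)) \<and>
    (\<exists>i\<in>I. \<exists>j\<in>I. x = (r' i + r' j) / 2 \<or> x = r' j + 1 \<or> x = r' j - 1)"
proof -
  have witness: ?thesis
    if "\<And>i. i \<in> I \<Longrightarrow> sgn (x - r' i) = sgn (s - r i)" and "k \<in> I" "j \<in> I"
      and "x = (r' k + r' j) / 2 \<or> x = r' j + 1 \<or> x = r' j - 1" for x k j
    using that by (intro exI[of _ x] conjI ballI bexI[of _ k] bexI[of _ j])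
  show ?thesis
  proof (cases "\<exists>i\<in>I. r i = s")
    case True
    then obtain i where "i \<in> I" "r i = s" by blast
    show ?thesis
      by (rule witness[of "r' i" i i]) (use order[OF \<open>i \<in> I\<close>] \<open>i \<in> I\<close> \<open>r i = s\<close> in auto)
  next
    case False
    define lo hi where "lo = {i \<in> I. r i < s}" and "hi = {i \<in> I. s < r i}"
    have fin: "finite lo" "finite hi" using assms(1) by (simp_all add: lo_def hi_def)
    have side: "j \<in> lo \<and> r j < s \<or> j \<in> hi \<and> s < r j" if "j \<in> I" for j
      using False that by (auto simp: lo_def hi_def)
    consider "lo = {}" | "hi = {}" | "lo \<noteq> {}" "hi \<noteq> {}" by blast
    then show ?thesis
    proof cases
      case 1
      obtain i where i: "i \<in> I" "\<And>j. j \<in> I \<Longrightarrow> r' i \<le> r' j"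
        using finite_has_min[OF assms(1,2), of r'] by blast
      have "sgn (r' i - 1 - r' j) = sgn (s - r j)" if "j \<in> I" for j
        using i(2)[OF that] side[OF that] 1 by (auto simp: sgn_eq_iff_real)
      then show ?thesis by (rule witness[of "r' i - 1" i i]) (use i(1) in simp_all)
    next
      case 2
      obtain i where i: "i \<in> I" "\<And>j. j \<in> I \<Longrightarrow> r' j \<le> r' i"
        using finite_has_max[OF assms(1,2), of r'] by blast
      have "sgn (r' i + 1 - r' j) = sgn (s - r j)" if "j \<in> I" for j
        using i(2)[OF that] side[OF that] 2 by (auto simp: sgn_eq_iff_real)
      then show ?thesis by (rule witness[of "r' i + 1" i i]) (use i(1) in simp_all)
    next
      case 3
      obtain l where l: "l \<in> lo" "\<And>j. j \<in> lo \<Longrightarrow> r' j \<le> r' l"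
        using finite_has_max[OF fin(1) 3(1), of r'] by blast
      obtain u where u: "u \<in> hi" "\<And>j. j \<in> hi \<Longrightarrow> r' u \<le> r' j"
        using finite_has_min[OF fin(2) 3(2), of r'] by blast
      have lu: "l \<in> I" "u \<in> I" "r l < r u" using l(1) u(1) by (auto simp: lo_def hi_def)
      then have less: "r' l < r' u" using order[of l u] lu unfolding sgn_eq_iff_real by simp
      have "sgn ((r' l + r' u) / 2 - r' j) = sgn (s - r j)" if "j \<in> I" for j
        using side[OF that] l(2)[of j] u(2)[of j] less by (auto simp: sgn_eq_iff_real)
      then show ?thesis by (rule witness[of "(r' l + r' u) / 2" l u]) (use lu in simp_all)
    qed
  qed
qed

lemma with_axis_length: "\<forall>h\<in>set H. length h = Suc d \<Longrightarrow> h \<in> set (with_axis d H) \<Longrightarrow> length h = Suc d"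
  by (auto simp: with_axis_def)

text \<open>
By induction there is a sample \<open>s\<close> of the eliminants with the same signs as the projection of \<open>z\<close>.
Over \<open>s\<close> and over the projection the roots of the functionals are therefore equally ordered, so that the
position of \<open>z\<close> among the roots can be copied to the line over \<open>s\<close>.
\<close>

theorem samples_meet_every_face:
  assumes "\<forall>h\<in>set H. length h = d" and "length z = d"
  shows "\<exists>s\<in>set (samples d H). \<forall>h\<in>set H.
    sgn (dot (real_vec h) (real_vec s)) = sgn (dot (real_vec h) z)"
  using assms
proof (induction d arbitrary: H z)
  case 0
  then show ?case by simp
next
  case (Suc d)
  obtain x z' where z: "z = x # z'" and z': "length z' = d"
    using Suc.prems(2) by (cases z) auto
  define A where "A = with_axis d H"
  have len: "length h = Suc d" if "h \<in> set A" for h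
    using with_axis_length[OF Suc.prems(1)] that by (simp add: A_def)
  have axis: "1 # replicate d 0 \<in> set A" by (simp add: A_def with_axis_def)
  have "\<forall>h\<in>set (eliminants A). length h = d"
    using len by (auto simp: set_eliminants length_eliminant)
  from Suc.IH[OF this z'] obtain s where s: "s \<in> set (samples d (eliminants A))"
    and sgn_elim: "\<forall>e\<in>set (eliminants A). sgn (dot (real_vec e) (real_vec s)) = sgn (dot (real_vec e) z')"
    by (elim bexE)
  have sgn_s: "sgn (dot (real_vec (eliminant g h)) (real_vec s)) = sgn (dot (real_vec (eliminant g h)) z')"
    if "g \<in> set A" "h \<in> set A" for g h
    using sgn_elim that by (auto simp: set_eliminants)
  have ls: "length (real_vec s) = d" using length_samples[OF s] by simp
  define I where "I = {h \<in> set A. hd h \<noteq> 0}"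
  have I: "finite I" "I \<noteq> {}" using axis by (auto simp: I_def intro!: exI[of _ "1 # replicate d 0"])
  have order: "sgn (root_over g z' - root_over h z') = sgn (root_over g (real_vec s) - root_over h (real_vec s))"
    if "g \<in> I" "h \<in> I" for g h
  proof -
    have gh: "g \<in> set A" "h \<in> set A" "hd g \<noteq> 0" "hd h \<noteq> 0" using that by (auto simp: I_def)
    have *: "root_over g w - root_over h w = - (dot (real_vec (eliminant g h)) w) / (real_of_int (hd g) * real_of_int (hd h))"
      if "length w = d" for w
      unfolding dot_eliminant[OF len[OF gh(1)] len[OF gh(2)] that]
      using gh by (simp add: root_over_def field_simps)
    show ?thesis
      unfolding *[OF z'] *[OF ls] divide_inverse sgn_mult sgn_minus sgn_s[OF gh(1,2)] ..
  qed
  have "\<exists>v. (\<forall>h\<in>I. sgn (v - root_over h (real_vec s)) = sgn (x - root_over h z')) \<and>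
    (\<exists>g\<in>I. \<exists>h\<in>I. v = (root_over g (real_vec s) + root_over h (real_vec s)) / 2 \<or>
      v = root_over h (real_vec s) + 1 \<or> v = root_over h (real_vec s) - 1)"
    by (rule sample_on_line[OF I]) (rule order)
  then obtain v g h where v: "\<forall>h\<in>I. sgn (v - root_over h (real_vec s)) = sgn (x - root_over h z')"
    and gh: "g \<in> I" "h \<in> I" "v = (root_over g (real_vec s) + root_over h (real_vec s)) / 2 \<or>
      v = root_over h (real_vec s) + 1 \<or> v = root_over h (real_vec s) - 1"
    by (elim exE conjE bexE)
  have "hd g \<noteq> 0" "hd h \<noteq> 0" "g \<in> set A" "h \<in> set A" using gh(1,2) by (simp_all add: I_def)
  with lifts_cases[OF _ _ gh(3)]
  obtain w k where w: "w \<in> set (lifts g h s)" and k: "k > 0" and wk: "real_vec w = scale k (v # real_vec s)"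
    by blast
  have "w \<in> set (samples (Suc d) H)"
    using w \<open>g \<in> set A\<close> \<open>h \<in> set A\<close> s unfolding samples.simps set_lift_all A_def by blast
  moreover have "sgn (dot (real_vec f) (real_vec w)) = sgn (dot (real_vec f) z)" if "f \<in> set H" for f
  proof -
    have f: "f \<in> set A" using that by (simp add: A_def with_axis_def)
    have "sgn (dot (real_vec f) (real_vec w)) = sgn (dot (real_vec f) (v # real_vec s))"
      unfolding wk dot_scale sgn_mult using k by simp
    also have "\<dots> = sgn (dot (real_vec f) z)"
    proof (cases "hd f = 0")
      case True
      have *: "dot (real_vec (eliminant f (1 # replicate d 0))) w = dot (real_vec (tl f)) w"
        if "length w = d" for w
        using dot_eliminant[OF len[OF f] len[OF axis] that] True by simp
      show ?thesis
        using True sgn_s[OF f axis] unfolding *[OF z'] *[OF ls] z dot_fibre[OF len[OF f]] by simp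
    next
      case False
      then show ?thesis
        using v f by (simp add: z dot_fibre_root[OF len[OF f]] I_def sgn_mult)
    qed
    finally show ?thesis .
  qed
  ultimately show ?case by blast
qed

text \<open>
Lifting the origin yields the two axis directions, which are the unbounded directions of the
lines over all points.
\<close>

lemma zero_in_samples: "replicate d 0 \<in> set (samples d H)"
proof (induction d arbitrary: H)
  case (Suc d)
  let ?e = "1 # replicate d 0 :: int list"
  have "replicate (Suc d) 0 \<in> set (lifts ?e ?e (replicate d 0))"
    by (simp add: lifts_def scale_def)
  then show ?case using Suc[of "eliminants (with_axis d H)"]
    by (force simp: set_lift_all with_axis_def)
qed simp

lemma axis_in_samples:
  "1 # replicate d 0 \<in> set (samples (Suc d) H)" "- 1 # replicate d 0 \<in> set (samples (Suc d) H)"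
proof -
  let ?e = "1 # replicate d 0 :: int list"
  have "1 # replicate d 0 \<in> set (lifts ?e ?e (replicate d 0))"
    "- 1 # replicate d 0 \<in> set (lifts ?e ?e (replicate d 0))"
    by (simp_all add: lifts_def scale_def)
  then show "1 # replicate d 0 \<in> set (samples (Suc d) H)" "- 1 # replicate d 0 \<in> set (samples (Suc d) H)"
    using zero_in_samples[of d "eliminants (with_axis d H)"]
    by (force simp: set_lift_all with_axis_def)+
qed

lemma face_closure_trans: "w \<in> face_closure H z \<Longrightarrow> v \<in> face_closure H w \<Longrightarrow> v \<in> face_closure H z"
  unfolding face_closure_def by blast

lemma face_closure_scale: "k > 0 \<Longrightarrow> w \<in> face_closure H z \<Longrightarrow> scale k w \<in> face_closure H z"
  unfolding face_closure_def by (auto simp: zero_le_mult_iff mult_le_0_iff)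

lemma face_closure_mono: "set H \<subseteq> set A \<Longrightarrow> face_closure A z \<subseteq> face_closure H z"
  unfolding face_closure_def by blast

text \<open>
On the line through \<open>z\<close> in the first coordinate, the closed face is an interval bounded by roots, and
the linear function \<open>L\<close> takes its least value at an end point or decreases in an unbounded
direction.  The latter is excluded by the axis directions.  At an end point, \<open>L\<close> is a linear
function of the remaining coordinates, since the end point is the root of a functional; the
induction hypothesis for the eliminants shows that it is nonnegative there.
\<close>

theorem nonneg_on_samples_imp_nonneg:
  assumes "\<forall>h\<in>set H. length h = d" and "length z = d" and "length L = d"
    and "\<And>s. s \<in> set (samples d H) \<Longrightarrow> real_vec s \<in> face_closure H z \<Longrightarrow> 0 \<le> dot L (real_vec s)"
  shows "0 \<le> dot L z"
  using assms
proof (induction d arbitrary: H z L)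
  case 0
  then show ?case by simp
next
  case (Suc d)
  obtain x z' where z: "z = x # z'" and z': "length z' = d"
    using Suc.prems(2) by (cases z) auto
  obtain l L' where L: "L = l # L'" and L': "length L' = d"
    using Suc.prems(3) by (cases L) auto
  define A where "A = with_axis d H"
  have len: "length h = Suc d" if "h \<in> set A" for h
    using with_axis_length[OF Suc.prems(1)] that by (simp add: A_def)
  have "1 # replicate d 0 \<in> set A" by (simp add: A_def with_axis_def)
  have HA: "set H \<subseteq> set A" by (auto simp: A_def with_axis_def)
  have sample: "0 \<le> dot L (real_vec s)"
    if "s \<in> set (samples (Suc d) H)" "real_vec s \<in> face_closure A z" for s
    using Suc.prems(4) that face_closure_mono[OF HA] by blast
  define I where "I = {h \<in> set A. hd h \<noteq> 0}"
  define r where "r h = root_over h z'" for h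
  have I: "finite I" by (simp add: I_def)
  have on_z: "dot (real_vec g) (y # z') = real_of_int (hd g) * (y - r g)" if "g \<in> I" for g y
    using that len dot_fibre_root[of g d] by (auto simp: I_def r_def)
  have const: "dot (real_vec g) (y # z') = dot (real_vec g) z" if "g \<in> set A" "g \<notin> I" for g y
    using that dot_fibre[OF len[OF that(1)]] by (simp add: I_def z)
  have at_root: "0 \<le> dot L (r h # z')" if h: "h \<in> I" and cl: "r h # z' \<in> face_closure A z" for h
  proof -
    have hA: "h \<in> set A" "hd h \<noteq> 0" using h by (auto simp: I_def)
    \<comment> \<open>The restriction of \<open>L\<close> to the hyperplane of \<open>h\<close>, in the remaining coordinates.\<close>
    define L'' where "L'' = map (\<lambda>x. 1 * fst x - l / real_of_int (hd h) * snd x) (zip L' (real_vec (tl h)))"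
    have L'': "dot L'' w = dot L (root_over h w # w)" if "length w = d" for w
      using that L' len[OF hA(1)] hA(2) unfolding L''_def
      by (subst dot_combination) (simp_all add: L root_over_def)
    have "0 \<le> dot L'' z'"
    proof (rule Suc.IH[where H = "eliminants A"])
      fix s assume s: "s \<in> set (samples d (eliminants A))"
        and clos: "real_vec s \<in> face_closure (eliminants A) z'"
      have ls: "length (real_vec s) = d" using length_samples[OF s] by simp
      define v where "v = root_over h (real_vec s) # real_vec s"
      have "v \<in> face_closure A (r h # z')"
        unfolding face_closure_def
      proof (intro CollectI ballI)
        fix g assume g: "g \<in> set A"
        have "eliminant g h \<in> set (eliminants A)" using g hA(1) by (auto simp: set_eliminants)
        with clos have "(0 \<le> dot (real_vec (eliminant g h)) z' \<longrightarrow> 0 \<le> dot (real_vec (eliminant g h)) (real_vec s)) \<and>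
            (dot (real_vec (eliminant g h)) z' \<le> 0 \<longrightarrow> dot (real_vec (eliminant g h)) (real_vec s) \<le> 0)"
          unfolding face_closure_def by blast
        then show "(0 \<le> dot (real_vec g) (r h # z') \<longrightarrow> 0 \<le> dot (real_vec g) v) \<and>
            (dot (real_vec g) (r h # z') \<le> 0 \<longrightarrow> dot (real_vec g) v \<le> 0)"
          unfolding v_def r_def dot_at_root[OF len[OF g] len[OF hA(1)] z' hA(2)]
            dot_at_root[OF len[OF g] len[OF hA(1)] ls hA(2)]
          by (auto simp: zero_le_divide_iff divide_le_0_iff)
      qed
      then have v: "v \<in> face_closure A z" using face_closure_trans[OF cl] by blast
      have "\<exists>w\<in>set (lifts h h s). \<exists>k>0. real_vec w = scale k (root_over h (real_vec s) # real_vec s)"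
        by (rule lifts_cases) (use hA in auto)
      then obtain w k where w: "w \<in> set (lifts h h s)" "k > 0" "real_vec w = scale k v"
        unfolding v_def by blast
      have "w \<in> set (samples (Suc d) H)" using w(1) hA(1) s by (auto simp: set_lift_all A_def)
      from sample[OF this] have "0 \<le> k * dot L v"
        using face_closure_scale[OF w(2) v] unfolding w(3) dot_scale by blast
      then show "0 \<le> dot L'' (real_vec s)"
        using w(2) L''[OF ls] by (simp add: v_def zero_le_mult_iff)
    qed (use len z' L' hA in \<open>auto simp: set_eliminants length_eliminant L''_def\<close>)
    then show ?thesis using L''[OF z'] by (simp add: r_def)
  qed
  have dotL: "dot L (y # z') = l * y + dot L' z'" for y by (simp add: L)
  show ?case
  proof (cases "\<exists>h\<in>I. r h = x")
    case True
    then obtain h where "h \<in> I" "r h = x" by blast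
    then show ?thesis using at_root[of h] by (auto simp: z face_closure_def)
  next
    case False
    define lo hi where "lo = {i \<in> I. r i < x}" and "hi = {i \<in> I. x < r i}"
    have fin: "finite lo" "finite hi" using I by (simp_all add: lo_def hi_def)
    have side: "j \<in> lo \<and> r j < x \<or> j \<in> hi \<and> x < r j" if "j \<in> I" for j
      using False that by (auto simp: lo_def hi_def)
    \<comment> \<open>The greatest root below \<open>x\<close> is still in the closed face of \<open>z\<close>.\<close>
    have below: "\<exists>y<x. 0 \<le> l * y + dot L' z'" if ne: "lo \<noteq> {}"
    proof -
      obtain b where b: "b \<in> lo" "\<And>j. j \<in> lo \<Longrightarrow> r j \<le> r b"
        using finite_has_max[OF fin(1) ne, of r] by blast
      have "r b # z' \<in> face_closure A z" unfolding face_closure_def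
      proof (intro CollectI ballI)
        fix g assume g: "g \<in> set A"
        show "(0 \<le> dot (real_vec g) z \<longrightarrow> 0 \<le> dot (real_vec g) (r b # z')) \<and>
          (dot (real_vec g) z \<le> 0 \<longrightarrow> dot (real_vec g) (r b # z') \<le> 0)"
        proof (cases "g \<in> I")
          case True
          have "r g \<le> r b \<and> r g < x \<or> r b < r g \<and> x < r g"
            using side[OF True] b by (auto simp: lo_def hi_def not_le[symmetric])
          then show ?thesis unfolding z on_z[OF True] by (auto simp: zero_le_mult_iff mult_le_0_iff)
        qed (simp add: const[OF g])
      qed
      then show ?thesis using at_root[of b] b(1) by (auto simp: lo_def dotL)
    qed
    have above: "\<exists>y>x. 0 \<le> l * y + dot L' z'" if ne: "hi \<noteq> {}"
    proof -
      obtain b where b: "b \<in> hi" "\<And>j. j \<in> hi \<Longrightarrow> r b \<le> r j"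
        using finite_has_min[OF fin(2) ne, of r] by blast
      have "r b # z' \<in> face_closure A z" unfolding face_closure_def
      proof (intro CollectI ballI)
        fix g assume g: "g \<in> set A"
        show "(0 \<le> dot (real_vec g) z \<longrightarrow> 0 \<le> dot (real_vec g) (r b # z')) \<and>
          (dot (real_vec g) z \<le> 0 \<longrightarrow> dot (real_vec g) (r b # z') \<le> 0)"
        proof (cases "g \<in> I")
          case True
          have "r b \<le> r g \<and> x < r g \<or> r g < r b \<and> r g < x"
            using side[OF True] b by (auto simp: lo_def hi_def not_le[symmetric])
          then show ?thesis unfolding z on_z[OF True] by (auto simp: zero_le_mult_iff mult_le_0_iff)
        qed (simp add: const[OF g])
      qed
      then show ?thesis using at_root[of b] b(1) by (auto simp: hi_def dotL)
    qed
    \<comment> \<open>Without a root on one side of \<open>x\<close>, the closed face contains the axis direction of that side.\<close>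
    have direction: "0 \<le> l * c" if c: "c = 1 \<and> hi = {} \<or> c = - 1 \<and> lo = {}" for c :: int
    proof -
      have "real_vec (c # replicate d 0) \<in> face_closure A z" unfolding face_closure_def
      proof (intro CollectI ballI)
        fix g assume g: "g \<in> set A"
        have ray: "dot (real_vec g) (real_vec (c # replicate d 0)) = real_of_int (hd g) * c"
          using dot_fibre[OF len[OF g], of "real_of_int c" "replicate d 0"] by simp
        show "(0 \<le> dot (real_vec g) z \<longrightarrow> 0 \<le> dot (real_vec g) (real_vec (c # replicate d 0))) \<and>
          (dot (real_vec g) z \<le> 0 \<longrightarrow> dot (real_vec g) (real_vec (c # replicate d 0)) \<le> 0)"
        proof (cases "g \<in> I")
          case True
          have "c = 1 \<and> r g < x \<or> c = - 1 \<and> x < r g"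
            using side[OF True] c by auto
          then show ?thesis unfolding ray z on_z[OF True] by (auto simp: zero_le_mult_iff mult_le_0_iff)
        next
          case False
          then show ?thesis using g unfolding ray by (simp add: I_def)
        qed
      qed
      then have "0 \<le> dot L (real_vec (c # replicate d 0))"
        using sample axis_in_samples[of d H] c by blast
      then show ?thesis by (simp add: L)
    qed
    show ?thesis
    proof (cases "0 \<le> l")
      case True
      then have "\<exists>y<x. 0 \<le> l * y + dot L' z'"
      proof (cases "lo = {}")
        case True
        note direction[of "- 1"]
        then have "l = 0" using True \<open>0 \<le> l\<close> by simp
        moreover have "hi \<noteq> {}"
          using side[of "1 # replicate d 0"] True \<open>1 # replicate d 0 \<in> set A\<close> by (auto simp: I_def)
        \<comment> \<open>\<open>L\<close> is constant on the line, so a root above \<open>x\<close> serves as well.\<close>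
        ultimately show ?thesis using above by (intro exI[of _ "x - 1"]) auto
      qed (rule below)
      then obtain y where "y < x" "0 \<le> l * y + dot L' z'" by blast
      moreover have "l * y \<le> l * x" using \<open>y < x\<close> True by (simp add: mult_left_mono)
      ultimately show ?thesis by (simp add: z dotL)
    next
      case neg: False
      then have "hi \<noteq> {}" using direction[of 1] by auto
      from above[OF this] obtain y where "x < y" "0 \<le> l * y + dot L' z'" by blast
      moreover have "l * y \<le> l * x" using \<open>x < y\<close> neg by (simp add: mult_left_mono_neg)
      ultimately show ?thesis by (simp add: z dotL)
    qed
  qed
qed

section \<open>The algorithm\<close>

text \<open>
The denominators without repetitions: the quotient of their product by one of them is the product of
the others, so that rationals can be brought to a common denominator by multiplications only.
\<close>

definition denominators :: "(int \<times> int) list list \<Rightarrow> int list" where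
  "denominators M = foldr List.insert (map snd (concat M)) []"

definition common_denominator :: "(int \<times> int) list list \<Rightarrow> int" where
  "common_denominator M = prod_list (denominators M)"

definition clear_denominators :: "(int \<times> int) list list \<Rightarrow> int list list" where
  "clear_denominators M = map (\<lambda>r. map (\<lambda>q.
     fst q * prod_list (filter (\<lambda>b. \<not> b = snd q) (denominators M))) r) M"

definition subtract :: "int list \<Rightarrow> int list \<Rightarrow> int list" where
  "subtract u v = map (\<lambda>z. fst z - snd z) (zip u v)"

text \<open>
The first functional is the height, the last coordinate of a homogeneous vector.
\<close>

definition arrangement :: "nat \<Rightarrow> int list list \<Rightarrow> int list list" where
  "arrangement p R = (replicate p 0 @ [1]) # concat (map (\<lambda>r. map (\<lambda>r'. subtract r r') R) R)"

text \<open>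
Entries with the same key as \<open>x\<close> are dropped.  Ties among residuals thus show in the length of the
sorted list.
\<close>

definition insert_strict :: "int \<times> int \<Rightarrow> (int \<times> int) list \<Rightarrow> (int \<times> int) list" where
  "insert_strict x l = filter (\<lambda>y. fst y < fst x) l @ x # filter (\<lambda>y. fst x < fst y) l"

definition sort_strict :: "(int \<times> int) list \<Rightarrow> (int \<times> int) list" where
  "sort_strict l = foldr insert_strict l []"

definition ranking :: "int list list \<Rightarrow> int list \<Rightarrow> int list" where
  "ranking R q = map snd (sort_strict (zip (map (\<lambda>r. dot r q) R) (map int [0..<length R])))"

text \<open>
The samples that represent points in the interior of a cell, with the permutation of the cell.
\<close>

definition cell_samples :: "nat \<Rightarrow> int list list \<Rightarrow> (int list \<times> int list) list" where
  "cell_samples p R = map (\<lambda>q. (q, ranking R q))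
     (filter (\<lambda>q. 0 < last q \<and> int (length (ranking R q)) = int (length R))
       (samples (Suc p) (arrangement p R)))"

definition objective :: "int list list \<Rightarrow> (int \<times> int) list \<Rightarrow> int list \<Rightarrow> int" where
  "objective R a g = dot (hd (clear_denominators [a])) (map (\<lambda>r. dot r g) R)"

text \<open>
The argument is a sample \<open>q\<close> in a cell with the coefficients of the cell.  A sample \<open>g\<close> lies in the
closure of the homogenized cell iff no functional has opposite signs at \<open>q\<close> and \<open>g\<close>.  The
two integers are numerator and denominator of the value of the linear function of the cell at the
point that \<open>g\<close> represents; the denominator is \<open>0\<close> iff \<open>g\<close> has height \<open>0\<close> and represents no point.
\<close>

definition cell_candidates ::
  "nat \<Rightarrow> (int \<times> int) list list \<Rightarrow> int list \<times> (int \<times> int) list \<Rightarrow> (int list \<times> int \<times> int) list" where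
  "cell_candidates p M c =
     map (\<lambda>g. (g, objective (clear_denominators M) (snd c) g,
          common_denominator [snd c] * common_denominator M * last g))
       (filter (\<lambda>g. \<forall>h\<in>set (arrangement p (clear_denominators M)). 0 \<le> dot h (fst c) * dot h g)
         (samples (Suc p) (arrangement p (clear_denominators M))))"

definition candidates ::
  "nat \<Rightarrow> (int \<times> int) list list \<Rightarrow> (int list \<times> (int \<times> int) list) list \<Rightarrow> (int list \<times> int \<times> int) list" where
  "candidates p M A = concat (map (\<lambda>c. cell_candidates p M c) A)"

text \<open>
The first candidate whose value is least; the denominators of the candidates are assumed positive.
\<close>

definition least_candidate :: "(int list \<times> int \<times> int) list \<Rightarrow> int list \<times> int \<times> int" where
  "least_candidate C = hd (filter (\<lambda>c. \<forall>c'\<in>set C.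
     fst (snd c) * snd (snd c') \<le> fst (snd c') * snd (snd c)) C)"

text \<open>
A direction along which the linear function of a cell decreases makes the problem unbounded.  The
signs are reversed because \<open>\<beta>\<close> is homogenized to \<open>(-\<beta>, 1)\<close>.
\<close>

definition select_optimum ::
  "(int list \<times> int \<times> int) list \<Rightarrow> ((int \<times> int) list \<times> int \<times> int) option" where
  "select_optimum C =
     (if \<forall>c\<in>set C. snd (snd c) = 0 \<longrightarrow> 0 \<le> fst (snd c)
      then Some (map (\<lambda>x. (- x, last (fst (least_candidate (filter (\<lambda>c. 0 < snd (snd c)) C)))))
              (butlast (fst (least_candidate (filter (\<lambda>c. 0 < snd (snd c)) C)))),
            snd (least_candidate (filter (\<lambda>c. 0 < snd (snd c)) C)))
      else None)"

section \<open>Running time of the algorithm\<close>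

lemma polytime_ternary:
  "polytime (\<lambda>z. F (fst z) (fst (snd z)) (snd (snd z))) \<Longrightarrow> polytime f \<Longrightarrow> polytime g \<Longrightarrow> polytime h
    \<Longrightarrow> polytime (\<lambda>x. F (f x) (g x) (h x))"
  using polytime_comp[OF _ polytime_Pair[OF _ polytime_Pair]] by fastforce

lemma polytime_imp [polytime_intros]: "polytime f \<Longrightarrow> polytime g \<Longrightarrow> polytime (\<lambda>x. f x \<longrightarrow> g x)"
  using polytime_Not[OF polytime_conj[OF _ polytime_Not]] by simp

lemma polytime_last [polytime_intros]: "polytime f \<Longrightarrow> polytime (\<lambda>x. last (f x))"
  unfolding hd_rev[symmetric] by (intro polytime_intros)

lemma polytime_butlast [polytime_intros]: "polytime f \<Longrightarrow> polytime (\<lambda>x. butlast (f x))"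
proof -
  assume "polytime f"
  then have "polytime (\<lambda>x. rev (tl (rev (f x))))" by (intro polytime_intros)
  then show ?thesis by (simp add: butlast_rev[symmetric])
qed

text \<open>
For each function of the algorithm, a proof for a single argument, possibly a tuple, is turned
into a rule for compositions.
\<close>

lemma polytime_dot': "polytime (\<lambda>z. dot (fst z) (snd z) :: int)"
  unfolding dot_def by (intro polytime_intros polytime_id)

lemmas polytime_dot [polytime_intros] = polytime_binary[OF polytime_dot']

lemma polytime_scale': "polytime (\<lambda>z. scale (fst z) (snd z :: int list))"
  unfolding scale_def by (intro polytime_intros polytime_id)

lemmas polytime_scale [polytime_intros] = polytime_binary[OF polytime_scale']

lemma polytime_eliminant': "polytime (\<lambda>z. eliminant (fst z) (snd z))"
  unfolding eliminant_def by (intro polytime_intros polytime_id)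

lemmas polytime_eliminant [polytime_intros] = polytime_binary[OF polytime_eliminant']

lemma polytime_subtract': "polytime (\<lambda>z. subtract (fst z) (snd z))"
  unfolding subtract_def by (intro polytime_intros polytime_id)

lemmas polytime_subtract [polytime_intros] = polytime_binary[OF polytime_subtract']

lemma polytime_lifts': "polytime (\<lambda>z. lifts (fst z) (fst (snd z)) (snd (snd z)))"
  unfolding lifts_def by (intro polytime_intros polytime_id polytime_const)

lemmas polytime_lifts [polytime_intros] = polytime_ternary[OF polytime_lifts']

lemma polytime_lift_all': "polytime (\<lambda>z. lift_all (fst z) (snd z))"
  unfolding lift_all_def by (intro polytime_intros polytime_id)

lemmas polytime_lift_all = polytime_binary[OF polytime_lift_all']

lemma polytime_eliminants': "polytime (\<lambda>z. eliminants z)"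
  unfolding eliminants_def by (intro polytime_intros polytime_id)

lemmas polytime_eliminants = polytime_comp[OF polytime_eliminants']

lemma polytime_with_axis': "polytime (\<lambda>z. with_axis d z)"
  unfolding with_axis_def by (intro polytime_intros polytime_id polytime_const)

lemmas polytime_with_axis = polytime_comp[OF polytime_with_axis']

text \<open>
The dimension is a constant here: the program and the exponent depend on \<open>d\<close>.
\<close>

lemma polytime_samples': "polytime (\<lambda>z. samples d z)"
proof (induction d)
  case 0
  then show ?case by (simp add: polytime_const)
next
  case (Suc d)
  show ?case
    unfolding samples.simps
    by (intro polytime_lift_all polytime_with_axis polytime_comp[OF Suc] polytime_eliminants polytime_id)
qed

lemmas polytime_samples [polytime_intros] = polytime_comp[OF polytime_samples']

lemma polytime_denominators': "polytime (\<lambda>z. denominators z)"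
  unfolding denominators_def by (intro polytime_insert_all polytime_intros polytime_id)

lemmas polytime_denominators [polytime_intros] = polytime_comp[OF polytime_denominators']

lemma polytime_common_denominator': "polytime (\<lambda>z. common_denominator z)"
  unfolding common_denominator_def by (intro polytime_intros polytime_id)

lemmas polytime_common_denominator [polytime_intros] = polytime_comp[OF polytime_common_denominator']

lemma polytime_clear_denominators': "polytime (\<lambda>z. clear_denominators z)"
  unfolding clear_denominators_def by (intro polytime_intros polytime_id)

lemmas polytime_clear_denominators [polytime_intros] = polytime_comp[OF polytime_clear_denominators']

lemma polytime_arrangement': "polytime (\<lambda>z. arrangement p z)"
  unfolding arrangement_def by (intro polytime_intros polytime_id polytime_const)

lemmas polytime_arrangement [polytime_intros] = polytime_comp[OF polytime_arrangement']

lemma sz_insert_strict: "sz (insert_strict x l) \<le> Suc (sz x + sz l)"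
proof -
  have "sz (filter (\<lambda>y. fst y < fst x) l) + sz (filter (\<lambda>y. fst x < fst y) l) \<le> sz l + 2"
    by (induction l) auto
  then show ?thesis
    using sz_append[of "filter (\<lambda>y. fst y < fst x) l" "x # filter (\<lambda>y. fst x < fst y) l"]
    unfolding insert_strict_def by simp
qed

lemma polytime_sort_strict': "polytime (\<lambda>z. sort_strict z)"
  unfolding sort_strict_def
proof (rule polytime_foldr_bounded)
  fix x ys zs :: "(int \<times> int) list" assume *: "x = ys @ zs"
  have "sz (foldr insert_strict zs []) \<le> sz zs"
  proof (induction zs)
    case (Cons z zs)
    then show ?case using sz_insert_strict[of z "foldr insert_strict zs []"] by simp
  qed simp
  then show "sz (foldr insert_strict zs []) \<le> sz x" using sz_suffix[OF *] by simp
qed (unfold insert_strict_def, (intro polytime_intros polytime_id polytime_const poly_bounded_sz)+)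

lemmas polytime_sort_strict [polytime_intros] = polytime_comp[OF polytime_sort_strict']

lemma polytime_ranking': "polytime (\<lambda>z. ranking (fst z) (snd z))"
  unfolding ranking_def by (intro polytime_intros polytime_id)

lemmas polytime_ranking [polytime_intros] = polytime_binary[OF polytime_ranking']

lemma polytime_cell_samples': "polytime (\<lambda>z. cell_samples p z)"
  unfolding cell_samples_def by (intro polytime_intros polytime_id polytime_const)

lemmas polytime_cell_samples [polytime_intros] = polytime_comp[OF polytime_cell_samples']

lemma polytime_objective': "polytime (\<lambda>z. objective (fst z) (fst (snd z)) (snd (snd z)))"
  unfolding objective_def by (intro polytime_intros polytime_id polytime_const)

lemmas polytime_objective [polytime_intros] = polytime_ternary[OF polytime_objective']

lemma polytime_cell_candidates': "polytime (\<lambda>z. cell_candidates p (fst z) (snd z))"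
  unfolding cell_candidates_def by (intro polytime_intros polytime_id polytime_const)

lemmas polytime_cell_candidates [polytime_intros] = polytime_binary[OF polytime_cell_candidates']

lemma polytime_candidates': "polytime (\<lambda>z. candidates p (fst z) (snd z))"
  unfolding candidates_def by (intro polytime_intros polytime_id)

lemmas polytime_candidates [polytime_intros] = polytime_binary[OF polytime_candidates']

lemma polytime_least_candidate': "polytime (\<lambda>z. least_candidate z)"
  unfolding least_candidate_def by (intro polytime_intros polytime_id)

lemmas polytime_least_candidate [polytime_intros] = polytime_comp[OF polytime_least_candidate']

lemma polytime_select_optimum': "polytime (\<lambda>z. select_optimum z)"
  unfolding select_optimum_def by (intro polytime_intros polytime_id polytime_const)

lemmas polytime_select_optimum [polytime_intros] = polytime_comp[OF polytime_select_optimum']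

lemma poly_nat_mono: "x \<le> y \<Longrightarrow> poly (p :: nat poly) x \<le> poly p y"
  by (induction p) (auto intro: add_mono mult_mono)

section \<open>Questions to the oracle\<close>

text \<open>
The answers may be longer than any fixed polynomial in the questions, so their size \<open>W\<close> enters the
time bound as a second parameter, while the program is independent of it.  The list of answered
questions comes out reversed, since they are collected by a loop.
\<close>

lemma ask_all:
  fixes A :: "'b :: encodable \<Rightarrow> 'c :: encodable"
  obtains c :: prog and P :: "nat poly" where
    "\<And>Q A l W. (\<And>q \<pi>. (q :: 'a :: encodable, \<pi> :: 'b) \<in> set l \<Longrightarrow>
        Q (encode \<pi>) = encode (A \<pi> :: 'c) \<and> sz (A \<pi>) \<le> W) \<Longrightarrow>
      runs_within Q c (encode l) (encode (rev (map (\<lambda>z. (fst z, A (snd z))) l))) (poly P (W + sz l))"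
proof -
  have "polytime (\<lambda>z :: ('a \<times> 'b) list \<times> ('a \<times> 'c) list. fst z \<noteq> [])"
    by (intro polytime_intros polytime_id)
  then obtain b kb where b: "\<And>Q z. runs_within Q b (encode z)
      (encode (fst (z :: ('a \<times> 'b) list \<times> ('a \<times> 'c) list) \<noteq> [])) (sz z ^ kb)"
    unfolding polytime_def by blast
  have "polytime (\<lambda>z :: ('a \<times> 'b) list \<times> ('a \<times> 'c) list. tl (fst z))"
    by (intro polytime_intros polytime_id)
  then obtain c1 k1 where c1: "\<And>Q z. runs_within Q c1 (encode z)
      (encode (tl (fst (z :: ('a \<times> 'b) list \<times> ('a \<times> 'c) list)))) (sz z ^ k1)"
    unfolding polytime_def by blast
  have "polytime (\<lambda>z :: ('a \<times> 'b) list \<times> ('a \<times> 'c) list. fst (hd (fst z)))"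
    by (intro polytime_intros polytime_id)
  then obtain c2 k2 where c2: "\<And>Q z. runs_within Q c2 (encode z)
      (encode (fst (hd (fst (z :: ('a \<times> 'b) list \<times> ('a \<times> 'c) list))))) (sz z ^ k2)"
    unfolding polytime_def by blast
  have "polytime (\<lambda>z :: ('a \<times> 'b) list \<times> ('a \<times> 'c) list. snd (hd (fst z)))"
    by (intro polytime_intros polytime_id)
  then obtain c3 k3 where c3: "\<And>Q z. runs_within Q c3 (encode z)
      (encode (snd (hd (fst (z :: ('a \<times> 'b) list \<times> ('a \<times> 'c) list))))) (sz z ^ k3)"
    unfolding polytime_def by blast
  have "polytime (\<lambda>z :: ('a \<times> 'b) list \<times> ('a \<times> 'c) list. snd z)"
    by (intro polytime_intros polytime_id)
  then obtain c4 k4 where c4: "\<And>Q z. runs_within Q c4 (encode z)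
      (encode (snd (z :: ('a \<times> 'b) list \<times> ('a \<times> 'c) list))) (sz z ^ k4)"
    unfolding polytime_def by blast
  have "polytime (\<lambda>l :: ('a \<times> 'b) list. (l, [] :: ('a \<times> 'c) list))"
    by (intro polytime_intros polytime_id polytime_const)
  then obtain c0 k0 where c0: "\<And>Q l. runs_within Q c0 (encode l)
      (encode (l :: ('a \<times> 'b) list, [] :: ('a \<times> 'c) list)) (sz l ^ k0)"
    unfolding polytime_def by blast
  define body where "body = Fork c1 (Fork (Fork c2 (Seq c3 Ask)) c4)"
  define Mp :: "nat poly" where "Mp = [:3, 4, 1:]"
  define Bp :: "nat poly" where
    "Bp = Mp ^ kb + Mp ^ k1 + Mp ^ k2 + 2 * Mp ^ k3 + Mp ^ k4 + [:0, 1:] + 3 * Mp + [:4:]"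
  define P :: "nat poly" where "P = [:0, 1:] ^ k0 + [:1, 1:] * (3 * Bp + [:1:]) + Mp ^ k4 + [:2:]"
  show thesis
  proof (rule that[of "Seq c0 (Seq (While b body) c4)" P])
    fix Q :: "val \<Rightarrow> val" and A :: "'b \<Rightarrow> 'c" and l :: "('a \<times> 'b) list" and W :: nat
    assume Q: "\<And>q \<pi>. (q, \<pi>) \<in> set l \<Longrightarrow> Q (encode \<pi>) = encode (A \<pi>) \<and> sz (A \<pi>) \<le> W"
    define N where "N = W + sz l"
    define f where "f z = (fst z, A (snd z))" for z :: "'a \<times> 'b"
    define state where "state i = (drop i l, rev (map f (take i l)))" for i
    have M: "sz (state i) \<le> poly Mp N" for i
    proof -
      have "sz y \<le> N + 1" if y: "y \<in> set (map f (take i l))" for y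
      proof -
        obtain z where z: "z \<in> set l" "y = (fst z, A (snd z))"
          using y by (auto simp: f_def dest: in_set_takeD)
        then show ?thesis
          using Q[of "fst z" "snd z"] sz_member[OF z(1)] sz_prod[of z] by (simp add: N_def)
      qed
      then have "sz (map f (take i l)) \<le> length (map f (take i l)) * (N + 1 + 1) + 2"
        by (rule sz_list_le)
      also have "\<dots> \<le> N * (N + 1 + 1) + 2"
        using length_le_sz[of l] by (intro add_le_mono1 mult_le_mono1) (simp add: N_def)
      finally show ?thesis using sz_drop[of i l]
        by (simp add: state_def sz_rev Mp_def N_def algebra_simps)
    qed
    have le: "sz (state i) ^ k \<le> poly Mp N ^ k" for i k by (rule power_mono[OF M]) simp
    have B: "poly Bp N = poly Mp N ^ kb + poly Mp N ^ k1 + poly Mp N ^ k2 + 2 * poly Mp N ^ k3 +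
        poly Mp N ^ k4 + N + 3 * poly Mp N + 4"
      by (simp add: Bp_def)
    have "runs_within Q (While b body) (encode (state 0)) (encode (state (length l)))
        (Suc (length l) * (3 * poly Bp N + 1))"
    proof (rule runs_within_While)
      fix i assume i: "i < length l"
      have nth: "l ! i \<in> set l" using i by simp
      have st: "fst (state i) = l ! i # drop (Suc i) l"
        using i by (simp add: state_def Cons_nth_drop_Suc)
      show "runs_within Q b (encode (state i)) (encode True) (poly Bp N)"
        using b[of Q "state i"] le[of i kb] st unfolding B by (auto elim!: runs_within_mono)
      have ans: "Q (encode (snd (l ! i))) = encode (A (snd (l ! i)))" "sz (A (snd (l ! i))) \<le> W"
        using Q[of "fst (l ! i)" "snd (l ! i)"] nth by simp_all
      have q3: "runs_within Q c3 (encode (state i)) (encode (snd (l ! i))) (poly Mp N ^ k3)"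
        using c3[of Q "state i"] le[of i k3] st by (auto elim!: runs_within_mono)
      have ask: "runs_within Q Ask (encode (snd (l ! i))) (encode (A (snd (l ! i)))) (poly Mp N ^ k3 + W)"
        using run.Ask[of Q "encode (snd (l ! i))"] runs_within_size[OF q3] ans
        unfolding runs_within_def by (intro exI[of _ "sz (snd (l ! i)) + sz (A (snd (l ! i)))"]) simp
      have q1: "runs_within Q c1 (encode (state i)) (encode (drop (Suc i) l)) (poly Mp N ^ k1)"
        using c1[of Q "state i"] le[of i k1] st by (auto elim!: runs_within_mono)
      have q2: "runs_within Q c2 (encode (state i)) (encode (fst (l ! i))) (poly Mp N ^ k2)"
        using c2[of Q "state i"] le[of i k2] st by (auto elim!: runs_within_mono)
      have q4: "runs_within Q c4 (encode (state i)) (encode (snd (state i))) (poly Mp N ^ k4)"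
        using c4[of Q "state i"] le[of i k4] by (auto elim!: runs_within_mono)
      have "encode (state (Suc i)) = Node (encode (drop (Suc i) l))
          (Node (Node (encode (fst (l ! i))) (encode (A (snd (l ! i))))) (encode (snd (state i))))"
        using i by (simp add: state_def take_Suc_conv_app_nth f_def)
      then show "runs_within Q body (encode (state i)) (encode (state (Suc i))) (poly Bp N)"
        using runs_within_Fork[OF q1 runs_within_Fork[OF runs_within_Fork[OF q2 runs_within_Seq[OF q3 ask]] q4]]
          M[of i] unfolding body_def B by (auto elim!: runs_within_mono simp: N_def)
    next
      show "runs_within Q b (encode (state (length l))) (encode False) (poly Bp N)"
        using b[of Q "state (length l)"] le[of "length l" kb] unfolding B
        by (auto elim!: runs_within_mono simp: state_def)
    next
      show "sz (state i) \<le> poly Bp N" for i using M[of i] unfolding B by simp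
    qed
    moreover have "runs_within Q c4 (encode (state (length l))) (encode (rev (map f l))) (poly Mp N ^ k4)"
      using c4[of Q "state (length l)"] le[of "length l" k4]
      by (auto elim!: runs_within_mono simp: state_def)
    moreover have "runs_within Q c0 (encode l) (encode (state 0)) (sz l ^ k0)"
      using c0 by (simp add: state_def)
    ultimately have "runs_within Q (Seq c0 (Seq (While b body) c4)) (encode l) (encode (rev (map f l)))
        (sz l ^ k0 + (Suc (length l) * (3 * poly Bp N + 1) + poly Mp N ^ k4 + 1) + 1)"
      by (blast intro: runs_within_Seq)
    moreover have "sz l ^ k0 \<le> N ^ k0" by (rule power_mono) (simp_all add: N_def)
    moreover have "Suc (length l) * (3 * poly Bp N + 1) \<le> (1 + N) * (3 * poly Bp N + 1)"
      using length_le_sz[of l] by (intro mult_le_mono1) (simp add: N_def)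
    ultimately show "runs_within Q (Seq c0 (Seq (While b body) c4)) (encode l)
        (encode (rev (map (\<lambda>z. (fst z, A (snd z))) l))) (poly P (W + sz l))"
      unfolding N_def[symmetric] f_def[symmetric] by (elim runs_within_mono) (simp add: P_def)
  qed
qed

section \<open>Cells\<close>

text \<open>
The curve \<open>(\<delta>, \<delta>\<^sup>2, \<dots>, \<delta>\<^sup>p)\<close> is in no hyperplane, so that following it from \<open>\<beta>\<close> separates any two
residuals that are not identical.
\<close>

definition perturb :: "nat \<Rightarrow> (nat \<Rightarrow> real) \<Rightarrow> real \<Rightarrow> nat \<Rightarrow> real" where
  "perturb p \<beta> \<delta> = (\<lambda>j. if j < p then \<beta> j + \<delta> ^ Suc j else 0)"

lemma perturb_in_Rp: "perturb p \<beta> \<delta> \<in> Rp p"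
  by (simp add: perturb_def topspace_Euclidean_space)

lemma perturb_0: "\<beta> \<in> Rp p \<Longrightarrow> perturb p \<beta> 0 = \<beta>"
  by (auto simp: perturb_def topspace_Euclidean_space fun_eq_iff)

lemma continuous_perturb: "continuous_map euclideanreal (Euclidean_space p) (perturb p \<beta>)"
  unfolding perturb_def
  by (subst continuous_map_componentwise_Euclidean_space) (auto intro!: continuous_intros)

text \<open>
Finitely many nonzero polynomials have no roots in some interval to the right of \<open>0\<close>, and hence, by
the intermediate value theorem, constant signs there, which can differ from the signs at \<open>0\<close> only
if the value at \<open>0\<close> is \<open>0\<close>.
\<close>

lemma nonzero_polys_near_0:
  fixes P :: "'i \<Rightarrow> real poly"
  assumes "finite I" and "\<And>i. i \<in> I \<Longrightarrow> P i \<noteq> 0"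
  shows "\<exists>\<epsilon>>0. \<forall>i\<in>I. \<forall>\<delta>. 0 < \<delta> \<longrightarrow> \<delta> < \<epsilon> \<longrightarrow>
    poly (P i) \<delta> \<noteq> 0 \<and> (poly (P i) \<delta> < 0 \<longrightarrow> poly (P i) 0 \<le> 0)"
proof -
  have "finite (\<Union>i\<in>I. {x. poly (P i) x = 0})" using assms by (auto intro: poly_roots_finite)
  from finite_set_avoid[OF this, of 0] obtain \<epsilon> where "0 < \<epsilon>"
    and \<epsilon>: "\<And>i x. i \<in> I \<Longrightarrow> poly (P i) x = 0 \<Longrightarrow> x \<noteq> 0 \<Longrightarrow> \<epsilon> \<le> dist 0 x"
    by blast
  have root: "poly (P i) x \<noteq> 0" if "i \<in> I" "0 < x" "x < \<epsilon>" for i x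
    using \<epsilon>[OF that(1), of x] that(2,3) by (auto simp: dist_real_def)
  have "poly (P i) 0 \<le> 0" if i: "i \<in> I" and \<delta>: "0 < \<delta>" "\<delta> < \<epsilon>" and neg: "poly (P i) \<delta> < 0" for i \<delta>
  proof (rule ccontr)
    assume "\<not> poly (P i) 0 \<le> 0"
    then obtain x where "0 < x" "x < \<delta>" "poly (P i) x = 0"
      using poly_IVT_neg[OF \<delta>(1) _ neg] by auto
    then show False using root[OF i, of x] \<delta> by simp
  qed
  with root \<open>0 < \<epsilon>\<close> show ?thesis by blast
qed

lemma perturbation_separates:
  assumes rows: "no_identical_rows n p X y"
  shows "\<exists>\<epsilon>>0. \<forall>\<delta>. 0 < \<delta> \<longrightarrow> \<delta> < \<epsilon> \<longrightarrow> (\<forall>i<n. \<forall>k<n. i \<noteq> k \<longrightarrow>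
    residual p X y (perturb p \<beta> \<delta>) i \<noteq> residual p X y (perturb p \<beta> \<delta>) k \<and>
    (residual p X y (perturb p \<beta> \<delta>) i < residual p X y (perturb p \<beta> \<delta>) k \<longrightarrow>
      residual p X y \<beta> i \<le> residual p X y \<beta> k))"
proof -
  define P where "P z = [:residual p X y \<beta> (fst z) - residual p X y \<beta> (snd z):]
    - (\<Sum>j<p. monom (X (fst z) j - X (snd z) j) (Suc j))" for z
  define I where "I = {z \<in> {..<n} \<times> {..<n}. fst z \<noteq> snd z}"
  have poly_P: "poly (P (i, k)) \<delta> = residual p X y (perturb p \<beta> \<delta>) i - residual p X y (perturb p \<beta> \<delta>) k" for i k \<delta>
    by (simp add: P_def residual_def perturb_def poly_sum poly_monom sum_subtractf sum.distrib algebra_simps)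
  \<comment> \<open>The coefficients of \<open>\<delta>, \<dots>, \<delta>\<^sup>p\<close> recover the difference of the rows of \<open>X\<close>, the constant one that of \<open>y\<close>.\<close>
  have "P (i, k) \<noteq> 0" if "(i, k) \<in> I" for i k
  proof
    assume zero: "P (i, k) = 0"
    have "X i j = X k j" if "j < p" for j
    proof -
      have "coeff (P (i, k)) (Suc j) = - (X i j - X k j)"
        using that by (simp add: P_def coeff_sum)
      with zero show ?thesis by simp
    qed
    moreover have "residual p X y \<beta> i - residual p X y \<beta> k = 0"
      using poly_P[of i k 0] arg_cong[OF zero, of "\<lambda>q. coeff q 0"] by (simp add: P_def coeff_sum)
    ultimately have "y i = y k" by (simp add: residual_def)
    with \<open>\<And>j. j < p \<Longrightarrow> X i j = X k j\<close> that rows show False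
      unfolding no_identical_rows_def I_def by auto
  qed
  moreover have "finite I" by (simp add: I_def)
  ultimately obtain \<epsilon> where "\<epsilon> > 0" and \<epsilon>: "\<And>i k \<delta>. (i, k) \<in> I \<Longrightarrow> 0 < \<delta> \<Longrightarrow> \<delta> < \<epsilon> \<Longrightarrow>
    poly (P (i, k)) \<delta> \<noteq> 0 \<and> (poly (P (i, k)) \<delta> < 0 \<longrightarrow> poly (P (i, k)) 0 \<le> 0)"
    using nonzero_polys_near_0[of I P] by (metis surj_pair)
  have at0: "poly (P (i, k)) 0 = residual p X y \<beta> i - residual p X y \<beta> k" for i k
    by (simp add: P_def poly_sum poly_monom)
  show ?thesis
    using \<open>\<epsilon> > 0\<close> \<epsilon> unfolding at0 unfolding poly_P I_def by (intro exI[of _ \<epsilon>]) auto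
qed

lemma permutes_nth:
  assumes "distinct xs" "set xs = {..<n}"
  shows "(\<lambda>k. if k < n then xs ! k else k) permutes {..<n}"
proof -
  have len: "length xs = n" using distinct_card[OF assms(1)] assms(2) by simp
  have "bij_betw (\<lambda>k. xs ! k) {..<n} {..<n}"
    using bij_betw_nth[OF assms(1) refl refl] assms(2) len by (simp add: lessThan_atLeast0)
  then have "bij_betw (\<lambda>k. if k < n then xs ! k else k) {..<n} {..<n}"
    by (rule bij_betw_cong[THEN iffD1, rotated]) simp
  then show ?thesis by (rule bij_imp_permutes) simp
qed

lemma sorting_permutation:
  fixes v :: "nat \<Rightarrow> real"
  assumes "\<And>i k. i < n \<Longrightarrow> k < n \<Longrightarrow> i \<noteq> k \<Longrightarrow> v i \<noteq> v k"
  shows "\<exists>\<pi>. \<pi> permutes {..<n} \<and> (\<forall>k. Suc k < n \<longrightarrow> v (\<pi> k) < v (\<pi> (Suc k)))"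
proof -
  define xs where "xs = sort_key v [0..<n]"
  have xs: "distinct xs" "set xs = {..<n}" by (auto simp: xs_def)
  have len: "length xs = n" by (simp add: xs_def)
  have "v (xs ! k) < v (xs ! Suc k)" if "Suc k < n" for k
  proof -
    have "sorted (map v xs)" by (simp add: xs_def)
    then have "v (xs ! k) \<le> v (xs ! Suc k)"
      using that len by (auto dest!: sorted_nth_mono[of _ k "Suc k"])
    moreover have "xs ! k \<noteq> xs ! Suc k" using that len xs(1) by (simp add: nth_eq_iff_index_eq)
    moreover have "xs ! k < n" "xs ! Suc k < n" using that len xs(2) nth_mem[of k xs] nth_mem[of "Suc k" xs] by auto
    ultimately show ?thesis using assms[of "xs ! k" "xs ! Suc k"] by linarith
  qed
  then show ?thesis using permutes_nth[OF xs] by (intro exI[of _ "\<lambda>k. if k < n then xs ! k else k"]) auto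
qed

lemma chain_le:
  fixes f :: "nat \<Rightarrow> real"
  assumes "\<And>k. Suc k < n \<Longrightarrow> f k \<le> f (Suc k)" and "a \<le> b" and "b < n"
  shows "f a \<le> f b"
  using assms(2,3)
proof (induction b)
  case (Suc b)
  then show ?case using assms(1)[of b] by (cases "a = Suc b") auto
qed simp

lemma chain_less:
  fixes f :: "nat \<Rightarrow> real"
  assumes "\<And>k. Suc k < n \<Longrightarrow> f k < f (Suc k)" and "a < b" and "b < n"
  shows "f a < f b"
  using assms(2,3)
proof (induction b)
  case (Suc b)
  then show ?case using assms(1)[of b] by (cases "a = b") auto
qed simp

lemma sorting_permutation_unique:
  fixes v :: "nat \<Rightarrow> real"
  assumes "\<pi> permutes {..<n}" "\<And>k. Suc k < n \<Longrightarrow> v (\<pi> k) < v (\<pi> (Suc k))"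
    and "\<sigma> permutes {..<n}" "\<And>k. Suc k < n \<Longrightarrow> v (\<sigma> k) < v (\<sigma> (Suc k))"
  shows "\<pi> = \<sigma>"
proof -
  have sorted: "sorted_wrt (<) (map (\<lambda>k. v (\<tau> k)) [0..<n])"
    if "\<And>k. Suc k < n \<Longrightarrow> v (\<tau> k) < v (\<tau> (Suc k))" for \<tau>
    using chain_less[of n "\<lambda>k. v (\<tau> k)"] that by (auto simp: sorted_wrt_iff_nth_less)
  have set: "set (map (\<lambda>k. v (\<tau> k)) [0..<n]) = v ` {..<n}" if "\<tau> permutes {..<n}" for \<tau>
    using permutes_image[OF that] by (auto simp: lessThan_atLeast0 image_image[symmetric])
  have "map (\<lambda>k. v (\<pi> k)) [0..<n] = map (\<lambda>k. v (\<sigma> k)) [0..<n]"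
    using strict_sorted_equal[OF sorted[of \<pi>, OF assms(2)] sorted[of \<sigma>, OF assms(4)]]
      set[OF assms(1)] set[OF assms(3)] by simp
  then have eq: "v (\<pi> k) = v (\<sigma> k)" if "k < n" for k using that by (simp add: map_eq_conv)
  have inj: "inj_on v {..<n}"
  proof (rule inj_onI)
    fix i k assume ik: "i \<in> {..<n}" "k \<in> {..<n}" "v i = v k"
    obtain a b where ab: "a < n" "i = \<pi> a" "b < n" "k = \<pi> b"
      using ik(1,2) permutes_image[OF assms(1)] by (metis imageE lessThan_iff)
    then show "i = k"
      using ik(3) chain_less[of n "\<lambda>k. v (\<pi> k)", OF assms(2)] by (cases a b rule: linorder_cases) force+
  qed
  show ?thesis
  proof
    fix k
    show "\<pi> k = \<sigma> k"
    proof (cases "k < n")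
      case True
      then show ?thesis
        using inj_onD[OF inj eq[OF True]] permutes_in_image[OF assms(1)] permutes_in_image[OF assms(3)] by simp
    next
      case False
      then show ?thesis using assms(1,3) by (simp add: permutes_def)
    qed
  qed
qed

lemma strict_C_of_subset: "strict_C_of n p X y \<pi> \<subseteq> C_of n p X y \<pi>"
  unfolding strict_C_of_def C_of_def by (auto intro: less_imp_le)

lemma openin_strict_C_of: "openin (Euclidean_space p) (strict_C_of n p X y \<pi>)"
proof -
  have cont: "continuous_map (Euclidean_space p) euclideanreal
      (\<lambda>\<beta>. residual p X y \<beta> i - residual p X y \<beta> k)" for i k
    unfolding continuous_map_Euclidean_space_iff residual_def
    by (intro continuous_intros continuous_on_subset[OF continuous_on_product_coordinates]) auto
  have "openin (Euclidean_space p)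
      {\<beta> \<in> Rp p. residual p X y \<beta> (\<pi> k) - residual p X y \<beta> (\<pi> (Suc k)) \<in> {..<0}}" for k
    by (rule openin_continuous_map_preimage[OF cont]) simp
  moreover have "finite {k. Suc k < n}" by (rule finite_subset[of _ "{..<n}"]) auto
  ultimately have "openin (Euclidean_space p) (topspace (Euclidean_space p) \<inter> (\<Inter>k\<in>{k. Suc k < n}.
      {\<beta> \<in> Rp p. residual p X y \<beta> (\<pi> k) - residual p X y \<beta> (\<pi> (Suc k)) \<in> {..<0}}))"
    by (intro openin_Int_Inter finite_imageI) auto
  also have "topspace (Euclidean_space p) \<inter> (\<Inter>k\<in>{k. Suc k < n}.
      {\<beta> \<in> Rp p. residual p X y \<beta> (\<pi> k) - residual p X y \<beta> (\<pi> (Suc k)) \<in> {..<0}})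
    = strict_C_of n p X y \<pi>"
    by (auto simp: strict_C_of_def)
  finally show ?thesis .
qed

text \<open>
The strict inequalities define an open set.
\<close>

lemma strict_imp_cell:
  assumes "\<pi> permutes {..<n}" and "\<beta> \<in> strict_C_of n p X y \<pi>"
  shows "\<pi> \<in> cells n p X y"
proof -
  have "strict_C_of n p X y \<pi> \<subseteq> cell_interior n p X y \<pi>"
    unfolding cell_interior_def
    by (rule interior_of_maximal[OF strict_C_of_subset openin_strict_C_of])
  then show ?thesis using assms by (auto simp: cells_def)
qed

text \<open>
The permutation that sorts the residuals at a small perturbation of \<open>\<beta>\<close> sorts them weakly at \<open>\<beta>\<close>.
\<close>

lemma cells_cover:
  assumes "no_identical_rows n p X y" and "\<beta> \<in> Rp p"
  shows "\<exists>\<pi>\<in>cells n p X y. \<beta> \<in> C_of n p X y \<pi>"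
proof -
  obtain \<epsilon> where "\<epsilon> > 0" and \<epsilon>: "\<forall>\<delta>. 0 < \<delta> \<longrightarrow> \<delta> < \<epsilon> \<longrightarrow> (\<forall>i<n. \<forall>k<n. i \<noteq> k \<longrightarrow>
    residual p X y (perturb p \<beta> \<delta>) i \<noteq> residual p X y (perturb p \<beta> \<delta>) k \<and>
    (residual p X y (perturb p \<beta> \<delta>) i < residual p X y (perturb p \<beta> \<delta>) k \<longrightarrow>
      residual p X y \<beta> i \<le> residual p X y \<beta> k))"
    using perturbation_separates[OF assms(1)] by blast
  define \<gamma> where "\<gamma> = perturb p \<beta> (\<epsilon> / 2)"
  have sep: "residual p X y \<gamma> i \<noteq> residual p X y \<gamma> k \<and>
      (residual p X y \<gamma> i < residual p X y \<gamma> k \<longrightarrow> residual p X y \<beta> i \<le> residual p X y \<beta> k)"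
    if "i < n" "k < n" "i \<noteq> k" for i k
    using \<epsilon>[rule_format, of "\<epsilon> / 2"] \<open>\<epsilon> > 0\<close> that unfolding \<gamma>_def by simp
  obtain \<pi> where \<pi>: "\<pi> permutes {..<n}"
    "\<And>k. Suc k < n \<Longrightarrow> residual p X y \<gamma> (\<pi> k) < residual p X y \<gamma> (\<pi> (Suc k))"
    using sorting_permutation[of n "residual p X y \<gamma>"] sep by blast
  have "\<gamma> \<in> strict_C_of n p X y \<pi>"
    using \<pi>(2) perturb_in_Rp by (simp add: strict_C_of_def \<gamma>_def)
  moreover have "residual p X y \<beta> (\<pi> k) \<le> residual p X y \<beta> (\<pi> (Suc k))" if "Suc k < n" for k
  proof -
    have "\<pi> k < n" "\<pi> (Suc k) < n" "\<pi> k \<noteq> \<pi> (Suc k)"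
      using that permutes_in_image[OF \<pi>(1)] permutes_inj[OF \<pi>(1)] by (auto dest: injD)
    then show ?thesis using sep \<pi>(2)[OF that] by blast
  qed
  ultimately show ?thesis using assms(2) strict_imp_cell[OF \<pi>(1), of \<gamma> p X y]
    by (intro bexI[of _ \<pi>]) (auto simp: C_of_def)
qed

text \<open>
A small perturbation of an interior point stays in the cell and has no ties.
\<close>

lemma cell_imp_strict:
  assumes "no_identical_rows n p X y" and \<pi>: "\<pi> \<in> cells n p X y"
  shows "\<exists>\<beta>. \<beta> \<in> strict_C_of n p X y \<pi>"
proof -
  define U where "U = cell_interior n p X y \<pi>"
  have U: "openin (Euclidean_space p) U" "U \<subseteq> C_of n p X y \<pi>"
    unfolding U_def cell_interior_def by (rule openin_interior_of interior_of_subset)+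
  have perm: "\<pi> permutes {..<n}" using \<pi> by (simp add: cells_def)
  obtain \<beta> where "\<beta> \<in> U" using \<pi> by (auto simp: cells_def U_def)
  then have \<beta>: "\<beta> \<in> Rp p" using openin_subset[OF U(1)] by blast
  obtain \<epsilon> where "\<epsilon> > 0" and \<epsilon>: "\<forall>\<delta>. 0 < \<delta> \<longrightarrow> \<delta> < \<epsilon> \<longrightarrow> (\<forall>i<n. \<forall>k<n. i \<noteq> k \<longrightarrow>
    residual p X y (perturb p \<beta> \<delta>) i \<noteq> residual p X y (perturb p \<beta> \<delta>) k \<and>
    (residual p X y (perturb p \<beta> \<delta>) i < residual p X y (perturb p \<beta> \<delta>) k \<longrightarrow>
      residual p X y \<beta> i \<le> residual p X y \<beta> k))"
    using perturbation_separates[OF assms(1)] by blast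
  have "open {\<delta>. perturb p \<beta> \<delta> \<in> U}"
    using openin_continuous_map_preimage[OF continuous_perturb U(1)] by simp
  moreover have "0 \<in> {\<delta>. perturb p \<beta> \<delta> \<in> U}" using \<open>\<beta> \<in> U\<close> by (simp add: perturb_0[OF \<beta>])
  ultimately obtain e where "e > 0" and e: "ball 0 e \<subseteq> {\<delta>. perturb p \<beta> \<delta> \<in> U}"
    using openE by blast
  define \<delta> where "\<delta> = min e \<epsilon> / 2"
  have \<delta>: "0 < \<delta>" "\<delta> < \<epsilon>" "\<delta> < e" using \<open>e > 0\<close> \<open>\<epsilon> > 0\<close> by (auto simp: \<delta>_def)
  then have "\<delta> \<in> ball 0 e" by simp
  then have "perturb p \<beta> \<delta> \<in> C_of n p X y \<pi>" using e U(2) by blast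
  moreover have "residual p X y (perturb p \<beta> \<delta>) (\<pi> k) \<noteq> residual p X y (perturb p \<beta> \<delta>) (\<pi> (Suc k))"
    if "Suc k < n" for k
  proof -
    have "\<pi> k < n" "\<pi> (Suc k) < n" "\<pi> k \<noteq> \<pi> (Suc k)"
      using that permutes_in_image[OF perm] permutes_inj[OF perm] by (auto dest: injD)
    then show ?thesis using \<epsilon> \<delta> by blast
  qed
  ultimately have "perturb p \<beta> \<delta> \<in> strict_C_of n p X y \<pi>"
    by (auto simp: C_of_def strict_C_of_def less_le)
  then show ?thesis by blast
qed

lemma in_GEN_value:
  assumes "in_GEN n p X y a F" and \<beta>: "\<beta> \<in> Rp p"
  shows "\<pi> \<in> cells n p X y \<Longrightarrow> \<beta> \<in> C_of n p X y \<pi> \<Longrightarrow>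
      F \<beta> \<le> (\<Sum>i<n. cell_coef n p X y a \<pi> i * residual p X y \<beta> i)"
    and "\<exists>\<pi>\<in>cells n p X y. \<beta> \<in> C_of n p X y \<pi> \<and>
      F \<beta> = (\<Sum>i<n. cell_coef n p X y a \<pi> i * residual p X y \<beta> i)"
proof -
  define V where "V \<pi> = (\<Sum>i<n. cell_coef n p X y a \<pi> i * residual p X y \<beta> i)" for \<pi>
  define S where "S = {V \<pi> | \<pi>. \<pi> \<in> cells n p X y \<and> \<beta> \<in> C_of n p X y \<pi>}"
  have rows: "no_identical_rows n p X y" and F: "F \<beta> = Min S"
    using assms unfolding in_GEN_def S_def V_def by blast+
  have "finite (cells n p X y)"
    unfolding cells_def by (rule finite_subset[OF _ finite_permutations[of "{..<n}"]]) auto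
  then have fin: "finite S"
    unfolding S_def by (rule finite_subset[rotated, OF finite_imageI[of _ V]]) auto
  have "S \<noteq> {}" using cells_cover[OF rows \<beta>] by (auto simp: S_def)
  then have "Min S \<in> S" using fin by (rule Min_in[rotated])
  then show "\<exists>\<pi>\<in>cells n p X y. \<beta> \<in> C_of n p X y \<pi> \<and>
      F \<beta> = (\<Sum>i<n. cell_coef n p X y a \<pi> i * residual p X y \<beta> i)"
    unfolding F[symmetric] by (auto simp: S_def V_def)
  show "F \<beta> \<le> (\<Sum>i<n. cell_coef n p X y a \<pi> i * residual p X y \<beta> i)"
    if "\<pi> \<in> cells n p X y" "\<beta> \<in> C_of n p X y \<pi>"
    unfolding F by (rule Min_le[OF fin]) (use that in \<open>auto simp: S_def V_def\<close>)
qed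

section \<open>Ranking\<close>

lemma sort_strict_sorted: "sorted_wrt (\<lambda>x y. fst x < fst y) (sort_strict l)"
proof (induction l)
  case (Cons x l)
  then show ?case
    by (auto simp: sort_strict_def insert_strict_def sorted_wrt_append intro: sorted_wrt_filter)
qed (simp add: sort_strict_def)

lemma distinct_sort_strict: "distinct (sort_strict l)"
proof -
  have "sorted_wrt (<) (map fst (sort_strict l))"
    using sort_strict_sorted[of l] unfolding sorted_wrt_map .
  from strict_sorted_iff[THEN iffD1, THEN conjunct2, OF this]
  show ?thesis by (rule distinct_map[THEN iffD1, THEN conjunct1])
qed

lemma set_sort_strict_subset: "set (sort_strict l) \<subseteq> set l"
  by (induction l) (auto simp: sort_strict_def insert_strict_def)

lemma set_sort_strict: "inj_on fst (set l) \<Longrightarrow> set (sort_strict l) = set l"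
proof (induction l)
  case (Cons x l)
  then have IH: "set (sort_strict l) = set l" by (auto simp: inj_on_def)
  have "y = x" if "y \<in> set l" "fst y = fst x" for y
    using Cons.prems that by (auto simp: inj_on_def)
  moreover have "set (sort_strict (x # l)) = {y \<in> set (sort_strict l). fst y \<noteq> fst x} \<union> {x}"
    by (auto simp: sort_strict_def insert_strict_def)
  ultimately show ?case unfolding IH by auto
qed (simp add: sort_strict_def)

definition perm_of :: "nat \<Rightarrow> int list \<Rightarrow> nat \<Rightarrow> nat" where
  "perm_of n l = (\<lambda>k. if k < n then nat (l ! k) else k)"

lemma ranking_eq: "ranking R q =
  map snd (sort_strict (map (\<lambda>i. (dot (R ! i) q, int i)) [0..<length R]))"
proof -
  have "zip (map (\<lambda>r. dot r q) R) (map int [0..<length R]) = map (\<lambda>i. (dot (R ! i) q, int i)) [0..<length R]"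
    by (rule nth_equalityI) simp_all
  then show ?thesis by (simp add: ranking_def)
qed

text \<open>
If no entry was dropped by the sorting, the ranking lists all indices in the order of their strictly
increasing keys.
\<close>

lemma ranking_permutation:
  assumes n: "length R = n" and len: "length (ranking R q) = n"
  defines "\<pi> \<equiv> perm_of n (ranking R q)"
  shows "\<pi> permutes {..<n}" and "encode (ranking R q) = enc_perm n \<pi>"
    and "Suc k < n \<Longrightarrow> dot (R ! \<pi> k) q < dot (R ! \<pi> (Suc k)) q"
proof -
  define P T where "P = map (\<lambda>i. (dot (R ! i) q, int i)) [0..<n]" and "T = sort_strict P"
  have rank: "ranking R q = map snd T" by (simp add: ranking_eq n T_def P_def)
  then have lT: "length T = n" using len by simp
  have sorted: "sorted_wrt (\<lambda>x y. fst x < fst y) T" unfolding T_def by (rule sort_strict_sorted)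
  have "distinct T" unfolding T_def by (rule distinct_sort_strict)
  from distinct_card[OF this] have "card (set T) = n" unfolding lT .
  moreover have "card (set P) \<le> n" using card_length[of P] by (simp add: P_def)
  ultimately have set: "set T = set P"
    using set_sort_strict_subset[of P] by (intro card_seteq) (simp_all add: T_def)
  define xs where "xs = map (\<lambda>z. nat (snd z)) T"
  have set_xs: "set xs = {..<n}" unfolding xs_def set_map set by (auto simp: P_def image_image)
  have "card (set xs) = length xs" unfolding set_xs by (simp add: xs_def lT)
  note xs = card_distinct[OF this] set_xs
  have \<pi>: "\<pi> k = nat (snd (T ! k))" if "k < n" for k
    using that lT by (simp add: \<pi>_def perm_of_def rank)
  have "\<pi> = (\<lambda>k. if k < n then xs ! k else k)"
    using lT by (auto simp: \<pi>_def perm_of_def rank xs_def fun_eq_iff)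
  then show "\<pi> permutes {..<n}" using permutes_nth[OF xs] by simp
  have entry: "T ! k = (dot (R ! \<pi> k) q, int (\<pi> k))" if "k < n" for k
  proof -
    have "T ! k \<in> set P" using that lT set by (metis nth_mem)
    then show ?thesis using \<pi>[OF that] by (auto simp: P_def)
  qed
  have "ranking R q = map (\<lambda>k. int (\<pi> k)) [0..<n]"
    by (rule nth_equalityI) (simp_all add: rank lT entry)
  then show "encode (ranking R q) = enc_perm n \<pi>"
    by (simp add: encode_list_def enc_perm_def comp_def)
  show "dot (R ! \<pi> k) q < dot (R ! \<pi> (Suc k)) q" if "Suc k < n"
    using sorted_wrt_nth_less[OF sorted, of k "Suc k"] that lT by (simp add: entry)
qed

lemma length_ranking:
  assumes n: "length R = n"
    and dist: "\<And>i k. i < n \<Longrightarrow> k < n \<Longrightarrow> i \<noteq> k \<Longrightarrow> dot (R ! i) q \<noteq> dot (R ! k) q"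
  shows "length (ranking R q) = n"
proof -
  define P where "P = map (\<lambda>i. (dot (R ! i) q, int i)) [0..<n]"
  have "inj_on fst (set P)" by (auto simp: P_def inj_on_def) (use dist in blast)
  then have "set (sort_strict P) = set P" by (rule set_sort_strict)
  moreover have "distinct (sort_strict P)" by (rule distinct_sort_strict)
  moreover have "distinct P" by (simp add: P_def distinct_map inj_on_def)
  ultimately have "length (sort_strict P) = length P" by (metis distinct_card)
  then show ?thesis by (simp add: ranking_eq n P_def)
qed

section \<open>Correctness\<close>

lemma dot_eq_sum: "length u = d \<Longrightarrow> length v = d \<Longrightarrow> dot u v = (\<Sum>j<d. u ! j * v ! j)"
proof (induction u arbitrary: v d)
  case (Cons a u)
  then show ?case by (cases v; cases d) (simp_all add: sum.lessThan_Suc_shift del: sum.lessThan_Suc)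
qed simp

lemma dot_height: "length z = Suc p \<Longrightarrow> dot (replicate p 0 @ [1]) z = z ! p"
  by (subst dot_eq_sum[of _ "Suc p"]) (simp_all add: nth_append)

lemma dot_subtract: "length u = length v \<Longrightarrow> length v = length z \<Longrightarrow>
    dot (subtract u v) z = dot u z - dot v z"
  using dot_combination[of u v z 1 1] by (simp add: subtract_def)

lemma real_dot_subtract: "length u = length v \<Longrightarrow> length v = length z \<Longrightarrow>
    dot (real_vec (subtract u v)) z = dot (real_vec u) z - dot (real_vec v) z"
  using dot_combination[of "real_vec u" "real_vec v" z 1 1]
  by (simp add: subtract_def zip_map1 zip_map2 split_beta comp_def)

lemma linear_combination_dot:
  fixes c :: "nat \<Rightarrow> real"
  assumes "\<And>i. i < m \<Longrightarrow> length (u i) = d"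
  shows "\<exists>L. length L = d \<and> (\<forall>z. length z = d \<longrightarrow> dot L z = (\<Sum>i<m. c i * dot (u i) z))"
  using assms
proof (induction m)
  case 0
  show ?case by (intro exI[of _ "replicate d 0"]) simp
next
  case (Suc m)
  then obtain L where L: "length L = d" "\<And>z. length z = d \<Longrightarrow> dot L z = (\<Sum>i<m. c i * dot (u i) z)"
    by auto
  have "dot (map (\<lambda>x. 1 * fst x - (- c m) * snd x) (zip L (u m))) z = (\<Sum>i<Suc m. c i * dot (u i) z)"
    if "length z = d" for z
    using Suc.prems[of m] L that by (subst dot_combination) simp_all
  then show ?case using Suc.prems[of m] L(1)
    by (intro exI[of _ "map (\<lambda>x. 1 * fst x - (- c m) * snd x) (zip L (u m))"]) simp
qed

definition homogenize :: "nat \<Rightarrow> (nat \<Rightarrow> real) \<Rightarrow> real list" where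
  "homogenize p \<beta> = map (\<lambda>j. - \<beta> j) [0..<p] @ [1]"

definition dehomogenize :: "nat \<Rightarrow> int list \<Rightarrow> nat \<Rightarrow> real" where
  "dehomogenize p s = (\<lambda>j. if j < p then - real_of_int (s ! j) / real_of_int (s ! p) else 0)"

lemma length_homogenize [simp]: "length (homogenize p \<beta>) = Suc p"
  by (simp add: homogenize_def)

lemma dehomogenize_in_Rp: "dehomogenize p s \<in> Rp p"
  by (simp add: dehomogenize_def topspace_Euclidean_space)

text \<open>
The integer matrix \<open>R\<close> is the data matrix \<open>(X, y)\<close> multiplied by the common denominator \<open>D\<close>.
\<close>

locale scaled_GEN =
  fixes n p :: nat and X :: "nat \<Rightarrow> nat \<Rightarrow> real" and y :: "nat \<Rightarrow> real"
    and a :: "(nat \<Rightarrow> real) \<Rightarrow> nat \<Rightarrow> real" and F :: "(nat \<Rightarrow> real) \<Rightarrow> real"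
    and R :: "int list list" and D :: int
  assumes length_R: "length R = n"
    and length_row: "\<And>r. r \<in> set R \<Longrightarrow> length r = Suc p"
    and D_pos: "0 < D"
    and X_entry: "\<And>i j. i < n \<Longrightarrow> j < p \<Longrightarrow> real_of_int (R ! i ! j) = real_of_int D * X i j"
    and y_entry: "\<And>i. i < n \<Longrightarrow> real_of_int (R ! i ! p) = real_of_int D * y i"
    and GEN: "in_GEN n p X y a F"
begin

abbreviation "res \<equiv> residual p X y"
abbreviation "coef \<equiv> cell_coef n p X y a"
abbreviation "H \<equiv> arrangement p R"
abbreviation "S \<equiv> set (samples (Suc p) H)"
abbreviation "C \<pi> \<equiv> C_of n p X y \<pi>"
abbreviation "row_at i g \<equiv> real_of_int (dot (R ! i) g)"
abbreviation "height g \<equiv> real_of_int (g ! p)"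

lemma rows_distinct: "no_identical_rows n p X y"
  using GEN unfolding in_GEN_def by (elim conjE)

lemma length_nth: "i < n \<Longrightarrow> length (R ! i) = Suc p"
  using length_row length_R nth_mem by metis

lemma set_H: "set H = {replicate p 0 @ [1]} \<union> {subtract (R ! i) (R ! k) | i k. i < n \<and> k < n}"
proof -
  have "set R = (\<lambda>i. R ! i) ` {..<n}"
    using length_R by (auto simp: set_conv_nth)
  moreover have "set H = {replicate p 0 @ [1]} \<union> {subtract r r' | r r'. r \<in> set R \<and> r' \<in> set R}"
    unfolding arrangement_def by auto
  ultimately show ?thesis by auto
qed

lemma length_H: "\<forall>h\<in>set H. length h = Suc p"
  unfolding set_H by (auto simp: subtract_def length_nth)

lemma length_S: "s \<in> S \<Longrightarrow> length s = Suc p"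
  by (rule length_samples)

lemma dot_homogenize: "i < n \<Longrightarrow> dot (real_vec (R ! i)) (homogenize p \<beta>) = D * res \<beta> i"
  using length_nth[of i]
  by (subst dot_eq_sum[of _ "Suc p"])
    (simp_all add: homogenize_def nth_append X_entry y_entry residual_def sum_negf
      sum_distrib_left algebra_simps)

lemma dot_row: "i < n \<Longrightarrow> length s = Suc p \<Longrightarrow>
    row_at i s = D * (y i * height s + (\<Sum>j<p. X i j * real_of_int (s ! j)))"
  using length_nth[of i]
  by (subst dot_eq_sum[of _ "Suc p"])
    (simp_all add: X_entry y_entry sum_distrib_left algebra_simps)

lemma dot_row_point:
  assumes "i < n" "length s = Suc p" "s ! p \<noteq> 0"
  shows "row_at i s = D * height s * res (dehomogenize p s) i"
proof -
  have "(\<Sum>j<p. X i j * dehomogenize p s j) = - (\<Sum>j<p. X i j * real_of_int (s ! j)) / height s"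
    by (simp add: dehomogenize_def sum_divide_distrib sum_negf)
  then show ?thesis
    using assms(3) unfolding dot_row[OF assms(1,2)] residual_def by (simp add: field_simps)
qed

text \<open>
The samples in the closed cone over \<open>{(-\<beta>, 1) | \<beta> \<in> C \<pi>}\<close>.
\<close>

definition ordered :: "(nat \<Rightarrow> nat) \<Rightarrow> int list \<Rightarrow> bool" where
  "ordered \<pi> g \<longleftrightarrow> g \<in> S \<and> 0 \<le> g ! p \<and> (\<forall>k. Suc k < n \<longrightarrow> dot (R ! \<pi> k) g \<le> dot (R ! \<pi> (Suc k)) g)"

text \<open>
The linear function of the cell, homogenized and multiplied by \<open>D\<close>: at \<open>g\<close> of positive height it is
\<open>D * height g\<close> times its value at the point of \<open>g\<close> (\<open>ordered_point\<close>), and at height \<open>0\<close> it is \<open>D\<close>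
times the slope in the direction \<open>-g\<close>.
\<close>

definition slope :: "(nat \<Rightarrow> nat) \<Rightarrow> int list \<Rightarrow> real" where
  "slope \<pi> g = (\<Sum>i<n. coef \<pi> i * row_at i g)"

lemma cell_permutes: "\<pi> \<in> cells n p X y \<Longrightarrow> \<pi> permutes {..<n}"
  by (simp add: cells_def)

lemma cell_less: "\<pi> \<in> cells n p X y \<Longrightarrow> k < n \<Longrightarrow> \<pi> k < n"
  using permutes_in_image[OF cell_permutes] by simp

lemma ordered_point:
  assumes \<pi>: "\<pi> \<in> cells n p X y" and g: "ordered \<pi> g" and pos: "0 < g ! p"
  shows "dehomogenize p g \<in> C \<pi>"
    and "slope \<pi> g = D * height g * (\<Sum>i<n. coef \<pi> i * res (dehomogenize p g) i)"
proof -
  have len: "length g = Suc p" using g length_S by (simp add: ordered_def)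
  have row: "row_at i g = D * height g * res (dehomogenize p g) i" if "i < n" for i
    using dot_row_point[OF that len] pos by simp
  show "slope \<pi> g = D * height g * (\<Sum>i<n. coef \<pi> i * res (dehomogenize p g) i)"
    by (simp add: slope_def row sum_distrib_left algebra_simps)
  have "res (dehomogenize p g) (\<pi> k) \<le> res (dehomogenize p g) (\<pi> (Suc k))" if k: "Suc k < n" for k
  proof -
    have "real_of_int (dot (R ! \<pi> k) g) \<le> real_of_int (dot (R ! \<pi> (Suc k)) g)"
      using g k by (simp add: ordered_def)
    moreover have "0 < real_of_int D * height g" using pos D_pos by simp
    ultimately show ?thesis
      using row[of "\<pi> k"] row[of "\<pi> (Suc k)"] cell_less[OF \<pi>] k by (simp add: mult_le_cancel_left_pos)
  qed
  then show "dehomogenize p g \<in> C \<pi>" using dehomogenize_in_Rp by (simp add: C_of_def)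
qed

lemma F_le_at_sample:
  assumes "\<pi> \<in> cells n p X y" and "ordered \<pi> g" and "0 < g ! p"
  shows "F (dehomogenize p g) \<le> slope \<pi> g / (D * height g)"
  using in_GEN_value(1)[OF GEN dehomogenize_in_Rp assms(1) ordered_point(1)[OF assms]] assms(3) D_pos
  unfolding ordered_point(2)[OF assms] by simp

text \<open>
Up to the sign, a sample of height \<open>0\<close> in the closed cone over a cell is a recession direction of the
cell.
\<close>

lemma unbounded_along_sample:
  assumes \<pi>: "\<pi> \<in> cells n p X y" and g: "ordered \<pi> g" and flat: "g ! p = 0" and neg: "slope \<pi> g < 0"
  shows "\<not> bdd_below (F ` Rp p)"
proof
  assume "bdd_below (F ` Rp p)"
  then obtain B where B: "\<And>\<beta>. \<beta> \<in> Rp p \<Longrightarrow> B \<le> F \<beta>" by (auto simp: bdd_below_def)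
  obtain \<beta> where "\<beta> \<in> strict_C_of n p X y \<pi>" using cell_imp_strict[OF rows_distinct \<pi>] by blast
  then have \<beta>: "\<beta> \<in> C \<pi>" using strict_C_of_subset by blast
  have len: "length g = Suc p" using g length_S by (simp add: ordered_def)
  define \<gamma> where "\<gamma> t j = (if j < p then \<beta> j - t * real_of_int (g ! j) else 0)" for t :: real and j
  have \<gamma>: "\<gamma> t \<in> Rp p" for t by (simp add: \<gamma>_def topspace_Euclidean_space)
  have res_\<gamma>: "res (\<gamma> t) i = res \<beta> i + t * (row_at i g / D)" if "i < n" for t i
  proof -
    have "row_at i g / real_of_int D = (\<Sum>j<p. X i j * real_of_int (g ! j))"
      using dot_row[OF that len] flat D_pos by simp
    then show ?thesis
      by (simp add: residual_def \<gamma>_def sum_distrib_left sum_subtractf algebra_simps)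
  qed
  have "\<gamma> t \<in> C \<pi>" if "0 \<le> t" for t
  proof -
    have "res (\<gamma> t) (\<pi> k) \<le> res (\<gamma> t) (\<pi> (Suc k))" if k: "Suc k < n" for k
    proof -
      have "real_of_int (dot (R ! \<pi> k) g) \<le> real_of_int (dot (R ! \<pi> (Suc k)) g)"
        using g k by (simp add: ordered_def)
      then have "t * (row_at (\<pi> k) g / D) \<le> t * (row_at (\<pi> (Suc k)) g / D)"
        using D_pos \<open>0 \<le> t\<close> by (intro mult_left_mono divide_right_mono) simp_all
      moreover have "res \<beta> (\<pi> k) \<le> res \<beta> (\<pi> (Suc k))" using \<beta> k by (simp add: C_of_def)
      ultimately show ?thesis using res_\<gamma> cell_less[OF \<pi>] k by simp
    qed
    then show ?thesis using \<gamma> by (simp add: C_of_def)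
  qed
  moreover define v where "v = (\<Sum>i<n. coef \<pi> i * res \<beta> i)"
  moreover have "(\<Sum>i<n. coef \<pi> i * res (\<gamma> t) i) = v + t * (slope \<pi> g / D)" for t
    by (simp add: v_def res_\<gamma> slope_def sum.distrib sum_distrib_left sum_divide_distrib algebra_simps)
  ultimately have le: "B \<le> v + t * (slope \<pi> g / D)" if "0 \<le> t" for t
    using in_GEN_value(1)[OF GEN \<gamma> \<pi>, of t] B[OF \<gamma>, of t] that by fastforce
  \<comment> \<open>A step at which the bound on \<open>F\<close> along the ray is at most \<open>B - 1\<close>.\<close>
  define t where "t = max 0 ((B - v - 1) / (slope \<pi> g / D))"
  have s: "slope \<pi> g / D < 0" using neg D_pos by (simp add: divide_neg_pos)
  have "(B - v - 1) / (slope \<pi> g / D) \<le> t" by (simp add: t_def)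
  then have "t * (slope \<pi> g / D) \<le> B - v - 1" using s by (simp only: neg_divide_le_eq)
  then show False using le[of t] by (simp add: t_def)
qed

text \<open>
The assumption says that the linear function of the cell minus \<open>m\<close>, homogenized, is nonnegative at the
samples in the closed cone over the cell; then it is nonnegative on the whole cone.
\<close>

lemma lower_bound_from_samples:
  fixes m :: real
  assumes bound: "\<And>\<pi> g. \<pi> \<in> cells n p X y \<Longrightarrow> ordered \<pi> g \<Longrightarrow> m * D * height g \<le> slope \<pi> g"
    and \<beta>: "\<beta> \<in> Rp p"
  shows "m \<le> F \<beta>"
proof -
  obtain \<pi> where \<pi>: "\<pi> \<in> cells n p X y" "\<beta> \<in> C \<pi>" and F: "F \<beta> = (\<Sum>i<n. coef \<pi> i * res \<beta> i)"
    using in_GEN_value(2)[OF GEN \<beta>] by blast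
  \<comment> \<open>Index \<open>n\<close> stands for the height functional, which homogenizes the constant \<open>m\<close>.\<close>
  define u where "u i = (if i < n then real_vec (R ! i) else real_vec (replicate p 0 @ [1]))" for i
  define c where "c i = (if i < n then coef \<pi> i else - (m * D))" for i
  have "length (u i) = Suc p" if "i < Suc n" for i using that length_nth by (simp add: u_def)
  from linear_combination_dot[where u = u and c = c, OF this]
  obtain L where L: "length L = Suc p"
    "\<And>z. length z = Suc p \<Longrightarrow> dot L z = (\<Sum>i<Suc n. c i * dot (u i) z)" by blast
  have height_dot: "dot (real_vec (replicate p 0 @ [1])) z = z ! p" if "length z = Suc p" for z :: "real list"
    using dot_height[OF that] by simp
  have dot_L: "dot L z = (\<Sum>i<n. coef \<pi> i * dot (real_vec (R ! i)) z) - m * D * z ! p"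
    if "length z = Suc p" for z :: "real list"
    using L(2)[OF that] height_dot[OF that] by (simp add: u_def c_def)
  have "0 \<le> dot L (homogenize p \<beta>)"
  proof (rule nonneg_on_samples_imp_nonneg[OF length_H _ L(1)])
    fix s assume s: "s \<in> S" and cl: "real_vec s \<in> face_closure H (homogenize p \<beta>)"
    have len: "length s = Suc p" using length_S[OF s] .
    have "homogenize p \<beta> ! p = 1" by (simp add: homogenize_def nth_append)
    then have "0 \<le> dot (real_vec (replicate p 0 @ [1])) (real_vec s)"
      using cl height_dot[of "homogenize p \<beta>"] unfolding face_closure_def set_H by auto
    then have "0 \<le> s ! p" using height_dot[of "real_vec s"] len by simp
    moreover have "dot (R ! \<pi> k) s \<le> dot (R ! \<pi> (Suc k)) s" if k: "Suc k < n" for k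
    proof -
      have lt: "\<pi> k < n" "\<pi> (Suc k) < n" using cell_less[OF \<pi>(1)] k by simp_all
      let ?h = "subtract (R ! \<pi> k) (R ! \<pi> (Suc k))"
      have "res \<beta> (\<pi> k) \<le> res \<beta> (\<pi> (Suc k))" using \<pi>(2) k by (simp add: C_of_def)
      then have "dot (real_vec ?h) (homogenize p \<beta>) \<le> 0"
        using D_pos lt by (simp add: real_dot_subtract length_nth dot_homogenize)
      moreover have "?h \<in> set H" using lt unfolding set_H by blast
      ultimately have "dot (real_vec ?h) (real_vec s) \<le> 0"
        using cl unfolding face_closure_def by blast
      then show ?thesis using lt len by (simp add: dot_real_vec dot_subtract length_nth)
    qed
    ultimately have "ordered \<pi> s" using s by (simp add: ordered_def)
    from bound[OF \<pi>(1) this] show "0 \<le> dot L (real_vec s)"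
      using len by (simp add: dot_L slope_def dot_real_vec)
  qed simp
  also have "dot L (homogenize p \<beta>) = D * (F \<beta> - m)"
    by (simp add: dot_L dot_homogenize F homogenize_def nth_append sum_distrib_left algebra_simps)
      (simp add: dot_homogenize[unfolded homogenize_def] sum_distrib_left algebra_simps)
  finally show ?thesis using D_pos by (simp add: zero_le_mult_iff)
qed

lemma last_nth: "length s = Suc p \<Longrightarrow> last s = s ! p"
  by (cases s rule: rev_cases) auto

lemma mem_cell_samples:
  "(q, l) \<in> set (cell_samples p R) \<longleftrightarrow>
    q \<in> S \<and> 0 < q ! p \<and> length (ranking R q) = n \<and> l = ranking R q"
  unfolding cell_samples_def using length_S by (auto simp: length_R last_nth)

lemma cell_sample_sound:
  assumes "(q, l) \<in> set (cell_samples p R)"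
  shows "perm_of n l \<in> cells n p X y" and "encode l = enc_perm n (perm_of n l)"
    and "Suc k < n \<Longrightarrow> dot (R ! perm_of n l k) q < dot (R ! perm_of n l (Suc k)) q"
proof -
  have q: "q \<in> S" "0 < q ! p" "length (ranking R q) = n" and l: "l = ranking R q"
    using assms unfolding mem_cell_samples by auto
  note perm = ranking_permutation[OF length_R q(3), folded l]
  show "encode l = enc_perm n (perm_of n l)" by (rule perm)
  show "dot (R ! perm_of n l k) q < dot (R ! perm_of n l (Suc k)) q" if "Suc k < n" for k
    using perm(3)[OF that] .
  have "res (dehomogenize p q) (perm_of n l k) < res (dehomogenize p q) (perm_of n l (Suc k))"
    if k: "Suc k < n" for k
  proof -
    have lt: "perm_of n l k < n" "perm_of n l (Suc k) < n"
      using permutes_in_image[OF perm(1)] k by simp_all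
    have "real_of_int (dot (R ! perm_of n l k) q) < real_of_int (dot (R ! perm_of n l (Suc k)) q)"
      using perm(3)[OF k] by simp
    moreover have "0 < real_of_int D * height q" using q(2) D_pos by simp
    ultimately show ?thesis
      using dot_row_point[OF lt(1) length_S[OF q(1)]] dot_row_point[OF lt(2) length_S[OF q(1)]] q(2)
      by (simp add: mult_less_cancel_left_pos)
  qed
  then have "dehomogenize p q \<in> strict_C_of n p X y (perm_of n l)"
    using dehomogenize_in_Rp by (simp add: strict_C_of_def)
  then show "perm_of n l \<in> cells n p X y" by (rule strict_imp_cell[OF perm(1)])
qed

text \<open>
A point with strictly ordered residuals lies in an open face of the arrangement; the sample in
that face has the same ranking.
\<close>

lemma cell_sample_complete:
  assumes \<pi>: "\<pi> \<in> cells n p X y"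
  shows "\<exists>q l. (q, l) \<in> set (cell_samples p R) \<and> perm_of n l = \<pi>"
proof -
  obtain \<beta> where \<beta>: "\<beta> \<in> strict_C_of n p X y \<pi>" using cell_imp_strict[OF rows_distinct \<pi>] by blast
  obtain q where q: "q \<in> S"
    and sgn: "\<And>h. h \<in> set H \<Longrightarrow> sgn (dot (real_vec h) (real_vec q)) = sgn (dot (real_vec h) (homogenize p \<beta>))"
    using samples_meet_every_face[OF length_H length_homogenize, of \<beta>] by blast
  have len: "length q = Suc p" using length_S[OF q] .
  have "sgn (real_of_int (q ! p)) = 1"
    using sgn[of "replicate p 0 @ [1]"] dot_height[of "real_vec q" p] dot_height[of "homogenize p \<beta>" p] len
    unfolding set_H by (simp add: homogenize_def nth_append)
  then have pos: "0 < q ! p" by (simp add: sgn_1_pos)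
  have diff: "sgn (row_at i q - row_at k q) = sgn (res \<beta> i - res \<beta> k)"
    if "i < n" "k < n" for i k
  proof -
    have "subtract (R ! i) (R ! k) \<in> set H" using that unfolding set_H by blast
    from sgn[OF this] have "sgn (row_at i q - row_at k q) = sgn (D * (res \<beta> i - res \<beta> k))"
      using that len
      by (simp add: real_dot_subtract dot_subtract length_nth dot_homogenize dot_real_vec algebra_simps)
    then show ?thesis using D_pos by (simp add: sgn_mult)
  qed
  have strict: "dot (R ! \<pi> k) q < dot (R ! \<pi> (Suc k)) q" if k: "Suc k < n" for k
  proof -
    have "res \<beta> (\<pi> k) < res \<beta> (\<pi> (Suc k))" using \<beta> k by (simp add: strict_C_of_def)
    then have "sgn (row_at (\<pi> k) q - row_at (\<pi> (Suc k)) q) = - 1"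
      using diff[of "\<pi> k" "\<pi> (Suc k)"] cell_less[OF \<pi>] k by simp
    then show ?thesis by (simp add: sgn_1_neg)
  qed
  have "dot (R ! i) q \<noteq> dot (R ! k) q" if ik: "i < n" "k < n" "i \<noteq> k" for i k
  proof -
    obtain b c where bc: "b < n" "i = \<pi> b" "c < n" "k = \<pi> c"
      using ik(1,2) permutes_image[OF cell_permutes[OF \<pi>]] by (metis imageE lessThan_iff)
    then have "b \<noteq> c" using ik(3) by blast
    then have "real_of_int (dot (R ! \<pi> b) q) \<noteq> real_of_int (dot (R ! \<pi> c) q)"
      using chain_less[of n "\<lambda>k. real_of_int (dot (R ! \<pi> k) q)"] strict bc(1,3)
      by (metis less_irrefl linorder_neqE_nat of_int_less_iff)
    then show ?thesis using bc by simp
  qed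
  then have rank: "length (ranking R q) = n" by (rule length_ranking[OF length_R])
  have "(q, ranking R q) \<in> set (cell_samples p R)"
    unfolding mem_cell_samples using q pos rank by simp
  moreover have "perm_of n (ranking R q) = \<pi>"
    using ranking_permutation[OF length_R rank] cell_permutes[OF \<pi>] strict
    by (intro sorting_permutation_unique[where v = "\<lambda>i. real_of_int (dot (R ! i) q)" and n = n]) simp_all
  ultimately show ?thesis by blast
qed

text \<open>
No functional comparing different rows vanishes at \<open>q\<close>, so the products determine the signs required
of \<open>g\<close>.
\<close>

lemma compatible_iff_ordered:
  assumes q: "(q, l) \<in> set (cell_samples p R)" and g: "g \<in> S"
  shows "(\<forall>h\<in>set H. 0 \<le> dot h q * dot h g) \<longleftrightarrow> ordered (perm_of n l) g"
proof -
  define \<pi> where "\<pi> = perm_of n l"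
  have \<pi>: "\<pi> \<in> cells n p X y" and strict: "\<And>k. Suc k < n \<Longrightarrow> dot (R ! \<pi> k) q < dot (R ! \<pi> (Suc k)) q"
    using cell_sample_sound[OF q] by (simp_all add: \<pi>_def)
  have qS: "q \<in> S" "0 < q ! p" using q unfolding mem_cell_samples by auto
  have len: "length q = Suc p" "length g = Suc p" using length_S qS g by blast+
  show ?thesis
    unfolding \<pi>_def[symmetric]
  proof
    assume all: "\<forall>h\<in>set H. 0 \<le> dot h q * dot h g"
    have "0 \<le> dot (replicate p 0 @ [1]) q * dot (replicate p 0 @ [1]) g"
      using all unfolding set_H by blast
    then have "0 \<le> g ! p" using qS(2) len by (simp add: dot_height zero_le_mult_iff)
    moreover have "dot (R ! \<pi> k) g \<le> dot (R ! \<pi> (Suc k)) g" if k: "Suc k < n" for k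
    proof -
      have lt: "\<pi> k < n" "\<pi> (Suc k) < n" using cell_less[OF \<pi>] k by simp_all
      have "subtract (R ! \<pi> k) (R ! \<pi> (Suc k)) \<in> set H" using lt unfolding set_H by blast
      with all have "0 \<le> (dot (R ! \<pi> k) q - dot (R ! \<pi> (Suc k)) q) * (dot (R ! \<pi> k) g - dot (R ! \<pi> (Suc k)) g)"
        using lt len by (auto simp: dot_subtract length_nth dest!: bspec)
      then show ?thesis using strict[OF k] by (simp add: zero_le_mult_iff)
    qed
    ultimately show "ordered \<pi> g" using g by (simp add: ordered_def)
  next
    assume ord: "ordered \<pi> g"
    have "0 \<le> (dot (R ! i) q - dot (R ! k) q) * (dot (R ! i) g - dot (R ! k) g)"
      if ik: "i < n" "k < n" for i k
    proof -
      obtain b c where bc: "b < n" "i = \<pi> b" "c < n" "k = \<pi> c"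
        using ik permutes_image[OF cell_permutes[OF \<pi>]] by (metis imageE lessThan_iff)
      have mono_q: "dot (R ! \<pi> b) q \<le> dot (R ! \<pi> c) q" if "b \<le> c" "c < n" for b c
        using chain_le[of n "\<lambda>k. real_of_int (dot (R ! \<pi> k) q)", OF _ that] strict by (simp add: less_imp_le)
      have mono_g: "dot (R ! \<pi> b) g \<le> dot (R ! \<pi> c) g" if "b \<le> c" "c < n" for b c
        using chain_le[of n "\<lambda>k. real_of_int (dot (R ! \<pi> k) g)", OF _ that] ord by (simp add: ordered_def)
      show ?thesis
        using mono_q[of b c] mono_q[of c b] mono_g[of b c] mono_g[of c b] bc
        by (cases b c rule: le_cases) (simp_all add: mult_nonpos_nonpos)
    qed
    then show "\<forall>h\<in>set H. 0 \<le> dot h q * dot h g"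
      using ord qS(2) len unfolding set_H ordered_def
      by (auto simp: dot_height dot_subtract length_nth)
  qed
qed

text \<open>
The list \<open>K\<close> holds, for every cell and every sample in the closed cone over it, numerator and denominator
of the value, up to a common positive factor \<open>c\<close>.
\<close>

lemma select_optimum_correct:
  assumes sound: "\<And>g N E. (g, N, E) \<in> set K \<Longrightarrow>
      \<exists>\<pi>\<in>cells n p X y. ordered \<pi> g \<and> (\<exists>c>0. real_of_int N = c * slope \<pi> g \<and> real_of_int E = c * D * height g)"
    and complete: "\<And>\<pi> g. \<pi> \<in> cells n p X y \<Longrightarrow> ordered \<pi> g \<Longrightarrow>
      \<exists>N E. (g, N, E) \<in> set K \<and> (\<exists>c>0. real_of_int N = c * slope \<pi> g \<and> real_of_int E = c * D * height g)"
  shows "minimization_result p F (encode (select_optimum K))"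
proof (cases "\<forall>c\<in>set K. snd (snd c) = 0 \<longrightarrow> 0 \<le> fst (snd c)")
  case False
  then obtain g N where "(g, N, 0) \<in> set K" "N < 0" by force
  from sound[OF this(1)] obtain \<pi> c where \<pi>: "\<pi> \<in> cells n p X y" "ordered \<pi> g" "(c :: real) > 0"
    "real_of_int N = c * slope \<pi> g" "0 = c * D * height g" by auto
  have "g ! p = 0" using \<pi>(3,5) D_pos by simp
  moreover have "c * slope \<pi> g < 0" using \<pi>(4) \<open>N < 0\<close> by linarith
  then have "slope \<pi> g < 0" using \<pi>(3) by (simp add: mult_less_0_iff)
  ultimately have "\<not> bdd_below (F ` Rp p)" using unbounded_along_sample[OF \<pi>(1,2)] by blast
  moreover have "select_optimum K = None" using False by (simp only: select_optimum_def if_False)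
  ultimately show ?thesis by (simp add: minimization_result_def)
next
  case True
  define K' where "K' = filter (\<lambda>c. 0 < snd (snd c)) K"
  define ratio where "ratio c = real_of_int (fst (snd c)) / real_of_int (snd (snd c))" for c :: "int list \<times> int \<times> int"
  have ratio: "fst (snd b) * snd (snd c) \<le> fst (snd c) * snd (snd b) \<longleftrightarrow> ratio b \<le> ratio c"
    if "b \<in> set K'" "c \<in> set K'" for b c
  proof -
    have "0 < snd (snd b)" "0 < snd (snd c)" using that by (auto simp: K'_def)
    then show ?thesis
      unfolding ratio_def by (simp add: field_simps flip: of_int_mult)
  qed
  \<comment> \<open>Samples inside cells have positive height; hence there are candidates of positive denominator.\<close>
  have "\<exists>\<pi>. \<pi> \<in> cells n p X y"
    using cells_cover[OF rows_distinct, of "\<lambda>_. 0"] by (auto simp: topspace_Euclidean_space)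
  then obtain \<pi>0 q l where \<pi>0: "\<pi>0 \<in> cells n p X y" "(q, l) \<in> set (cell_samples p R)" "perm_of n l = \<pi>0"
    using cell_sample_complete by blast
  have q: "q \<in> S" "0 < q ! p" using \<pi>0(2) unfolding mem_cell_samples by auto
  have "ordered \<pi>0 q"
    using compatible_iff_ordered[OF \<pi>0(2) q(1)] \<pi>0(3) by simp
  from complete[OF \<pi>0(1) this] obtain N0 E0 c0 where K0: "(q, N0, E0) \<in> set K" "(c0 :: real) > 0"
    "real_of_int E0 = c0 * D * height q" by blast
  have "0 < real_of_int E0" using K0(2,3) q(2) D_pos by simp
  then have "(q, N0, E0) \<in> set K'" using K0(1) by (simp add: K'_def)
  then have "K' \<noteq> []" by auto
  then obtain b where b: "b \<in> set K'" "\<And>c. c \<in> set K' \<Longrightarrow> ratio b \<le> ratio c"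
    using finite_has_min[of "set K'" ratio] by auto
  have "\<forall>c\<in>set K'. fst (snd b) * snd (snd c) \<le> fst (snd c) * snd (snd b)"
    using ratio b by blast
  then have "filter (\<lambda>c. \<forall>c'\<in>set K'. fst (snd c) * snd (snd c') \<le> fst (snd c') * snd (snd c)) K' \<noteq> []"
    using b(1) unfolding filter_empty_conv by blast
  from hd_in_set[OF this] have least: "least_candidate K' \<in> set K'"
    "\<And>c. c \<in> set K' \<Longrightarrow> ratio (least_candidate K') \<le> ratio c"
    unfolding least_candidate_def by (auto simp: ratio)
  obtain g N E where K'E: "least_candidate K' = (g, N, E)" by (metis surj_pair)
  define m where "m = ratio (g, N, E)"
  have gK: "(g, N, E) \<in> set K" "0 < E" using least(1) unfolding K'E by (auto simp: K'_def)
  from sound[OF gK(1)] obtain \<pi> c where \<pi>: "\<pi> \<in> cells n p X y" "ordered \<pi> g" "(c :: real) > 0"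
    "real_of_int N = c * slope \<pi> g" "real_of_int E = c * D * height g" by auto
  have len: "length g = Suc p" using \<pi>(2) length_S by (simp add: ordered_def)
  have "0 < c * D * height g" using gK(2) \<pi>(5) by linarith
  moreover have "0 < c * D" using \<pi>(3) D_pos by simp
  ultimately have pos: "0 < g ! p" using zero_less_mult_pos by fastforce
  have m: "m = slope \<pi> g / (D * height g)" using \<pi>(3-5) by (simp add: m_def ratio_def)
  have lower: "m \<le> F \<beta>" if "\<beta> \<in> Rp p" for \<beta>
  proof (rule lower_bound_from_samples[OF _ that])
    fix \<sigma> h assume \<sigma>: "\<sigma> \<in> cells n p X y" "ordered \<sigma> h"
    from complete[OF this] obtain N' E' d where K: "(h, N', E') \<in> set K" "(d :: real) > 0"
      "real_of_int N' = d * slope \<sigma> h" "real_of_int E' = d * D * height h" by auto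
    have h: "0 \<le> h ! p" using \<sigma>(2) by (simp add: ordered_def)
    show "m * D * height h \<le> slope \<sigma> h"
    proof (cases "h ! p = 0")
      case zero: True
      then have "E' = 0" using K(4) by simp
      then have "0 \<le> N'" using True K(1) by force
      then have "0 \<le> d * slope \<sigma> h" unfolding K(3)[symmetric] by simp
      then show ?thesis using zero K(2) by (simp add: zero_le_mult_iff)
    next
      case False
      then have pos': "0 < h ! p" using h by simp
      then have "0 < d * D * height h" using K(2) D_pos by simp
      then have "0 < E'" unfolding K(4)[symmetric] by simp
      then have "m \<le> ratio (h, N', E')"
        using least(2)[of "(h, N', E')"] K(1) unfolding K'E m_def by (simp add: K'_def)
      also have "\<dots> = slope \<sigma> h / (D * height h)" using K(2-4) by (simp add: ratio_def)
      finally show ?thesis using pos' D_pos by (simp add: field_simps)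
    qed
  qed
  have "F (dehomogenize p g) = m"
    using F_le_at_sample[OF \<pi>(1,2) pos] lower[OF dehomogenize_in_Rp, of g] unfolding m by linarith
  then have value_rep: "represents (encode (N, E)) (F (dehomogenize p g))"
    using gK(2) by (auto simp: represents_def m_def ratio_def)
  define pt where "pt = map (\<lambda>x. (- x, last g)) (butlast g)"
  have "represents (map encode pt ! j) (dehomogenize p g j)" if "j < p" for j
  proof -
    have "map encode pt ! j = encode (- (g ! j), g ! p)"
      using that len by (simp add: pt_def nth_butlast last_nth del: encode_simps)
    then show ?thesis using that pos by (auto simp: represents_def dehomogenize_def)
  qed
  then have "represents_point p (encode pt) (dehomogenize p g)"
    unfolding represents_point_def using dehomogenize_in_Rp len
    by (auto simp: encode_list_def pt_def intro!: exI[of _ "map encode pt"])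
  moreover have "select_optimum K = Some (pt, N, E)"
    using True K'E by (simp add: select_optimum_def K'_def pt_def)
  ultimately show ?thesis
    using value_rep lower unfolding minimization_result_def \<open>F (dehomogenize p g) = m\<close>[symmetric]
    by auto
qed

end

section \<open>Rational data\<close>

lemma set_insert_all: "set (foldr List.insert xs []) = set xs"
  by (induction xs) auto

lemma distinct_insert_all: "distinct (foldr List.insert xs [])"
  by (induction xs) (auto simp: distinct_insert)

lemma prod_list_split:
  fixes b :: int
  assumes "distinct B" "b \<in> set B"
  shows "prod_list B = b * prod_list (filter (\<lambda>c. \<not> c = b) B)"
  using assms
proof (induction B)
  case (Cons c B)
  show ?case
  proof (cases "c = b")
    case True
    then have "filter (\<lambda>c. \<not> c = b) B = B" using Cons.prems(1) by (auto simp: filter_id_conv)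
    then show ?thesis using True by simp
  next
    case False
    then show ?thesis using Cons by simp
  qed
qed simp

lemma set_denominators: "set (denominators M) = (\<Union>r\<in>set M. snd ` set r)"
  by (auto simp: denominators_def set_insert_all)

lemma common_denominator_pos:
  assumes "\<And>r q. r \<in> set M \<Longrightarrow> q \<in> set r \<Longrightarrow> 0 < snd q"
  shows "0 < common_denominator M"
proof -
  have "\<forall>b\<in>set (denominators M). 0 < b" using assms by (auto simp: set_denominators)
  then have "0 < prod_list xs" if "set xs \<subseteq> set (denominators M)" for xs
    using that by (induction xs) auto
  then show ?thesis by (simp add: common_denominator_def)
qed

lemma length_clear_denominators [simp]:
  "length (clear_denominators M) = length M"
  "i < length M \<Longrightarrow> length (clear_denominators M ! i) = length (M ! i)"
  by (simp_all add: clear_denominators_def)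

lemma clear_denominators_entry:
  assumes i: "i < length M" and j: "j < length (M ! i)" and pos: "0 < snd (M ! i ! j)"
  shows "real_of_int (clear_denominators M ! i ! j) =
    real_of_int (common_denominator M) * (real_of_int (fst (M ! i ! j)) / real_of_int (snd (M ! i ! j)))"
proof -
  define q where "q = M ! i ! j"
  have "M ! i \<in> set M" "q \<in> set (M ! i)" using i j by (simp_all add: q_def)
  then have "snd q \<in> set (denominators M)" unfolding set_denominators by blast
  from prod_list_split[OF _ this] have
    "common_denominator M = snd q * prod_list (filter (\<lambda>c. \<not> c = snd q) (denominators M))"
    unfolding common_denominator_def denominators_def by (simp add: distinct_insert_all)
  moreover have "clear_denominators M ! i ! j = fst q * prod_list (filter (\<lambda>c. \<not> c = snd q) (denominators M))"
    using i j by (simp add: clear_denominators_def q_def)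
  ultimately show ?thesis using pos by (simp add: q_def)
qed

definition fractions :: "nat \<Rightarrow> (nat \<Rightarrow> rat) \<Rightarrow> (int \<times> int) list" where
  "fractions n v = map (\<lambda>i. quotient_of (v i)) [0..<n]"

definition data_matrix :: "nat \<Rightarrow> nat \<Rightarrow> (nat \<Rightarrow> nat \<Rightarrow> rat) \<Rightarrow> (nat \<Rightarrow> rat) \<Rightarrow> (int \<times> int) list list" where
  "data_matrix n p X y = map (\<lambda>i. fractions (Suc p) (\<lambda>j. if j < p then X i j else y i)) [0..<n]"

lemma encode_fractions: "encode (fractions n v) = enc_vec n v"
proof -
  have "encode (quotient_of q) = enc_rat q" for q
    by (cases "quotient_of q") (simp add: enc_rat_def)
  then show ?thesis by (simp add: encode_list_def fractions_def enc_vec_def comp_def)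
qed

lemma encode_data_matrix: "encode (data_matrix n p X y) = enc_data n p X y"
proof -
  have "enc_data n p X y =
      enc_list (map (\<lambda>i. encode (fractions (Suc p) (\<lambda>j. if j < p then X i j else y i))) [0..<n])"
    unfolding enc_data_def encode_fractions ..
  also have "\<dots> = enc_list (map encode (data_matrix n p X y))"
    unfolding data_matrix_def map_map comp_def ..
  also have "\<dots> = encode (data_matrix n p X y)" by (rule encode_list_def[symmetric])
  finally show ?thesis by (rule sym)
qed

lemma sz_map_upt: "sz (map f [0..<n]) = 2 + (\<Sum>i<n. 1 + sz (f i))"
proof (induction n)
  case (Suc n)
  then show ?case using sz_append[of "map f [0..<n]" "[f n]"] by simp
qed simp

lemma rat_bits_ge_3: "3 \<le> rat_bits q"
  using bin_digits_pos[of "nat \<bar>fst (quotient_of q)\<bar>"] bin_digits_pos[of "nat (snd (quotient_of q))"]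
  by (simp add: rat_bits_def split_beta)

lemma sz_quotient: "sz (quotient_of q) = 2 + rat_bits q"
  using quotient_of_denom_pos'[of q] by (simp add: rat_bits_def split_beta sz_prod abs_of_pos)

lemma sz_fractions: "sz (fractions n v) \<le> 2 + 2 * vec_bits n v"
proof -
  have "(\<Sum>i<n. 1 + sz (quotient_of (v i))) \<le> (\<Sum>i<n. 2 * rat_bits (v i))"
  proof (rule sum_mono)
    fix i show "1 + sz (quotient_of (v i)) \<le> 2 * rat_bits (v i)"
      using rat_bits_ge_3[of "v i"] unfolding sz_quotient by simp
  qed
  then show ?thesis unfolding fractions_def sz_map_upt by (simp add: vec_bits_def sum_distrib_left)
qed

lemma sz_data_matrix: "sz (data_matrix n p X y) \<le> 2 + 3 * data_bits n p X y"
proof -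
  have "1 + sz (fractions (Suc p) (\<lambda>j. if j < p then X i j else y i))
      \<le> 3 * (vec_bits p (X i) + rat_bits (y i))" for i
  proof -
    have "vec_bits (Suc p) (\<lambda>j. if j < p then X i j else y i) = vec_bits p (X i) + rat_bits (y i)"
      by (simp add: vec_bits_def)
    then show ?thesis
      using sz_fractions[of "Suc p" "\<lambda>j. if j < p then X i j else y i"] rat_bits_ge_3[of "y i"] by simp
  qed
  then have "(\<Sum>i<n. 1 + sz (fractions (Suc p) (\<lambda>j. if j < p then X i j else y i)))
      \<le> (\<Sum>i<n. 3 * (vec_bits p (X i) + rat_bits (y i)))"
    by (intro sum_mono)
  then show ?thesis unfolding data_matrix_def sz_map_upt by (simp add: data_bits_def sum_distrib_left)
qed

lemma quotient_real: "real_of_int (fst (quotient_of q)) / real_of_int (snd (quotient_of q)) = real_of_rat q"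
proof -
  have "q = of_int (fst (quotient_of q)) / of_int (snd (quotient_of q))"
    by (rule quotient_of_div) simp
  then show ?thesis by (metis of_rat_divide of_rat_of_int_eq)
qed

lemma fractions_clear:
  assumes "length R = n"
  shows "0 < common_denominator [fractions n c]"
    and "real_of_int (objective R (fractions n c) g) =
      real_of_int (common_denominator [fractions n c]) * (\<Sum>i<n. real_of_rat (c i) * real_of_int (dot (R ! i) g))"
proof -
  define M where "M = [fractions n c]"
  show "0 < common_denominator [fractions n c]"
    by (rule common_denominator_pos) (auto simp: fractions_def quotient_of_denom_pos')
  have len: "length (clear_denominators M ! 0) = n" by (simp add: M_def fractions_def)
  have entry: "real_of_int (clear_denominators M ! 0 ! i) = real_of_int (common_denominator M) * real_of_rat (c i)"
    if "i < n" for i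
    using clear_denominators_entry[of 0 M i] that
    by (simp add: M_def fractions_def quotient_of_denom_pos' quotient_real)
  have "hd (clear_denominators M) = clear_denominators M ! 0"
    by (rule hd_conv_nth) (simp add: M_def clear_denominators_def)
  then have "objective R (fractions n c) g = (\<Sum>i<n. clear_denominators M ! 0 ! i * dot (R ! i) g)"
    unfolding objective_def M_def[symmetric] using len assms by (simp add: dot_eq_sum)
  then show "real_of_int (objective R (fractions n c) g) =
      real_of_int (common_denominator [fractions n c]) * (\<Sum>i<n. real_of_rat (c i) * real_of_int (dot (R ! i) g))"
    unfolding M_def[symmetric] by (simp add: entry sum_distrib_left mult.assoc)
qed

lemma scaled_GEN_data:
  assumes GEN: "in_GEN n p (\<lambda>i j. real_of_rat (X i j)) (\<lambda>i. real_of_rat (y i)) a F"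
  shows "scaled_GEN n p (\<lambda>i j. real_of_rat (X i j)) (\<lambda>i. real_of_rat (y i)) a F
    (clear_denominators (data_matrix n p X y)) (common_denominator (data_matrix n p X y))"
proof -
  define M R D where "M = data_matrix n p X y" and "R = clear_denominators M" and "D = common_denominator M"
  have M: "length M = n" "\<And>i. i < n \<Longrightarrow> length (M ! i) = Suc p"
    "\<And>i j. i < n \<Longrightarrow> j < Suc p \<Longrightarrow> M ! i ! j = quotient_of (if j < p then X i j else y i)"
    by (simp_all add: M_def data_matrix_def fractions_def del: upt_Suc)
  have entry: "real_of_int (R ! i ! j) = real_of_int D * real_of_rat (if j < p then X i j else y i)"
    if "i < n" "j < Suc p" for i j
    using clear_denominators_entry[of i M j] that M
    by (simp add: R_def D_def quotient_of_denom_pos' quotient_real)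
  have "scaled_GEN n p (\<lambda>i j. real_of_rat (X i j)) (\<lambda>i. real_of_rat (y i)) a F R D"
  proof
    show "length R = n" using M by (simp add: R_def)
    show "length r = Suc p" if "r \<in> set R" for r
      using that M by (auto simp: R_def in_set_conv_nth)
    show "0 < D" unfolding D_def
      by (rule common_denominator_pos)
        (auto simp: M_def data_matrix_def fractions_def simp del: upt_Suc intro: quotient_of_denom_pos[OF sym])
    show "real_of_int (R ! i ! j) = real_of_int D * real_of_rat (X i j)" if "i < n" "j < p" for i j
      using entry[of i j] that by simp
    show "real_of_int (R ! i ! p) = real_of_int D * real_of_rat (y i)" if "i < n" for i
      using entry[of i p] that by simp
  qed (rule GEN)
  then show ?thesis unfolding R_def D_def M_def .
qed

lemma cell_samples_are_cells:
  assumes "in_GEN n p (\<lambda>i j. real_of_rat (X i j)) (\<lambda>i. real_of_rat (y i)) a F"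
    and "(q, l) \<in> set (cell_samples p (clear_denominators (data_matrix n p X y)))"
  shows "perm_of n l \<in> cells n p (\<lambda>i j. real_of_rat (X i j)) (\<lambda>i. real_of_rat (y i))"
    and "encode l = enc_perm n (perm_of n l)"
  using scaled_GEN.cell_sample_sound(1,2)[OF scaled_GEN_data] assms by blast+

text \<open>
The list \<open>A\<close> is what remains of the samples in cells once each permutation has been replaced by the
answer of the oracle.
\<close>

lemma candidates_optimal:
  fixes n p :: nat and X :: "nat \<Rightarrow> nat \<Rightarrow> rat" and y :: "nat \<Rightarrow> rat"
    and a :: "(nat \<Rightarrow> real) \<Rightarrow> nat \<Rightarrow> rat"
  defines "M \<equiv> data_matrix n p X y"
  assumes GEN: "in_GEN n p (\<lambda>i j. real_of_rat (X i j)) (\<lambda>i. real_of_rat (y i)) (\<lambda>\<beta> i. real_of_rat (a \<beta> i)) F"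
    and A: "set A = (\<lambda>z. (fst z, fractions n (cell_coef n p (\<lambda>i j. real_of_rat (X i j)) (\<lambda>i. real_of_rat (y i)) a
      (perm_of n (snd z))))) ` set (cell_samples p (clear_denominators M))"
  shows "minimization_result p F (encode (select_optimum (candidates p M A)))"
proof -
  define R D where "R = clear_denominators M" and "D = common_denominator M"
  interpret G: scaled_GEN n p "\<lambda>i j. real_of_rat (X i j)" "\<lambda>i. real_of_rat (y i)"
    "\<lambda>\<beta> i. real_of_rat (a \<beta> i)" F R D
    unfolding R_def D_def M_def by (rule scaled_GEN_data[OF GEN])
  define coef where "coef = cell_coef n p (\<lambda>i j. real_of_rat (X i j)) (\<lambda>i. real_of_rat (y i)) a"
  have coef: "cell_coef n p (\<lambda>i j. real_of_rat (X i j)) (\<lambda>i. real_of_rat (y i)) (\<lambda>\<beta> i. real_of_rat (a \<beta> i)) \<pi> i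
      = real_of_rat (coef \<pi> i)" for \<pi> i
    by (simp add: coef_def cell_coef_def)
  define cand where "cand l g = (g, objective R (fractions n (coef (perm_of n l))) g,
      common_denominator [fractions n (coef (perm_of n l))] * D * last g)" for l g
  have mem: "k \<in> set (candidates p M A) \<longleftrightarrow>
      (\<exists>q l g. (q, l) \<in> set (cell_samples p R) \<and> G.ordered (perm_of n l) g \<and> k = cand l g)" for k
  proof -
    have each: "set (cell_candidates p M (q, fractions n (coef (perm_of n l)))) =
        cand l ` {g \<in> G.S. \<forall>h\<in>set G.H. 0 \<le> dot h q * dot h g}" for q l
      by (simp add: cell_candidates_def cand_def R_def D_def)
    have "set (candidates p M A) = (\<Union>c\<in>set A. set (cell_candidates p M c))"
      by (simp add: candidates_def)
    also have "\<dots> = (\<Union>z\<in>set (cell_samples p R). set (cell_candidates p M (fst z, fractions n (coef (perm_of n (snd z))))))"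
      unfolding A coef_def R_def by simp
    finally have "k \<in> set (candidates p M A) \<longleftrightarrow> (\<exists>q l g. (q, l) \<in> set (cell_samples p R) \<and>
        (g \<in> G.S \<and> (\<forall>h\<in>set G.H. 0 \<le> dot h q * dot h g)) \<and> k = cand l g)"
      unfolding each by (simp add: image_iff Bex_def) blast
    also have "\<dots> \<longleftrightarrow> (\<exists>q l g. (q, l) \<in> set (cell_samples p R) \<and> G.ordered (perm_of n l) g \<and> k = cand l g)"
      using G.compatible_iff_ordered by (metis G.ordered_def)
    finally show ?thesis .
  qed
  have val: "\<exists>c>0. real_of_int (fst (snd (cand l g))) = c * G.slope (perm_of n l) g \<and>
      real_of_int (snd (snd (cand l g))) = c * D * real_of_int (g ! p)"
    if "G.ordered (perm_of n l) g" for l g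
  proof (intro exI[of _ "real_of_int (common_denominator [fractions n (coef (perm_of n l))])"] conjI)
    have "length g = Suc p" using that G.length_S by (simp add: G.ordered_def)
    then show "real_of_int (snd (snd (cand l g))) =
        real_of_int (common_denominator [fractions n (coef (perm_of n l))]) * D * real_of_int (g ! p)"
      by (simp add: cand_def G.last_nth)
    show "real_of_int (fst (snd (cand l g))) =
        real_of_int (common_denominator [fractions n (coef (perm_of n l))]) * G.slope (perm_of n l) g"
      using fractions_clear(2)[OF G.length_R] by (simp add: cand_def G.slope_def coef)
  qed (use fractions_clear(1)[OF G.length_R] in simp)
  show ?thesis
  proof (rule G.select_optimum_correct)
    fix g N E assume "(g, N, E) \<in> set (candidates p M A)"
    then obtain q l where l: "(q, l) \<in> set (cell_samples p R)" "G.ordered (perm_of n l) g" "(g, N, E) = cand l g"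
      unfolding mem by (auto simp: cand_def)
    then show "\<exists>\<pi>\<in>cells n p (\<lambda>i j. real_of_rat (X i j)) (\<lambda>i. real_of_rat (y i)). G.ordered \<pi> g \<and>
        (\<exists>c>0. real_of_int N = c * G.slope \<pi> g \<and> real_of_int E = c * D * real_of_int (g ! p))"
      using G.cell_sample_sound(1)[OF l(1)] val[OF l(2)] unfolding l(3)[symmetric] by auto
  next
    fix \<pi> g assume \<pi>: "\<pi> \<in> cells n p (\<lambda>i j. real_of_rat (X i j)) (\<lambda>i. real_of_rat (y i))" "G.ordered \<pi> g"
    obtain q l where l: "(q, l) \<in> set (cell_samples p R)" "perm_of n l = \<pi>"
      using G.cell_sample_complete[OF \<pi>(1)] by blast
    have "cand l g \<in> set (candidates p M A)" unfolding mem using l \<pi>(2) by blast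
    moreover have "cand l g = (g, fst (snd (cand l g)), snd (snd (cand l g)))" by (simp add: cand_def)
    ultimately show "\<exists>N E. (g, N, E) \<in> set (candidates p M A) \<and>
        (\<exists>c>0. real_of_int N = c * G.slope \<pi> g \<and> real_of_int E = c * D * real_of_int (g ! p))"
      using val[of l g] l(2) \<pi>(2) by metis
  qed
qed

section \<open>Minimization in polynomial time\<close>

theorem theorem3p3:
  fixes p :: nat
  shows "\<exists>alg :: prog. \<forall>coef_bound :: nat poly. \<exists>time_bound :: nat poly.
    \<forall>(n :: nat) (X :: nat \<Rightarrow> nat \<Rightarrow> rat) (y :: nat \<Rightarrow> rat)
      (a :: (nat \<Rightarrow> real) \<Rightarrow> nat \<Rightarrow> rat) (F :: (nat \<Rightarrow> real) \<Rightarrow> real) (Q :: val \<Rightarrow> val).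
      in_GEN n p (\<lambda>i j. real_of_rat (X i j)) (\<lambda>i. real_of_rat (y i))
        (\<lambda>\<beta> i. real_of_rat (a \<beta> i)) F \<longrightarrow>
      (\<forall>\<beta>\<in>Rp p. vec_bits n (a \<beta>) \<le> poly coef_bound (data_bits n p X y)) \<longrightarrow>
      answers_coefs n p (\<lambda>i j. real_of_rat (X i j)) (\<lambda>i. real_of_rat (y i)) a Q \<longrightarrow>
      (\<exists>out t. run Q alg (enc_data n p X y) out t \<and>
         t \<le> poly time_bound (data_bits n p X y) \<and>
         minimization_result p F out)"
proof -
  define prepare where "prepare M = (M, cell_samples p (clear_denominators M))" for M :: "(int \<times> int) list list"
  define finish where "finish z = select_optimum (candidates p (fst z) (snd z))"
    for z :: "(int \<times> int) list list \<times> (int list \<times> (int \<times> int) list) list"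
  have "polytime prepare" unfolding prepare_def by (intro polytime_intros polytime_id)
  then obtain c1 k1 where c1: "\<And>Q M. runs_within Q c1 (encode M) (encode (prepare M)) (sz M ^ k1)"
    unfolding polytime_def by blast
  have "polytime finish" unfolding finish_def by (intro polytime_intros polytime_id)
  then obtain c2 k2 where c2: "\<And>Q z. runs_within Q c2 (encode z) (encode (finish z)) (sz z ^ k2)"
    unfolding polytime_def by blast
  obtain d1 j1 where d1: "\<And>Q z. runs_within Q d1 (encode z)
      (encode (fst (z :: (int \<times> int) list list \<times> (int list \<times> int list) list))) (sz z ^ j1)"
    using polytime_fst[OF polytime_id] unfolding polytime_def by blast
  obtain d2 j2 where d2: "\<And>Q z. runs_within Q d2 (encode z)
      (encode (snd (z :: (int \<times> int) list list \<times> (int list \<times> int list) list))) (sz z ^ j2)"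
    using polytime_snd[OF polytime_id] unfolding polytime_def by blast
  obtain ask and P :: "nat poly" where ask:
    "\<And>Q A l W. (\<And>q \<pi>. (q :: int list, \<pi> :: int list) \<in> set l \<Longrightarrow>
        Q (encode \<pi>) = encode (A \<pi> :: (int \<times> int) list) \<and> sz (A \<pi>) \<le> W) \<Longrightarrow>
      runs_within Q ask (encode l) (encode (rev (map (\<lambda>z. (fst z, A (snd z))) l))) (poly P (W + sz l))"
    using ask_all[where 'a = "int list" and 'b = "int list" and 'c = "(int \<times> int) list"] by blast
  define alg where "alg = Seq c1 (Seq (Fork d1 (Seq d2 ask)) c2)"
  show ?thesis
  proof (intro exI[of _ alg] allI)
    fix coef_bound :: "nat poly"
    \<comment> \<open>Bounds, in terms of the bitsize of the data, for the time of the first phase, of the questions, and in total.\<close>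
    define T1 :: "nat poly" where "T1 = [:2, 3:] ^ k1"
    define T2 :: "nat poly" where
      "T2 = T1 ^ j1 + (T1 ^ j2 + pcompose P ([:2:] + smult 2 coef_bound + T1) + [:1:]) + T1 + [:1:]"
    define T :: "nat poly" where "T = T1 + (T2 + T2 ^ k2 + [:1:]) + [:1:]"
    show "\<exists>time_bound :: nat poly. \<forall>n X y a F Q.
      in_GEN n p (\<lambda>i j. real_of_rat (X i j)) (\<lambda>i. real_of_rat (y i))
        (\<lambda>\<beta> i. real_of_rat (a \<beta> i)) F \<longrightarrow>
      (\<forall>\<beta>\<in>Rp p. vec_bits n (a \<beta>) \<le> poly coef_bound (data_bits n p X y)) \<longrightarrow>
      answers_coefs n p (\<lambda>i j. real_of_rat (X i j)) (\<lambda>i. real_of_rat (y i)) a Q \<longrightarrow>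
      (\<exists>out t. run Q alg (enc_data n p X y) out t \<and>
         t \<le> poly time_bound (data_bits n p X y) \<and>
         minimization_result p F out)"
    proof (intro exI[of _ T] allI impI)
      fix n :: nat and X :: "nat \<Rightarrow> nat \<Rightarrow> rat" and y :: "nat \<Rightarrow> rat"
        and a :: "(nat \<Rightarrow> real) \<Rightarrow> nat \<Rightarrow> rat" and F :: "(nat \<Rightarrow> real) \<Rightarrow> real" and Q :: "val \<Rightarrow> val"
      let ?X = "\<lambda>i j. real_of_rat (X i j)" and ?y = "\<lambda>i. real_of_rat (y i)"
      define L where "L = data_bits n p X y"
      assume GEN: "in_GEN n p ?X ?y (\<lambda>\<beta> i. real_of_rat (a \<beta> i)) F"
        and bits: "\<forall>\<beta>\<in>Rp p. vec_bits n (a \<beta>) \<le> poly coef_bound (data_bits n p X y)"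
        and Q: "answers_coefs n p ?X ?y a Q"
      define M where "M = data_matrix n p X y"
      define l where "l = cell_samples p (clear_denominators M)"
      define A where "A \<pi> = fractions n (cell_coef n p ?X ?y a (perm_of n \<pi>))" for \<pi>
      define A' where "A' = rev (map (\<lambda>z. (fst z, A (snd z))) l)"
      define W where "W = 2 + 2 * poly coef_bound L"
      have answers: "Q (encode \<pi>) = encode (A \<pi>) \<and> sz (A \<pi>) \<le> W" if "(q, \<pi>) \<in> set l" for q \<pi>
      proof -
        have cell: "perm_of n \<pi> \<in> cells n p ?X ?y" and enc: "encode \<pi> = enc_perm n (perm_of n \<pi>)"
          using cell_samples_are_cells[OF GEN] that unfolding l_def M_def by blast+
        have "Q (encode \<pi>) = encode (A \<pi>)"
          using Q cell unfolding answers_coefs_def enc A_def encode_fractions by blast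
        moreover have "cell_interior n p ?X ?y (perm_of n \<pi>) \<noteq> {}" using cell by (simp add: cells_def)
        then have "(SOME \<beta>. \<beta> \<in> cell_interior n p ?X ?y (perm_of n \<pi>)) \<in> cell_interior n p ?X ?y (perm_of n \<pi>)"
          by (rule some_in_eq[THEN iffD2])
        then have "(SOME \<beta>. \<beta> \<in> cell_interior n p ?X ?y (perm_of n \<pi>)) \<in> Rp p"
          unfolding cell_interior_def by (rule subsetD[OF interior_of_subset_topspace])
        then have "vec_bits n (cell_coef n p ?X ?y a (perm_of n \<pi>)) \<le> poly coef_bound L"
          using bits unfolding cell_coef_def L_def by blast
        then have "sz (A \<pi>) \<le> W"
          using sz_fractions[of n "cell_coef n p ?X ?y a (perm_of n \<pi>)"] unfolding A_def W_def by simp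
        ultimately show ?thesis by blast
      qed
      have "sz M ^ k1 \<le> poly T1 L"
        unfolding T1_def poly_power by (rule power_mono) (use sz_data_matrix[of n p X y] in \<open>simp_all add: M_def L_def\<close>)
      with c1 have run1: "runs_within Q c1 (encode M) (encode (M, l)) (poly T1 L)"
        using runs_within_mono by (fastforce simp: prepare_def l_def)
      then have s1: "sz (M, l) \<le> poly T1 L" by (rule runs_within_size)
      have e1: "runs_within Q d1 (encode (M, l)) (encode M) (poly T1 L ^ j1)"
        using runs_within_mono[OF d1 power_mono[OF s1]] by fastforce
      have e2: "runs_within Q d2 (encode (M, l)) (encode l) (poly T1 L ^ j2)"
        using runs_within_mono[OF d2 power_mono[OF s1]] by fastforce
      have "runs_within Q ask (encode l) (encode A') (poly P (W + sz l))"
        unfolding A'_def by (rule ask) (rule answers)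
      moreover have "poly P (W + sz l) \<le> poly P (W + poly T1 L)"
        using s1 by (intro poly_nat_mono) simp
      ultimately have e3: "runs_within Q ask (encode l) (encode A') (poly P (W + poly T1 L))"
        by (rule runs_within_mono)
      have "runs_within Q (Fork d1 (Seq d2 ask)) (encode (M, l)) (encode (M, A')) (poly T2 L)"
        using runs_within_Fork[OF e1 runs_within_Seq[OF e2 e3]] s1
        by (auto elim!: runs_within_mono simp: T2_def poly_pcompose W_def)
      then have run2: "runs_within Q (Fork d1 (Seq d2 ask)) (encode (M, l)) (encode (M, A')) (poly T2 L)" .
      then have s2: "sz (M, A') \<le> poly T2 L" by (rule runs_within_size)
      have run3: "runs_within Q c2 (encode (M, A')) (encode (finish (M, A'))) (poly T2 L ^ k2)"
        using runs_within_mono[OF c2 power_mono[OF s2]] by fastforce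
      have "runs_within Q alg (encode M) (encode (finish (M, A'))) (poly T L)"
        using runs_within_Seq[OF run1 runs_within_Seq[OF run2 run3]] unfolding alg_def
        by (simp add: T_def)
      moreover have "minimization_result p F (encode (finish (M, A')))"
        unfolding finish_def fst_conv snd_conv M_def
        by (rule candidates_optimal[OF GEN]) (simp add: A'_def A_def l_def M_def)
      ultimately show "\<exists>out t. run Q alg (enc_data n p X y) out t \<and>
         t \<le> poly T (data_bits n p X y) \<and> minimization_result p F out"
        unfolding runs_within_def M_def encode_data_matrix L_def by blast
    qed
  qed
qed

end
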